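(* Let $p\in[1,\infty[$. (a) $\mathcal{L}^p_E(H)$ is a vector subspace of $\mathcal{K}_E(H)$ and the map $\mathcal{L}^p_E(H)\to\mathbb{R}_+$, $u\mapsto\|u\|_p$ is a norm. (b) $\mathcal{L}^p_E(H)$, endowed with this norm, is complete. (c) If $u\in\mathcal{L}^p_E(H)$ and $$u=\sum_{n\in\mathbb{N}}\theta_n(u)\,\xi_n\langle\,\cdot\,|\,\eta_n\rangle$$ is a Schatten decomposition of $u$ with $\xi_n,\eta_n\in H$ for all $n\in\mathbb{N}$, then this sum converges in $\mathcal{L}^p_E(H)$.
   Context: $\mathbb{K}$ is $\mathbb{R}$ or $\mathbb{C}$; $\mathbb{N}=\{1,2,\dots\}$. $T$ is a compact hyperstonian space and $E:=\mathcal{C}(T)$ is the commutative C*-algebra (in fact W*-algebra) of continuous $\mathbb{K}$-valued functions on $T$. $(p_\iota)_{\iota\in I}$ is a family of projections of $E$. $K$ is the selfdual Hilbert right $E$-module given by the W*-direct sum of the $p_\iota E$: families $\xi=(\xi_\iota)_{\iota\in I}$ with $\xi_\iota\in p_\iota E$ for which the finite partial sums of $\sum_\iota \xi_\iota^*\xi_\iota$ are bounded, with $\langle\xi|\eta\rangle=\sum_{\iota}\eta_\iota^*\xi_\iota$ (weak* sum in $E$). $H\subset K$ is the C*-direct sum of the $p_\iota E$: families for which $\sum_\iota\xi_\iota^*\xi_\iota$ is norm-summable in $E$. $\mathcal{L}_E(\cdot)$ denotes the C*-algebra of adjointable operators, $\mathcal{K}_E(\cdot)$ its C*-subalgebra of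 "compact" operators, i.e. the closed linear span of the operators $\xi\langle\cdot|\eta\rangle:\zeta\mapsto\xi\langle\zeta|\eta\rangle$; $\mathcal{K}_E(H)\subset\mathcal{K}_E(K)$ by letting $\xi\langle\cdot|\eta\rangle$ ($\xi,\eta\in H$) act on $K$. For $t\in T$ let $\psi:l^2(I)\to H$, $\zeta\mapsto(\zeta_\iota p_\iota)_\iota$; $\psi_t:H\to l^2(I)$, $\xi\mapsto(\xi_\iota(t))_\iota$; $\varphi_t u:=\psi_t\circ u\circ\psi\in\mathcal{L}(l^2(I))$ for $u\in\mathcal{L}_E(H)$. For $u\in\mathcal{K}_E(H)$, $t\mapsto\varphi_tu$ is continuous from $T$ into the compact operators on $l^2(I)$. For a compact operator $x$ on a Hilbert space, $\theta_n(x)$ is its $n$-th singular value (decreasing order, with multiplicity, completed by $0$); $\theta_n(u)\in E$ is the continuous function $t\mapsto\theta_n(\varphi_tu)$. For $\xi\in K$ put $\xi(t):=(\xi_\iota(t))_\iota\in l^2(I)$. Put $U_n(u):=\{t\in T:\theta_n(\varphi_tu)\ne0\}$, and let $e_n(u)\in E$ be the indicator function of the clopen set $\overline{U_n(u)}$. A sequence $(\xi_n)$ in $K$ is $u$-orthonormal if $\langle\xi_m|\xi_n\rangle=\delta_{m,n}e_n(u)$ for $m\le n$ and each map $U_n(u)\to l^2(I)$, $t\mapsto\xi_n(t)$ is continuous. A Schatten decomposition of $u\in\mathcal{K}_E(H)$ is an identity $u=\sum_{n}\theta_n(u)\,\xi_n\langle\cdot|\eta_n\rangle$, convergent in $\mathcal{K}_E(K)$,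 with $(\xi_n)$, $(\eta_n)$ $u$-orthonormal sequences in $K$. For $p\in[1,\infty[$, $\mathcal{L}^p_E(H)$ is the set of $u\in\mathcal{K}_E(H)$ such that $(\theta_n(u)^p)_{n\in\mathbb{N}}$ is (norm-)summable in $E$, and $\|u\|_p:=\big\|\sum_{n}\theta_n(u)^p\big\|^{1/p}$. *)

theory Defs
  imports "HOL-Analysis.Analysis" "HOL-Library.Function_Algebras"
begin

section \<open>The scalar field\<close>

text \<open>Every instance of this class is \<open>\<real>\<close> or \<open>\<complex>\<close>: a fixed point \<open>y\<close> of \<open>kconj\<close> satisfies
  \<open>y\<^sup>2 = (norm y)\<^sup>2\<close>, hence is real, so that every \<open>x\<close> is a root of the real quadratic polynomial
  \<open>(X - x) (X - kconj x)\<close>.\<close>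

class rc_scalar = real_normed_field + banach +
  fixes kconj :: "'a \<Rightarrow> 'a"
  assumes kconj_add: "kconj (x + y) = kconj x + kconj y"
    and kconj_mult: "kconj (x * y) = kconj x * kconj y"
    and kconj_kconj: "kconj (kconj x) = x"
    and mult_kconj_scaleR: "x * kconj x = (norm x)\<^sup>2 *\<^sub>R 1"

lemma mult_kconj: "x * kconj x = of_real ((norm x)\<^sup>2)" for x :: "'k::rc_scalar"
  by (simp add: mult_kconj_scaleR of_real_def)

instantiation real :: rc_scalar
begin
definition "kconj_real (x::real) = x"
instance by standard (auto simp: kconj_real_def power2_eq_square)
end

instantiation complex :: rc_scalar
begin
definition "kconj_complex (x::complex) = cnj x"
instance by standard (auto simp: kconj_complex_def complex_norm_square[symmetric] scaleR_conv_of_real)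
end

lemma kconj_0 [simp]: "kconj (0::'k::rc_scalar) = 0"
  using kconj_add[of "0::'k" 0] by simp

lemma norm_kconj [simp]: "norm (kconj (x::'k::rc_scalar)) = norm x"
proof (cases "x = 0")
  case False
  have "norm x * norm (kconj x) = norm (x * kconj x)"
    by (simp add: norm_mult)
  also have "\<dots> = norm x * norm x"
    by (simp only: mult_kconj norm_of_real) (simp add: power2_eq_square)
  finally show ?thesis using False by simp
qed simp

lemma kconj_minus: "kconj (- x) = - kconj (x::'k::rc_scalar)"
  using kconj_add[of x "- x"] by (simp add: eq_neg_iff_add_eq_0 add.commute)

lemma continuous_on_kconj [continuous_intros]:
  fixes f :: "'a::topological_space \<Rightarrow> 'k::rc_scalar"
  assumes "continuous_on S f"
  shows "continuous_on S (\<lambda>x. kconj (f x))"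
proof -
  have "dist (kconj x) (kconj y) = dist x y" for x y :: 'k
    using kconj_add[of x "- y"] norm_kconj[of "x - y"] by (simp add: dist_norm kconj_minus)
  then have "continuous_on UNIV (kconj :: 'k \<Rightarrow> 'k)"
    unfolding continuous_on_iff by metis
  from continuous_on_compose2[OF this assms] show ?thesis by simp
qed


section \<open>The C*-algebra of continuous functions\<close>

text \<open>For compact \<open>T\<close>, the type \<open>T \<Rightarrow>\<^sub>C \<K>\<close> is the space of all continuous functions with the
  supremum norm. It receives its pointwise multiplication and involution here.\<close>

lemma mult_bcontfun:
  fixes f g :: "'a::topological_space \<Rightarrow> 'b::real_normed_algebra"
  assumes "f \<in> bcontfun" "g \<in> bcontfun"
  shows "(\<lambda>x. f x * g x) \<in> bcontfun"
proof -
  obtain a b where ab: "\<And>x. norm (f x) \<le> a" "\<And>x. norm (g x) \<le> b"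
    using assms by (auto simp: bcontfun_def bounded_iff)
  show ?thesis
  proof (rule bcontfun_normI)
    show "continuous_on UNIV (\<lambda>x. f x * g x)"
      using assms by (auto simp: bcontfun_def intro!: continuous_intros)
    fix x
    have "norm (f x * g x) \<le> norm (f x) * norm (g x)" by (rule norm_mult_ineq)
    also have "\<dots> \<le> a * b"
      using ab[of x] by (intro mult_mono) (auto intro: order_trans[OF norm_ge_zero])
    finally show "norm (f x * g x) \<le> a * b" .
  qed
qed

setup_lifting type_definition_bcontfun

instantiation bcontfun :: (topological_space, real_normed_algebra) real_normed_algebra
begin

lift_definition times_bcontfun :: "('a \<Rightarrow>\<^sub>C 'b) \<Rightarrow> ('a \<Rightarrow>\<^sub>C 'b) \<Rightarrow> 'a \<Rightarrow>\<^sub>C 'b"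
  is "\<lambda>f g x. f x * g x"
  by (rule mult_bcontfun)

instance
proof
  fix f g h :: "'a \<Rightarrow>\<^sub>C 'b" and a :: real
  show "f * g * h = f * (g * h)"
    by (rule bcontfun_eqI) (simp add: times_bcontfun.rep_eq mult.assoc)
  show "(f + g) * h = f * h + g * h"
    by (rule bcontfun_eqI) (simp add: times_bcontfun.rep_eq distrib_right)
  show "f * (g + h) = f * g + f * h"
    by (rule bcontfun_eqI) (simp add: times_bcontfun.rep_eq distrib_left)
  show "a *\<^sub>R f * g = a *\<^sub>R (f * g)"
    by (rule bcontfun_eqI) (simp add: times_bcontfun.rep_eq)
  show "f * a *\<^sub>R g = a *\<^sub>R (f * g)"
    by (rule bcontfun_eqI) (simp add: times_bcontfun.rep_eq)
  show "norm (f * g) \<le> norm f * norm g"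
  proof (rule norm_bound)
    fix x
    have "norm (apply_bcontfun (f * g) x) \<le> norm (f x) * norm (g x)"
      by (simp add: times_bcontfun.rep_eq norm_mult_ineq)
    also have "\<dots> \<le> norm f * norm g"
      by (intro mult_mono norm_bounded) auto
    finally show "norm (apply_bcontfun (f * g) x) \<le> norm f * norm g" .
  qed
qed

end

instantiation bcontfun :: (topological_space, real_normed_algebra_1) real_normed_algebra_1
begin

definition one_bcontfun :: "'a \<Rightarrow>\<^sub>C 'b" where "one_bcontfun = const_bcontfun 1"

instance
proof
  fix f :: "'a \<Rightarrow>\<^sub>C 'b"
  show "1 * f = f" "f * 1 = f"
    by (rule bcontfun_eqI; simp add: times_bcontfun.rep_eq one_bcontfun_def)+
  show "(0::'a \<Rightarrow>\<^sub>C 'b) \<noteq> 1"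
    unfolding one_bcontfun_def
    by (metis const_bcontfun.rep_eq zero_bcontfun.rep_eq zero_neq_one)
  show "norm (1::'a \<Rightarrow>\<^sub>C 'b) = 1"
  proof (rule antisym)
    show "norm (1::'a \<Rightarrow>\<^sub>C 'b) \<le> 1"
      by (rule norm_bound) (simp add: one_bcontfun_def)
    show "1 \<le> norm (1::'a \<Rightarrow>\<^sub>C 'b)"
      using norm_bounded[of "1::'a \<Rightarrow>\<^sub>C 'b" undefined] by (simp add: one_bcontfun_def)
  qed
qed

end

instance bcontfun :: (topological_space, real_normed_field) comm_ring_1
  by standard
    (auto intro!: bcontfun_eqI
      simp: times_bcontfun.rep_eq one_bcontfun_def algebra_simps)

lift_definition cstar :: "('t::topological_space \<Rightarrow>\<^sub>C 'k::rc_scalar) \<Rightarrow> 't \<Rightarrow>\<^sub>C 'k"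
  is "\<lambda>f x. kconj (f x)"
  by (auto simp: bcontfun_def bounded_iff intro!: continuous_intros)

lifting_update bcontfun.lifting
lifting_forget bcontfun.lifting

definition cprojection :: "('t::topological_space \<Rightarrow>\<^sub>C 'k::rc_scalar) \<Rightarrow> bool" where
  "cprojection x \<longleftrightarrow> cstar x = x \<and> x * x = x"

definition spos :: "'k::rc_scalar \<Rightarrow> bool" where
  "spos c \<longleftrightarrow> c = of_real (norm c)"

definition cpos :: "('t::topological_space \<Rightarrow>\<^sub>C 'k::rc_scalar) \<Rightarrow> bool" where
  "cpos x \<longleftrightarrow> (\<forall>t. spos (x t))"

definition cle :: "('t::topological_space \<Rightarrow>\<^sub>C 'k::rc_scalar) \<Rightarrow> ('t \<Rightarrow>\<^sub>C 'k) \<Rightarrow> bool" where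
  "cle x y \<longleftrightarrow> cpos (y - x)"

text \<open>The power \<open>x\<^sup>a\<close> (\<open>a > 0\<close>) of a positive element \<open>x\<close>; here \<open>0 powr a = 0\<close>.\<close>

definition cpowr :: "('t::topological_space \<Rightarrow>\<^sub>C 'k::rc_scalar) \<Rightarrow> real \<Rightarrow> 't \<Rightarrow>\<^sub>C 'k" where
  "cpowr x a = Bcontfun (\<lambda>t. of_real (norm (x t) powr a))"


section \<open>Normal functionals, hyperstonian spaces and weak* sums\<close>

definition is_csup :: "('t::topological_space \<Rightarrow>\<^sub>C 'k::rc_scalar) set \<Rightarrow> ('t \<Rightarrow>\<^sub>C 'k) \<Rightarrow> bool" where
  "is_csup D g \<longleftrightarrow> (\<forall>f\<in>D. cle f g) \<and> (\<forall>h. (\<forall>f\<in>D. cle f h) \<longrightarrow> cle g h)"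

text \<open>Positive linear functionals (i.e. positive Radon measures on a compact \<open>T\<close>) which preserve
  suprema of bounded upward directed sets of positive functions. On positive functions such a
  functional has values \<open>\<ge> 0\<close>, which the norm turns into real numbers.\<close>

definition pos_normal :: "(('t::topological_space \<Rightarrow>\<^sub>C 'k::rc_scalar) \<Rightarrow> 'k) \<Rightarrow> bool" where
  "pos_normal \<phi> \<longleftrightarrow>
     (\<forall>x y. \<phi> (x + y) = \<phi> x + \<phi> y) \<and>
     (\<forall>c x. \<phi> (const_bcontfun c * x) = c * \<phi> x) \<and>
     (\<forall>x. cpos x \<longrightarrow> spos (\<phi> x)) \<and>
     (\<forall>D g. D \<noteq> {} \<and> (\<forall>f\<in>D. cpos f) \<and> (\<forall>f\<in>D. \<forall>f'\<in>D. \<exists>h\<in>D. cle f h \<and> cle f' h) \<and> is_csup D g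
        \<longrightarrow> norm (\<phi> g) = (SUP f\<in>D. norm (\<phi> f)))"

text \<open>Compact, Hausdorff (by the sort), extremally disconnected, with sufficiently many positive
  normal measures.\<close>

definition hyperstonian :: "'t::t2_space itself \<Rightarrow> bool" where
  "hyperstonian (_ :: 't itself) \<longleftrightarrow>
     compact (UNIV :: 't set) \<and>
     (\<forall>U::'t set. open U \<longrightarrow> open (closure U)) \<and>
     (\<forall>f :: 't \<Rightarrow>\<^sub>C real. cpos f \<and> f \<noteq> 0 \<longrightarrow> (\<exists>\<phi>. pos_normal \<phi> \<and> \<phi> f \<noteq> 0))"

text \<open>The predual of a W*-algebra is the linear span of its positive normal functionals, so these
  suffice to describe weak* convergence.\<close>

definition weak_star_has_sum ::
  "('i \<Rightarrow> ('t::topological_space \<Rightarrow>\<^sub>C 'k::rc_scalar)) \<Rightarrow> ('t \<Rightarrow>\<^sub>C 'k) \<Rightarrow> bool" where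
  "weak_star_has_sum f x \<longleftrightarrow> (\<forall>\<phi>. pos_normal \<phi> \<longrightarrow> ((\<lambda>\<iota>. \<phi> (f \<iota>)) has_sum \<phi> x) UNIV)"


section \<open>The Hilbert modules \<open>H \<subseteq> K\<close> and their operators\<close>

type_synonym ('i, 't, 'k) family = "'i \<Rightarrow> ('t \<Rightarrow>\<^sub>C 'k)"
type_synonym ('i, 't, 'k) oper = "('i, 't, 'k) family \<Rightarrow> ('i, 't, 'k) family"

definition modK :: "('i, 't::topological_space, 'k::rc_scalar) family \<Rightarrow> ('i, 't, 'k) family set" where
  "modK P = {\<xi>. (\<forall>\<iota>. \<xi> \<iota> \<in> range (\<lambda>x. P \<iota> * x)) \<and>
     bounded {(\<Sum>\<iota>\<in>F. cstar (\<xi> \<iota>) * \<xi> \<iota>) | F. finite F}}"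

definition modH :: "('i, 't::topological_space, 'k::rc_scalar) family \<Rightarrow> ('i, 't, 'k) family set" where
  "modH P = {\<xi>. (\<forall>\<iota>. \<xi> \<iota> \<in> range (\<lambda>x. P \<iota> * x)) \<and>
     (\<lambda>\<iota>. cstar (\<xi> \<iota>) * \<xi> \<iota>) summable_on UNIV}"

definition minner ::
  "('i, 't::topological_space, 'k::rc_scalar) family \<Rightarrow> ('i, 't, 'k) family \<Rightarrow> 't \<Rightarrow>\<^sub>C 'k" where
  "minner \<xi> \<eta> = (THE x. weak_star_has_sum (\<lambda>\<iota>. cstar (\<eta> \<iota>) * \<xi> \<iota>) x)"

definition mnorm :: "('i, 't::topological_space, 'k::rc_scalar) family \<Rightarrow> real" where
  "mnorm \<xi> = sqrt (norm (minner \<xi> \<xi>))"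

definition mscale ::
  "('i, 't::topological_space, 'k::rc_scalar) family \<Rightarrow> ('t \<Rightarrow>\<^sub>C 'k) \<Rightarrow> ('i, 't, 'k) family" where
  "mscale \<xi> x = (\<lambda>\<iota>. \<xi> \<iota> * x)"

text \<open>Below, \<open>M\<close> is \<open>modK P\<close> or \<open>modH P\<close>. An operator on \<open>M\<close> is represented by a total function
  which vanishes outside \<open>M\<close>, so that equality of operators is equality on \<open>M\<close>.\<close>

definition opnorm ::
  "('i, 't::topological_space, 'k::rc_scalar) family set \<Rightarrow> ('i, 't, 'k) oper \<Rightarrow> real" where
  "opnorm M u = (SUP \<zeta>\<in>{\<zeta>\<in>M. mnorm \<zeta> \<le> 1}. mnorm (u \<zeta>))"

definition adjointable_ops ::
  "('i, 't::topological_space, 'k::rc_scalar) family set \<Rightarrow> ('i, 't, 'k) oper set" where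
  "adjointable_ops M = {u.
     (\<forall>\<zeta>\<in>M. u \<zeta> \<in> M) \<and> (\<forall>\<zeta>. \<zeta> \<notin> M \<longrightarrow> u \<zeta> = 0) \<and>
     (\<forall>\<zeta>\<in>M. \<forall>\<omega>\<in>M. u (\<zeta> + \<omega>) = u \<zeta> + u \<omega>) \<and>
     (\<forall>\<zeta>\<in>M. \<forall>x. u (mscale \<zeta> x) = mscale (u \<zeta>) x) \<and>
     (\<exists>C. \<forall>\<zeta>\<in>M. mnorm (u \<zeta>) \<le> C * mnorm \<zeta>) \<and>
     (\<exists>v. (\<forall>\<omega>\<in>M. v \<omega> \<in> M) \<and> (\<forall>\<zeta>\<in>M. \<forall>\<omega>\<in>M. minner (u \<zeta>) \<omega> = minner \<zeta> (v \<omega>)))}"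

definition rank_one ::
  "('i, 't::topological_space, 'k::rc_scalar) family set \<Rightarrow>
   ('i, 't, 'k) family \<Rightarrow> ('i, 't, 'k) family \<Rightarrow> ('i, 't, 'k) oper" where
  "rank_one M \<xi> \<eta> = (\<lambda>\<zeta>. if \<zeta> \<in> M then mscale \<xi> (minner \<zeta> \<eta>) else 0)"

definition op_scale ::
  "'k::rc_scalar \<Rightarrow> ('i, 't::topological_space, 'k) oper \<Rightarrow> ('i, 't, 'k) oper" where
  "op_scale c u = (\<lambda>\<zeta> \<iota>. const_bcontfun c * u \<zeta> \<iota>)"

global_interpretation opv: vector_space
  "op_scale :: 'k::rc_scalar \<Rightarrow> ('i, 't::topological_space, 'k) oper \<Rightarrow> ('i, 't, 'k) oper"
  by unfold_locales
    (auto simp: op_scale_def fun_eq_iff times_bcontfun.rep_eq algebra_simps intro!: bcontfun_eqI)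

definition compact_ops ::
  "('i, 't::topological_space, 'k::rc_scalar) family set \<Rightarrow> ('i, 't, 'k) oper set" where
  "compact_ops M = {u \<in> adjointable_ops M.
     \<forall>\<epsilon>>0. \<exists>v \<in> opv.span {rank_one M \<xi> \<eta> | \<xi> \<eta>. \<xi> \<in> M \<and> \<eta> \<in> M}. opnorm M (u - v) < \<epsilon>}"


section \<open>Singular values of compact operators on \<open>l\<^sup>2\<close>\<close>

definition l2 :: "('i \<Rightarrow> 'k::rc_scalar) set" where
  "l2 = {\<zeta>. (\<lambda>\<iota>. (norm (\<zeta> \<iota>))\<^sup>2) summable_on UNIV}"

definition l2_inner :: "('i \<Rightarrow> 'k::rc_scalar) \<Rightarrow> ('i \<Rightarrow> 'k) \<Rightarrow> 'k" where
  "l2_inner \<zeta> \<omega> = (\<Sum>\<^sub>\<infinity>\<iota>. \<zeta> \<iota> * kconj (\<omega> \<iota>))"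

definition l2_norm :: "('i \<Rightarrow> 'k::rc_scalar) \<Rightarrow> real" where
  "l2_norm \<zeta> = sqrt (\<Sum>\<^sub>\<infinity>\<iota>. (norm (\<zeta> \<iota>))\<^sup>2)"

definition l2_scale :: "'k::rc_scalar \<Rightarrow> ('i \<Rightarrow> 'k) \<Rightarrow> 'i \<Rightarrow> 'k" where
  "l2_scale c \<zeta> = (\<lambda>\<iota>. c * \<zeta> \<iota>)"

global_interpretation l2v: vector_space "l2_scale :: 'k::rc_scalar \<Rightarrow> ('i \<Rightarrow> 'k) \<Rightarrow> 'i \<Rightarrow> 'k"
  by unfold_locales (auto simp: l2_scale_def fun_eq_iff algebra_simps)

definition l2_adj :: "(('i \<Rightarrow> 'k::rc_scalar) \<Rightarrow> 'i \<Rightarrow> 'k) \<Rightarrow> ('i \<Rightarrow> 'k) \<Rightarrow> 'i \<Rightarrow> 'k" where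
  "l2_adj x \<omega> = (if \<omega> \<in> l2
     then (THE \<omega>'. \<omega>' \<in> l2 \<and> (\<forall>\<zeta>\<in>l2. l2_inner (x \<zeta>) \<omega> = l2_inner \<zeta> \<omega>')) else 0)"

text \<open>The decreasing null sequence in which every \<open>\<mu> > 0\<close> occurs as often as the dimension of the
  eigenspace of \<open>x\<^sup>* x\<close> for \<open>\<mu>\<^sup>2\<close>. Limit \<open>0\<close> rules out infinite repetition of some \<open>\<mu> > 0\<close> (where
  \<open>card\<close> would be \<open>0\<close>) and forces the completion by \<open>0\<close>. Numbering starts at \<open>0\<close>: the
  largest singular value has index \<open>0\<close>, and likewise for all other sequences below.\<close>

definition singular_values :: "(('i \<Rightarrow> 'k::rc_scalar) \<Rightarrow> 'i \<Rightarrow> 'k) \<Rightarrow> nat \<Rightarrow> real" where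
  "singular_values x = (THE s. decseq s \<and> s \<longlonglongrightarrow> 0 \<and>
     (\<forall>\<mu>>0. card {n. s n = \<mu>} =
        l2v.dim {\<zeta>\<in>l2. l2_adj x (x \<zeta>) = l2_scale (of_real (\<mu>\<^sup>2)) \<zeta>}))"


section \<open>The functions \<open>\<theta>\<^sub>n(u)\<close>, Schatten classes and Schatten decompositions\<close>

definition psi ::
  "('i, 't::topological_space, 'k::rc_scalar) family \<Rightarrow> ('i \<Rightarrow> 'k) \<Rightarrow> ('i, 't, 'k) family" where
  "psi P \<zeta> = (\<lambda>\<iota>. const_bcontfun (\<zeta> \<iota>) * P \<iota>)"

definition ev_at :: "'t::topological_space \<Rightarrow> ('i, 't, 'k::rc_scalar) family \<Rightarrow> 'i \<Rightarrow> 'k" where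
  "ev_at t \<xi> = (\<lambda>\<iota>. apply_bcontfun (\<xi> \<iota>) t)"

definition phi ::
  "('i, 't::topological_space, 'k::rc_scalar) family \<Rightarrow> 't \<Rightarrow> ('i, 't, 'k) oper \<Rightarrow>
   ('i \<Rightarrow> 'k) \<Rightarrow> 'i \<Rightarrow> 'k" where
  "phi P t u = (\<lambda>\<zeta>. if \<zeta> \<in> l2 then ev_at t (u (psi P \<zeta>)) else 0)"

definition theta ::
  "('i, 't::topological_space, 'k::rc_scalar) family \<Rightarrow> ('i, 't, 'k) oper \<Rightarrow> nat \<Rightarrow> 't \<Rightarrow>\<^sub>C 'k" where
  "theta P u n = Bcontfun (\<lambda>t. of_real (singular_values (phi P t u) n))"

definition Lp ::
  "('i, 't::topological_space, 'k::rc_scalar) family \<Rightarrow> real \<Rightarrow> ('i, 't, 'k) oper set" where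
  "Lp P p = {u \<in> compact_ops (modH P). (\<lambda>n. cpowr (theta P u n) p) summable_on UNIV}"

definition Lp_norm ::
  "('i, 't::topological_space, 'k::rc_scalar) family \<Rightarrow> real \<Rightarrow> ('i, 't, 'k) oper \<Rightarrow> real" where
  "Lp_norm P p u = norm (\<Sum>\<^sub>\<infinity>n. cpowr (theta P u n) p) powr (1 / p)"

definition U_set ::
  "('i, 't::topological_space, 'k::rc_scalar) family \<Rightarrow> ('i, 't, 'k) oper \<Rightarrow> nat \<Rightarrow> 't set" where
  "U_set P u n = {t. singular_values (phi P t u) n \<noteq> 0}"

definition e_proj ::
  "('i, 't::topological_space, 'k::rc_scalar) family \<Rightarrow> ('i, 't, 'k) oper \<Rightarrow> nat \<Rightarrow> 't \<Rightarrow>\<^sub>C 'k" where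
  "e_proj P u n = Bcontfun (indicator (closure (U_set P u n)))"

definition u_orthonormal ::
  "('i, 't::topological_space, 'k::rc_scalar) family \<Rightarrow> ('i, 't, 'k) oper \<Rightarrow>
   (nat \<Rightarrow> ('i, 't, 'k) family) \<Rightarrow> bool" where
  "u_orthonormal P u \<xi> \<longleftrightarrow>
     (\<forall>n. \<xi> n \<in> modK P) \<and>
     (\<forall>m n. m \<le> n \<longrightarrow> minner (\<xi> m) (\<xi> n) = (if m = n then e_proj P u n else 0)) \<and>
     (\<forall>n. \<forall>t\<in>U_set P u n.
        ((\<lambda>s. l2_norm (ev_at s (\<xi> n) - ev_at t (\<xi> n))) \<longlongrightarrow> 0) (at t within U_set P u n))"

text \<open>The summand \<open>\<theta>\<^sub>n(u) \<xi>\<^sub>n\<langle>\<cdot>|\<eta>\<^sub>n\<rangle>\<close>, as an operator on \<open>M\<close>.\<close>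

definition schatten_term ::
  "('i, 't::topological_space, 'k::rc_scalar) family \<Rightarrow> ('i, 't, 'k) family set \<Rightarrow>
   ('i, 't, 'k) oper \<Rightarrow> (nat \<Rightarrow> ('i, 't, 'k) family) \<Rightarrow> (nat \<Rightarrow> ('i, 't, 'k) family) \<Rightarrow>
   nat \<Rightarrow> ('i, 't, 'k) oper" where
  "schatten_term P M u \<xi> \<eta> n = rank_one M (mscale (\<xi> n) (theta P u n)) (\<eta> n)"

text \<open>The image of \<open>u\<close> under the inclusion of the compact operators on \<open>H\<close> into those on \<open>K\<close> is the
  operator \<open>v\<close> on \<open>K\<close> which restricts to \<open>u\<close>; it is unique, because an adjointable operator on \<open>K\<close>
  which vanishes on \<open>H\<close> is zero.\<close>

definition schatten_decomposition ::
  "('i, 't::topological_space, 'k::rc_scalar) family \<Rightarrow> ('i, 't, 'k) oper \<Rightarrow>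
   (nat \<Rightarrow> ('i, 't, 'k) family) \<Rightarrow> (nat \<Rightarrow> ('i, 't, 'k) family) \<Rightarrow> bool" where
  "schatten_decomposition P u \<xi> \<eta> \<longleftrightarrow>
     u_orthonormal P u \<xi> \<and> u_orthonormal P u \<eta> \<and>
     (\<exists>v \<in> compact_ops (modK P). (\<forall>\<zeta>\<in>modH P. v \<zeta> = u \<zeta>) \<and>
        (\<lambda>N. opnorm (modK P) ((\<Sum>n<N. schatten_term P (modK P) u \<xi> \<eta> n) - v)) \<longlonglongrightarrow> 0)"

definition norm_on :: "('i, 't::topological_space, 'k::rc_scalar) oper set \<Rightarrow>
   (('i, 't, 'k) oper \<Rightarrow> real) \<Rightarrow> bool" where
  "norm_on S N \<longleftrightarrow>
     (\<forall>u\<in>S. 0 \<le> N u) \<and> (\<forall>u\<in>S. N u = 0 \<longleftrightarrow> u = 0) \<and>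
     (\<forall>c. \<forall>u\<in>S. N (op_scale c u) = norm c * N u) \<and>
     (\<forall>u\<in>S. \<forall>v\<in>S. N (u + v) \<le> N u + N v)"

definition complete_on :: "('i, 't::topological_space, 'k::rc_scalar) oper set \<Rightarrow>
   (('i, 't, 'k) oper \<Rightarrow> real) \<Rightarrow> bool" where
  "complete_on S N \<longleftrightarrow>
     (\<forall>w. (\<forall>n. w n \<in> S) \<and> (\<forall>\<epsilon>>0. \<exists>n0. \<forall>m\<ge>n0. \<forall>n\<ge>n0. N (w m - w n) < \<epsilon>)
        \<longrightarrow> (\<exists>u\<in>S. (\<lambda>n. N (w n - u)) \<longlonglongrightarrow> 0))"

end

theory Submission
  imports Defs
begin

text \<open>An element \<open>\<xi>\<close> of \<open>H\<close> is a norm continuous section \<open>t \<mapsto> \<xi>(t)\<close> of the fibres of \<open>l\<^sup>2(I)\<close> (Dini), and an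
  adjointable operator \<open>u\<close> acts fibrewise, \<open>(u \<xi>)(t) = (\<phi>\<^sub>t u) \<xi>(t)\<close>, with norm \<open>sup\<^sub>t \<parallel>\<phi>\<^sub>t u\<parallel>\<close>. For compact \<open>u\<close> the
  fibres depend norm continuously on \<open>t\<close>. So everything reduces to compact operators on \<open>l\<^sup>2(I)\<close> with
  estimates uniform in \<open>t\<close>: the triangle inequality is the one for Schatten norms of compact operators,
  Weyl's inequality \<open>\<theta>\<^sub>m\<^sub>+\<^sub>n(u + w) \<le> \<theta>\<^sub>m(u) + \<theta>\<^sub>n(w)\<close> makes the tails of \<open>\<Sum> \<theta>\<^sub>n(u + w)\<^sup>p\<close> uniformly small, and
  the remainders of a Schatten decomposition have the shifted sequence \<open>\<theta>\<^sub>n\<^sub>+\<^sub>N(u)\<close> as singular values.\<close>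

section \<open>Scalars\<close>

text \<open>The obstacle is that three notions are definite descriptions: \<open>minner\<close> is
  the value of a weak* sum, \<open>singular_values\<close> is read off from eigenspaces, and
  \<open>l2_adj\<close> is described by its pairing. Each must be shown to pick the intended object.
  For \<open>minner\<close> this takes the separating normal functionals of a hyperstonian space.
  Evaluation at a point then commutes with the sum when one factor lies in \<open>H\<close>, where
  convergence is in norm; on \<open>K\<close> the value of \<open>minner \<xi> \<xi>\<close> is a
  supremum formed in a Stonean space. For singular values, Schmidt decompositions serve throughout:
  any such decomposition with decreasing coefficients determines them, so inequalities and tails are
  obtained by comparing or exhibiting decompositions. Norm summability in \<open>E\<close> is more
  than boundedness of the sums. Therefore the triangle inequality does not show that a sum of two
  members of \<open>Lp\<close> is a member, and tails need an argument of their own. The scalar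
  field is abstract, so real parts and compact balls are derived from the axioms on
  \<open>kconj\<close>.\<close>

lemma kconj_1 [simp]: "kconj (1::'k::rc_scalar) = 1"
proof -
  have "kconj (1::'k) * kconj 1 = kconj 1 * 1"
    using kconj_mult[of "1::'k" 1] by simp
  moreover have "kconj (1::'k) \<noteq> 0" using norm_kconj[of "1::'k"] by (metis norm_eq_zero norm_one zero_neq_one)
  ultimately show ?thesis by (metis mult_left_cancel)
qed

lemma kconj_of_real [simp]: "kconj (of_real r :: 'k::rc_scalar) = of_real r"
proof (cases "r = 0")
  case False
  have "of_real r * kconj (of_real r :: 'k) = of_real r * of_real r"
    by (simp add: mult_kconj power2_eq_square)
  then show ?thesis using False by simp
qed simp

lemma kconj_diff: "kconj (x - y) = kconj x - kconj (y::'k::rc_scalar)"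
  using kconj_add[of x "- y"] by (simp add: kconj_minus)

lemma kconj_eq_0_iff [simp]: "kconj x = 0 \<longleftrightarrow> x = (0::'k::rc_scalar)"
  by (metis norm_kconj norm_eq_zero)

lemma kconj_inverse: "kconj (inverse x) = inverse (kconj (x::'k::rc_scalar))"
proof (cases "x = 0")
  case False
  then have "kconj x * kconj (inverse x) = 1" by (simp flip: kconj_mult)
  then show ?thesis by (metis inverse_unique)
qed simp

lemma kconj_divide: "kconj (x / y) = kconj x / kconj (y::'k::rc_scalar)"
  by (simp add: divide_inverse kconj_mult kconj_inverse)

lemma kconj_numeral [simp]: "kconj (numeral n :: 'k::rc_scalar) = numeral n"
  by (metis kconj_of_real of_real_numeral)

section \<open>Real parts and an imaginary unit of the scalar field\<close>

lemma kconj_fixed_real: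
  assumes "kconj y = (y::'k::rc_scalar)"
  shows "\<exists>r. y = of_real r"
proof -
  have "y * y = of_real (norm y) * of_real (norm y)"
    using mult_kconj[of y] assms by (simp add: power2_eq_square)
  then have "y = of_real (norm y) \<or> y = - of_real (norm y)"
    by (simp add: square_eq_iff)
  then show ?thesis by (metis of_real_minus)
qed

text \<open>The real part. The symmetrized element is fixed by \<open>kconj\<close>, hence real by
  \<open>kconj_fixed_real\<close>, and injectivity of \<open>of_real\<close> makes the description
  unique.\<close>

definition kre :: "'k::rc_scalar \<Rightarrow> real" where
  "kre x = (THE r. of_real r = (x + kconj x) / 2)"

lemma of_real_kre: "of_real (kre x) = (x + kconj x) / (2::'k::rc_scalar)"
proof -
  have "kconj ((x + kconj x) / 2) = (x + kconj x) / 2"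
    by (simp add: kconj_divide kconj_add kconj_kconj add.commute)
  then obtain r where r: "(x + kconj x) / 2 = of_real r"
    using kconj_fixed_real by blast
  show ?thesis unfolding kre_def r by (rule theI[of _ r]) (auto simp: of_real_eq_iff)
qed

lemma kre_unique: "of_real r = (x + kconj x) / (2::'k::rc_scalar) \<Longrightarrow> kre x = r"
  by (metis of_real_eq_iff of_real_kre)

lemma kre_add: "kre (x + y) = kre x + kre (y::'k::rc_scalar)"
  by (rule kre_unique) (simp add: of_real_kre kconj_add add_divide_distrib)

lemma kre_of_real [simp]: "kre (of_real r :: 'k::rc_scalar) = r"
  by (rule kre_unique) simp

lemma kre_0 [simp]: "kre (0::'k::rc_scalar) = 0"
  using kre_of_real[of 0] by simp

lemma kre_1 [simp]: "kre (1::'k::rc_scalar) = 1"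
  using kre_of_real[of 1] by simp

lemma kre_kconj [simp]: "kre (kconj x) = kre (x::'k::rc_scalar)"
  by (rule kre_unique) (simp add: of_real_kre kconj_kconj add.commute)

lemma kre_of_real_mult [simp]: "kre (of_real r * x) = r * kre (x::'k::rc_scalar)"
  by (rule kre_unique) (simp add: of_real_kre kconj_mult distrib_left)

lemma kre_scaleR [simp]: "kre (r *\<^sub>R x) = r * kre (x::'k::rc_scalar)"
  by (simp add: scaleR_conv_of_real)

lemma kre_minus [simp]: "kre (- x) = - kre (x::'k::rc_scalar)"
  using kre_of_real_mult[of "-1" x] by simp

lemma kre_diff: "kre (x - y) = kre x - kre (y::'k::rc_scalar)"
  using kre_add[of x "- y"] by simp

lemma kre_mult_kconj [simp]: "kre (x * kconj x) = (norm (x::'k::rc_scalar))\<^sup>2"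
  by (simp only: mult_kconj kre_of_real)

lemma kre_kconj_mult [simp]: "kre (kconj x * x) = (norm (x::'k::rc_scalar))\<^sup>2"
  by (metis kre_mult_kconj mult.commute)

lemma abs_kre_le: "\<bar>kre x\<bar> \<le> norm (x::'k::rc_scalar)"
proof -
  have "\<bar>kre x\<bar> = norm (of_real (kre x) :: 'k)" by simp
  also have "\<dots> \<le> (norm x + norm (kconj x)) / 2"
    unfolding of_real_kre norm_divide norm_numeral
    by (intro divide_right_mono norm_triangle_ineq) simp
  finally show ?thesis by simp
qed

lemma bounded_linear_kre: "bounded_linear (kre :: 'k::rc_scalar \<Rightarrow> real)"
  by (rule bounded_linear_intro[where K=1]) (auto simp: kre_add abs_kre_le)

lemmas continuous_on_kre [continuous_intros] = bounded_linear.continuous_on[OF bounded_linear_kre]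

lemma bounded_linear_kconj: "bounded_linear (kconj :: 'k::rc_scalar \<Rightarrow> 'k)"
  by (rule bounded_linear_intro[where K=1])
    (auto simp: kconj_add kconj_mult scaleR_conv_of_real)

text \<open>In the real case take \<open>j = 0\<close>, in the complex case \<open>j = \<i>\<close>.\<close>

lemma ex_imaginary_unit:
  "\<exists>j::'k::rc_scalar. norm j \<le> 1 \<and> (j = 0 \<or> j * j = - 1) \<and>
     (\<forall>x. x = of_real (kre x) - j * of_real (kre (j * x)))"
proof (cases "\<forall>x::'k. kconj x = x")
  case True
  have "x = of_real (kre x)" for x :: 'k
    unfolding of_real_kre using True by simp
  then show ?thesis by (intro exI[of _ 0]) simp
next
  case False
  then obtain z :: 'k where z: "kconj z \<noteq> z" by blast
  define y where "y = z - kconj z"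
  have y: "kconj y = - y" "y \<noteq> 0"
    using z by (auto simp: y_def kconj_diff kconj_kconj)
  \<comment> \<open>\<open>y\<close> changes sign under \<open>kconj\<close>, hence its square is
    \<open>- (norm y)\<^sup>2\<close>; normalizing it leaves a square root of -1.\<close>
  define j where "j = y / of_real (norm y)"
  have kj: "kconj j = - j"
    by (simp add: j_def kconj_divide y)
  have nj: "norm j = 1" using y by (simp add: j_def norm_divide)
  have jj: "j * j = - 1"
    using mult_kconj[of j] kj nj by (simp add: minus_equation_iff[of _ 1])
  have "x = of_real (kre x) - j * of_real (kre (j * x))" for x
  proof -
    have "of_real (kre (j * x)) = j * ((x - kconj x) / 2)"
      by (simp add: of_real_kre kconj_mult kj right_diff_distrib)
    then have "j * of_real (kre (j * x)) = - ((x - kconj x) / 2)"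
      using jj by (metis mult.assoc mult_minus1)
    then show ?thesis by (simp add: of_real_kre field_simps)
  qed
  with nj jj show ?thesis by (intro exI[of _ j]) auto
qed

text \<open>The two real coordinates from \<open>ex_imaginary_unit\<close> exhibit the ball as a
  closed subset of the continuous image of a square. This is what makes rank one operators compact
  over the abstract scalar field.\<close>

lemma compact_cball_scalar: "compact (cball (0::'k::rc_scalar) M)"
proof -
  obtain j :: 'k where j: "norm j \<le> 1" "\<And>x. x = of_real (kre x) - j * of_real (kre (j * x))"
    using ex_imaginary_unit by blast
  let ?f = "\<lambda>(a::real, b::real). of_real a - j * of_real b"
  have "compact (?f ` ({-M..M} \<times> {-M..M}))"
    by (intro compact_continuous_image compact_Times)
      (auto simp: case_prod_beta intro!: continuous_intros)
  moreover have "cball 0 M \<subseteq> ?f ` ({-M..M} \<times> {-M..M})"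
  proof
    fix x :: 'k assume "x \<in> cball 0 M"
    then have x: "norm x \<le> M" by simp
    have "norm (j * x) \<le> 1 * M" unfolding norm_mult using j x by (intro mult_mono) auto
    then have "\<bar>kre (j * x)\<bar> \<le> M" using abs_kre_le[of "j * x"] by simp
    moreover have "\<bar>kre x\<bar> \<le> M" using abs_kre_le[of x] x by simp
    ultimately have "(kre x, kre (j * x)) \<in> {-M..M} \<times> {-M..M}" by auto
    moreover have "x = ?f (kre x, kre (j * x))" using j(2)[of x] by simp
    ultimately show "x \<in> ?f ` ({-M..M} \<times> {-M..M})" by (rule rev_image_eqI)
  qed
  ultimately have "compact (cball 0 M \<inter> ?f ` ({-M..M} \<times> {-M..M}))"
    by (intro closed_Int_compact closed_cball)
  then show ?thesis using \<open>cball 0 M \<subseteq> _\<close> by (simp add: inf.absorb1)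
qed

section \<open>The Hilbert space of square-summable families\<close>

lemma l2_iff_bounded_sums:
  "f \<in> l2 \<longleftrightarrow> (\<exists>C. \<forall>F. finite F \<longrightarrow> (\<Sum>i\<in>F. (norm (f i :: 'k::rc_scalar))\<^sup>2) \<le> C)"
proof
  assume "f \<in> l2"
  then show "\<exists>C. \<forall>F. finite F \<longrightarrow> (\<Sum>i\<in>F. (norm (f i))\<^sup>2) \<le> C"
    unfolding l2_def by (auto intro!: exI finite_sum_le_infsum)
next
  assume "\<exists>C. \<forall>F. finite F \<longrightarrow> (\<Sum>i\<in>F. (norm (f i))\<^sup>2) \<le> C"
  then obtain C where C: "\<And>F. finite F \<Longrightarrow> (\<Sum>i\<in>F. (norm (f i))\<^sup>2) \<le> C" by blast
  show "f \<in> l2"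
    unfolding l2_def mem_Collect_eq
    by (rule nonneg_bdd_above_summable_on) (auto intro!: bdd_aboveI2[where M=C] C)
qed

lemma l2_norm_mult_summable:
  assumes "f \<in> l2" "g \<in> l2"
  shows "(\<lambda>i. norm (f i :: 'k::rc_scalar) * norm (g i :: 'k)) summable_on UNIV"
proof (rule summable_on_comparison_test)
  show "(\<lambda>i. (norm (f i))\<^sup>2 + (norm (g i))\<^sup>2) summable_on UNIV"
    using assms unfolding l2_def by (intro summable_on_add) auto
  fix i
  have "2 * (norm (f i) * norm (g i)) \<le> (norm (f i))\<^sup>2 + (norm (g i))\<^sup>2"
    using sum_squares_bound[of "norm (f i)" "norm (g i)"] by simp
  then show "norm (f i) * norm (g i) \<le> (norm (f i))\<^sup>2 + (norm (g i))\<^sup>2"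
    by (smt (verit) mult_nonneg_nonneg norm_ge_zero)
qed auto

lemma l2_add: "f \<in> l2 \<Longrightarrow> g \<in> l2 \<Longrightarrow> f + g \<in> (l2 :: ('i \<Rightarrow> 'k::rc_scalar) set)"
proof -
  assume fg: "f \<in> l2" "g \<in> l2"
  show "f + g \<in> l2"
    unfolding l2_def mem_Collect_eq
  proof (rule summable_on_comparison_test)
    show "(\<lambda>i. 2 * (norm (f i))\<^sup>2 + 2 * (norm (g i))\<^sup>2) summable_on UNIV"
      using fg unfolding l2_def by (intro summable_on_add summable_on_cmult_right) auto
    fix i
    have "(norm (f i + g i))\<^sup>2 \<le> (norm (f i) + norm (g i))\<^sup>2"
      by (intro power_mono norm_triangle_ineq) auto
    also have "\<dots> \<le> 2 * (norm (f i))\<^sup>2 + 2 * (norm (g i))\<^sup>2"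
      using sum_squares_bound[of "norm (f i)" "norm (g i)"] by (simp add: power2_sum)
    finally show "(norm ((f + g) i))\<^sup>2 \<le> 2 * (norm (f i))\<^sup>2 + 2 * (norm (g i))\<^sup>2" by simp
  qed auto
qed

lemma l2_scale_mem: "f \<in> l2 \<Longrightarrow> (\<lambda>i. c * f i) \<in> (l2 :: ('i \<Rightarrow> 'k::rc_scalar) set)"
  unfolding l2_def by (simp add: norm_mult power_mult_distrib summable_on_cmult_right)

text \<open>A type copy of the set \<open>l2\<close>, so that inner product spaces, completeness and
  bounded operators of the library apply. Those only see real scalars; the field \<open>'k\<close>
  acts through \<open>ksc\<close>.\<close>

typedef (overloaded) ('i, 'k::rc_scalar) ell2 = "l2 :: ('i \<Rightarrow> 'k) set"
  morphisms coord of_coord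
  by (rule exI[of _ "\<lambda>_. 0"]) (simp add: l2_def)

setup_lifting type_definition_ell2

lift_definition ksc :: "'k::rc_scalar \<Rightarrow> ('i, 'k) ell2 \<Rightarrow> ('i, 'k) ell2" is "\<lambda>c f i. c * f i"
  by (rule l2_scale_mem)

definition kinner :: "('i, 'k::rc_scalar) ell2 \<Rightarrow> ('i, 'k) ell2 \<Rightarrow> 'k" where
  "kinner x y = (\<Sum>\<^sub>\<infinity>i. coord x i * kconj (coord y i))"

lemma coord_in_l2 [simp]: "coord x \<in> l2"
  using coord by blast

lemma kinner_has_sum: "((\<lambda>i. coord x i * kconj (coord y i)) has_sum kinner x y) UNIV"
proof -
  have "(\<lambda>i. norm (coord x i) * norm (coord y i)) summable_on UNIV"
    by (rule l2_norm_mult_summable) auto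
  then have "(\<lambda>i. coord x i * kconj (coord y i)) abs_summable_on UNIV"
    by (simp add: norm_mult)
  then show ?thesis
    unfolding kinner_def by (intro has_sum_infsum) (rule abs_summable_summable)
qed

lemma kinner_eqI: "((\<lambda>i. coord x i * kconj (coord y i)) has_sum c) UNIV \<Longrightarrow> kinner x y = c"
  using kinner_has_sum has_sum_unique by blast

instantiation ell2 :: (type, rc_scalar) real_vector
begin

lift_definition zero_ell2 :: "('a, 'b) ell2" is "\<lambda>_. 0" by (simp add: l2_def)
lift_definition plus_ell2 :: "('a, 'b) ell2 \<Rightarrow> ('a, 'b) ell2 \<Rightarrow> ('a, 'b) ell2" is "\<lambda>f g. f + g"
  by (rule l2_add)
lift_definition uminus_ell2 :: "('a, 'b) ell2 \<Rightarrow> ('a, 'b) ell2" is "\<lambda>f i. - f i"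
  by (simp add: l2_def)
lift_definition minus_ell2 :: "('a, 'b) ell2 \<Rightarrow> ('a, 'b) ell2 \<Rightarrow> ('a, 'b) ell2" is "\<lambda>f g. f + (\<lambda>i. - g i)"
  by (rule l2_add) (auto simp: l2_def)
lift_definition scaleR_ell2 :: "real \<Rightarrow> ('a, 'b) ell2 \<Rightarrow> ('a, 'b) ell2" is "\<lambda>r f i. of_real r * f i"
  by (rule l2_scale_mem)

instance
  by standard (transfer; auto simp: fun_eq_iff algebra_simps)+

end

lemma coord_0 [simp]: "coord 0 i = 0" by transfer simp
lemma coord_add [simp]: "coord (x + y) i = coord x i + coord y i" by transfer simp
lemma coord_uminus [simp]: "coord (- x) i = - coord x i" by transfer simp
lemma coord_diff [simp]: "coord (x - y) i = coord x i - coord y i" by transfer simp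
lemma coord_scaleR [simp]: "coord (r *\<^sub>R x) i = of_real r * coord x i" by transfer simp
lemma coord_ksc [simp]: "coord (ksc c x) i = c * coord x i" by transfer simp

lemma ell2_eqI: "(\<And>i. coord x i = coord y i) \<Longrightarrow> x = y"
  by (metis coord_inject ext)

lemma kinner_add_left: "kinner (x + y) z = kinner x z + kinner y z"
  by (rule kinner_eqI) (simp add: distrib_right has_sum_add kinner_has_sum)

lemma kinner_ksc_left [simp]: "kinner (ksc c x) y = c * kinner x y"
  by (rule kinner_eqI) (simp add: mult.assoc has_sum_cmult_right kinner_has_sum)

lemma kinner_commute: "kinner y x = kconj (kinner x y)"
  by (rule kinner_eqI)
    (use has_sum_bounded_linear[OF bounded_linear_kconj kinner_has_sum[of x y]] in
      \<open>simp add: o_def kconj_mult kconj_kconj mult.commute\<close>)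

lemma kinner_add_right: "kinner x (y + z) = kinner x y + kinner x z"
  by (subst (1 2 3) kinner_commute) (simp add: kinner_add_left kconj_add)

lemma kinner_ksc_right [simp]: "kinner x (ksc c y) = kconj c * kinner x y"
  by (subst (1 2) kinner_commute) (simp add: kconj_mult)

lemma scaleR_ksc: "r *\<^sub>R x = ksc (of_real r) x"
  by (rule ell2_eqI) simp

lemma kinner_scaleR_left [simp]: "kinner (r *\<^sub>R x) y = of_real r * kinner x y"
  by (simp add: scaleR_ksc)

lemma kinner_scaleR_right [simp]: "kinner x (r *\<^sub>R y) = of_real r * kinner x y"
  by (simp add: scaleR_ksc)

lemma kinner_0_left [simp]: "kinner 0 y = 0"
  using kinner_scaleR_left[of 0 y y] by simp

lemma kinner_0_right [simp]: "kinner x 0 = 0"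
  using kinner_scaleR_right[of x 0 x] by simp

lemma kinner_self_has_sum: "((\<lambda>i. (norm (coord x i))\<^sup>2) has_sum kre (kinner x x)) UNIV"
  using has_sum_bounded_linear[OF bounded_linear_kre kinner_has_sum[of x x]]
  by (simp add: o_def)

lemma kinner_self_nonneg: "0 \<le> kre (kinner x x)"
  by (rule has_sum_nonneg[OF kinner_self_has_sum]) simp

text \<open>The real part of \<open>kinner\<close> induces the Hilbert space norm. Statements about
  the scalar-valued form are recovered by multiplying one argument by a suitable scalar.\<close>

instantiation ell2 :: (type, rc_scalar) real_inner
begin

definition inner_ell2 :: "('a, 'b) ell2 \<Rightarrow> ('a, 'b) ell2 \<Rightarrow> real" where
  "inner_ell2 x y = kre (kinner x y)"
definition norm_ell2 :: "('a, 'b) ell2 \<Rightarrow> real" where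
  "norm_ell2 x = sqrt (inner x x)"
definition sgn_ell2 :: "('a, 'b) ell2 \<Rightarrow> ('a, 'b) ell2" where
  "sgn_ell2 x = inverse (norm x) *\<^sub>R x"
definition dist_ell2 :: "('a, 'b) ell2 \<Rightarrow> ('a, 'b) ell2 \<Rightarrow> real" where
  "dist_ell2 x y = norm (x - y)"
definition uniformity_ell2 :: "(('a, 'b) ell2 \<times> ('a, 'b) ell2) filter" where
  "uniformity_ell2 = (INF e\<in>{0<..}. principal {(x, y). dist x y < e})"
definition open_ell2 :: "('a, 'b) ell2 set \<Rightarrow> bool" where
  "open_ell2 U \<longleftrightarrow> (\<forall>x\<in>U. eventually (\<lambda>(x', y). x' = x \<longrightarrow> y \<in> U) uniformity)"

instance
proof
  fix x y z :: "('a, 'b) ell2" and r :: real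
  show "inner x y = inner y x"
    unfolding inner_ell2_def by (metis kinner_commute kre_kconj)
  show "inner (x + y) z = inner x z + inner y z"
    by (simp add: inner_ell2_def kinner_add_left kre_add)
  show "inner (r *\<^sub>R x) y = r * inner x y"
    by (simp add: inner_ell2_def)
  show "0 \<le> inner x x" by (simp add: inner_ell2_def kinner_self_nonneg)
  show "inner x x = 0 \<longleftrightarrow> x = 0"
  proof
    assume "inner x x = 0"
    then have "((\<lambda>i. (norm (coord x i))\<^sup>2) has_sum 0) UNIV"
      using kinner_self_has_sum[of x] by (simp add: inner_ell2_def)
    then have "(norm (coord x i))\<^sup>2 = 0" for i
      using nonneg_has_sum_le_0D[of "\<lambda>i. (norm (coord x i))\<^sup>2" UNIV 0 i] by auto
    then show "x = 0" by (intro ell2_eqI) auto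
  qed (simp add: inner_ell2_def)
qed (simp_all add: norm_ell2_def sgn_ell2_def dist_ell2_def uniformity_ell2_def open_ell2_def)

end

lemma norm_ell2_has_sum: "((\<lambda>i. (norm (coord x i))\<^sup>2) has_sum (norm x)\<^sup>2) UNIV"
  using kinner_self_has_sum[of x] kinner_self_nonneg[of x]
  by (simp add: norm_ell2_def inner_ell2_def)

lemma kinner_self: "kinner x x = of_real ((norm (x :: ('i, 'k::rc_scalar) ell2))\<^sup>2)"
proof -
  have "((\<lambda>i. of_real ((norm (coord x i))\<^sup>2) :: 'k) has_sum of_real ((norm x)\<^sup>2)) UNIV"
    using has_sum_bounded_linear[OF bounded_linear_of_real norm_ell2_has_sum[of x]] by (simp add: o_def)
  then show ?thesis by (intro kinner_eqI) (simp only: mult_kconj)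
qed

lemma norm_ksc [simp]: "norm (ksc c x) = norm c * norm (x :: ('i, 'k::rc_scalar) ell2)"
proof -
  have "(of_real ((norm (ksc c x))\<^sup>2) :: 'k) = kinner (ksc c x) (ksc c x)"
    by (simp only: kinner_self)
  also have "\<dots> = c * kconj c * kinner x x" by simp
  also have "\<dots> = of_real ((norm c * norm x)\<^sup>2)"
    by (simp only: kinner_self mult_kconj power_mult_distrib of_real_mult)
  finally show ?thesis
    unfolding of_real_eq_iff by (rule power2_eq_imp_eq) auto
qed

text \<open>Multiplying \<open>x\<close> by the conjugate of \<open>kinner x y\<close> makes the
  inner product a non-negative real number, to which the real inequality applies.\<close>

lemma kinner_cauchy_schwarz: "norm (kinner x y) \<le> norm x * norm y"
proof (cases "kinner x y = 0")
  case False
  define c where "c = kconj (kinner x y)"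
  have "(norm (kinner x y))\<^sup>2 = inner (ksc c x) y"
    by (simp add: inner_ell2_def c_def)
  also have "\<dots> \<le> norm (kinner x y) * (norm x * norm y)"
    using norm_cauchy_schwarz[of "ksc c x" y] by (simp add: c_def mult.assoc)
  finally show ?thesis using False by (simp add: power2_eq_square)
qed simp

lemma bounded_bilinear_kinner: "bounded_bilinear kinner"
  by standard
    (auto simp: kinner_add_left kinner_add_right scaleR_conv_of_real
      intro!: exI[of _ 1] kinner_cauchy_schwarz)

lemmas tendsto_kinner [tendsto_intros] = bounded_bilinear.tendsto[OF bounded_bilinear_kinner]
lemmas continuous_on_kinner [continuous_intros] = bounded_bilinear.continuous_on[OF bounded_bilinear_kinner]
lemmas kinner_diff_left = bounded_bilinear.diff_left[OF bounded_bilinear_kinner]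
lemmas kinner_diff_right = bounded_bilinear.diff_right[OF bounded_bilinear_kinner]
lemmas kinner_sum_left = bounded_bilinear.sum_left[OF bounded_bilinear_kinner]
lemmas kinner_sum_right = bounded_bilinear.sum_right[OF bounded_bilinear_kinner]
lemma ksc_add_left: "ksc (c + d) x = ksc c x + ksc d x"
  by (rule ell2_eqI) (simp add: algebra_simps)

lemma ksc_add_right: "ksc c (x + y) = ksc c x + ksc c y"
  by (rule ell2_eqI) (simp add: algebra_simps)

lemma ksc_ksc [simp]: "ksc c (ksc d x) = ksc (c * d) x"
  by (rule ell2_eqI) (simp add: algebra_simps)

lemma ksc_1 [simp]: "ksc 1 x = x" by (rule ell2_eqI) simp

lemma bounded_bilinear_ksc: "bounded_bilinear (ksc :: 'k::rc_scalar \<Rightarrow> ('i, 'k) ell2 \<Rightarrow> _)"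
  by standard
    (auto simp: ksc_add_left ksc_add_right scaleR_ksc scaleR_conv_of_real mult.commute
      intro!: exI[of _ 1])

lemmas tendsto_ksc [tendsto_intros] = bounded_bilinear.tendsto[OF bounded_bilinear_ksc]
lemmas continuous_on_ksc [continuous_intros] = bounded_bilinear.continuous_on[OF bounded_bilinear_ksc]
lemmas ksc_diff_right = bounded_bilinear.diff_right[OF bounded_bilinear_ksc]
lemmas ksc_diff_left = bounded_bilinear.diff_left[OF bounded_bilinear_ksc]
lemmas ksc_sum_right = bounded_bilinear.sum_right[OF bounded_bilinear_ksc]
lemmas ksc_0_left [simp] = bounded_bilinear.zero_left[OF bounded_bilinear_ksc]
lemmas ksc_0_right [simp] = bounded_bilinear.zero_right[OF bounded_bilinear_ksc]

lemma norm_coord_le: "norm (coord x i) \<le> norm x"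
proof -
  have "(\<Sum>i\<in>{i}. (norm (coord x i))\<^sup>2) \<le> (norm x)\<^sup>2"
    by (rule finite_sum_le_has_sum[OF norm_ell2_has_sum]) auto
  then show ?thesis using power2_le_imp_le[OF _ norm_ge_zero] by simp
qed

lemma bounded_linear_coord: "bounded_linear (\<lambda>x. coord x i)"
  by (rule bounded_linear_intro[where K=1]) (auto simp: scaleR_conv_of_real norm_coord_le)

lemma coord_of_coord_bounded:
  assumes "\<And>F. finite F \<Longrightarrow> (\<Sum>i\<in>F. (norm (f i :: 'k::rc_scalar))\<^sup>2) \<le> C\<^sup>2" and "0 \<le> C"
  shows "coord (of_coord f) = f" "norm (of_coord f) \<le> C"
proof -
  have "f \<in> l2" using assms(1) l2_iff_bounded_sums by blast
  then show f: "coord (of_coord f) = f" by (rule of_coord_inverse)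
  have "(norm (of_coord f))\<^sup>2 \<le> C\<^sup>2"
    by (rule has_sum_le_finite_sums[OF norm_ell2_has_sum]) (auto simp: f assms)
  then show "norm (of_coord f) \<le> C" using assms(2) power2_le_imp_le by blast
qed

instance ell2 :: (type, rc_scalar) complete_space
proof
  fix X :: "nat \<Rightarrow> ('a, 'b) ell2"
  assume X: "Cauchy X"
  have "\<exists>l. (\<lambda>n. coord (X n) i) \<longlonglongrightarrow> l" for i
    using Cauchy_convergent[OF bounded_linear.Cauchy[OF bounded_linear_coord X]]
    by (auto simp: convergent_def)
  then obtain a where a: "\<And>i. (\<lambda>n. coord (X n) i) \<longlonglongrightarrow> a i" by metis
  \<comment> \<open>Membership of the coordinatewise limit in \<open>l2\<close> is proved together
    with the estimate, since \<open>of_coord\<close> is meaningful only on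
    \<open>l2\<close>.\<close>
  have *: "\<exists>n0. \<forall>n\<ge>n0. a \<in> l2 \<and> norm (X n - of_coord a) \<le> e" if "e > 0" for e
  proof -
    obtain n0 where n0: "\<And>m n. m \<ge> n0 \<Longrightarrow> n \<ge> n0 \<Longrightarrow> norm (X m - X n) < e"
      using CauchyD[OF X \<open>e > 0\<close>] by blast
    have "a \<in> l2 \<and> norm (X n - of_coord a) \<le> e" if n: "n \<ge> n0" for n
    proof -
      let ?d = "\<lambda>i. coord (X n) i - a i"
      have b: "(\<Sum>i\<in>F. (norm (?d i))\<^sup>2) \<le> e\<^sup>2" if "finite F" for F
      proof (rule LIMSEQ_le_const2)
        show "(\<lambda>m. \<Sum>i\<in>F. (norm (coord (X n) i - coord (X m) i))\<^sup>2) \<longlonglongrightarrow> (\<Sum>i\<in>F. (norm (?d i))\<^sup>2)"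
          by (intro tendsto_intros a)
        have "(\<Sum>i\<in>F. (norm (coord (X n) i - coord (X m) i))\<^sup>2) \<le> e\<^sup>2" if "m \<ge> n0" for m
        proof -
          have "(\<Sum>i\<in>F. (norm (coord (X n - X m) i))\<^sup>2) \<le> (norm (X n - X m))\<^sup>2"
            by (rule finite_sum_le_has_sum[OF norm_ell2_has_sum]) (use \<open>finite F\<close> in auto)
          also have "\<dots> \<le> e\<^sup>2" using n0[OF n that] by (intro power_mono) auto
          finally show ?thesis by simp
        qed
        then show "\<exists>N. \<forall>m\<ge>N. (\<Sum>i\<in>F. (norm (coord (X n) i - coord (X m) i))\<^sup>2) \<le> e\<^sup>2" by blast
      qed
      note d = coord_of_coord_bounded[of ?d e, OF b less_imp_le[OF \<open>e > 0\<close>]]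
      \<comment> \<open>The limit differs from \<open>X n\<close> by the square-summable family
        \<open>?d\<close>, hence is square-summable itself.\<close>
      have eq: "a = coord (X n - of_coord ?d)" by (rule ext) (simp add: d(1))
      have "a \<in> l2" by (subst eq) simp
      moreover have "of_coord a = X n - of_coord ?d"
        using arg_cong[OF eq, of of_coord] by (simp only: coord_inverse)
      ultimately show ?thesis using d(2) by simp
    qed
    then show ?thesis by blast
  qed
  have "X \<longlonglongrightarrow> of_coord a"
  proof (rule LIMSEQ_I)
    fix r :: real assume "r > 0"
    then obtain n0 where "\<And>n. n \<ge> n0 \<Longrightarrow> norm (X n - of_coord a) \<le> r / 2"
      using *[of "r/2"] by auto
    with \<open>r > 0\<close> show "\<exists>no. \<forall>n\<ge>no. norm (X n - of_coord a) < r"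
      by (intro exI[of _ n0]) fastforce
  qed
  then show "convergent X" by (auto simp: convergent_def)
qed

instance ell2 :: (type, rc_scalar) banach ..

lifting_update ell2.lifting
lifting_forget ell2.lifting

section \<open>Inequalities for powers\<close>

text \<open>Convexity on the open half-line, where the power is differentiable; the end point
  \<open>y = 0\<close> is computed separately.\<close>

lemma powr_above_tangent:
  assumes "1 \<le> p" "0 < x" "0 \<le> (y::real)"
  shows "x powr p + p * x powr (p - 1) * (y - x) \<le> y powr p"
proof (cases "y = 0")
  case True
  have "x powr p = x powr (p - 1) * x"
    using assms by (simp add: powr_diff)
  then have "x powr p + p * x powr (p - 1) * (y - x) = (1 - p) * x powr p"
    using True by (simp add: algebra_simps)
  also have "\<dots> \<le> 0" using assms by (intro mult_nonpos_nonneg) auto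
  finally show ?thesis using True by simp
next
  case False
  then have "y > 0" using assms by simp
  have "p * x powr (p - 1) * (y - x) \<le> y powr p - x powr p"
    by (rule convex_on_imp_above_tangent[OF powr_convex[OF assms(1)]])
      (use assms \<open>y > 0\<close> in \<open>auto simp: interior_open intro!: derivative_eq_intros\<close>)
  then show ?thesis by simp
qed

text \<open>Weighted average of the tangents at the mean \<open>X\<close>. A total weight below 1 is
  harmless, as if the missing weight sat on the value 0; such weights are what Bessel's inequality
  delivers.\<close>

lemma powr_sum_jensen:
  assumes "1 \<le> p" "\<And>i. i \<in> I \<Longrightarrow> 0 \<le> a i" "\<And>i. i \<in> I \<Longrightarrow> 0 \<le> (s i::real)"
    and "(\<Sum>i\<in>I. a i) \<le> 1"
  shows "(\<Sum>i\<in>I. a i * s i) powr p \<le> (\<Sum>i\<in>I. a i * s i powr p)"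
proof -
  define X where "X = (\<Sum>i\<in>I. a i * s i)"
  define \<alpha> where "\<alpha> = (\<Sum>i\<in>I. a i)"
  have X: "0 \<le> X" unfolding X_def by (intro sum_nonneg mult_nonneg_nonneg assms)
  show ?thesis
  proof (cases "X = 0")
    case True
    then show ?thesis using assms by (auto simp: X_def intro!: sum_nonneg)
  next
    case False
    with X have "X > 0" by simp
    have pX: "X powr p = X powr (p - 1) * X" using \<open>X > 0\<close> by (simp add: powr_diff)
    have "X powr p \<le> X powr p * (\<alpha> + p * (1 - \<alpha>))"
    proof -
      have "(p - 1) * (1 - \<alpha>) \<ge> 0" using assms by (simp add: \<alpha>_def)
      then have "1 \<le> \<alpha> + p * (1 - \<alpha>)" by (simp add: algebra_simps)
      then show ?thesis using mult_left_mono[of 1 _ "X powr p"] by simp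
    qed
    also have "\<dots> = (\<Sum>i\<in>I. a i * (X powr p + p * X powr (p - 1) * (s i - X)))"
    proof -
      have "(\<Sum>i\<in>I. a i * (c + d * (s i - z))) = sum a I * c + d * ((\<Sum>i\<in>I. a i * s i) - sum a I * z)" for c d z
        by (simp add: algebra_simps sum.distrib sum_subtractf sum_distrib_left sum_distrib_right)
      from this[of "X powr p" "p * X powr (p - 1)" X]
      have "(\<Sum>i\<in>I. a i * (X powr p + p * X powr (p - 1) * (s i - X)))
          = \<alpha> * X powr p + p * X powr (p - 1) * (X - \<alpha> * X)"
        by (simp only: X_def[symmetric] \<alpha>_def[symmetric])
      then show ?thesis by (simp add: pX algebra_simps)
    qed
    also have "\<dots> \<le> (\<Sum>i\<in>I. a i * s i powr p)"
      by (intro sum_mono mult_left_mono powr_above_tangent assms \<open>X > 0\<close>)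
    finally show ?thesis by (simp add: X_def)
  qed
qed

text \<open>With \<open>l = a / (a + b)\<close> the sum \<open>x + y\<close> is \<open>a + b\<close>
  times the convex combination of \<open>x / a\<close> and \<open>y / b\<close> with weights
  \<open>l\<close> and \<open>1 - l\<close>, and the \<open>p\<close>-th powers of these two add up
  to at most 1. If \<open>a\<close> or \<open>b\<close> is 0, the corresponding family
  vanishes.\<close>

lemma powr_minkowski:
  assumes "1 \<le> p" "finite K" "\<And>k. k \<in> K \<Longrightarrow> 0 \<le> x k" "\<And>k. k \<in> K \<Longrightarrow> 0 \<le> (y k::real)"
    and "0 \<le> a" "0 \<le> b"
    and x: "(\<Sum>k\<in>K. x k powr p) \<le> a powr p" and y: "(\<Sum>k\<in>K. y k powr p) \<le> b powr p"
  shows "(\<Sum>k\<in>K. (x k + y k) powr p) \<le> (a + b) powr p"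
proof (cases "a = 0 \<or> b = 0")
  case True
  then show ?thesis
  proof
    assume "a = 0"
    then have "(\<Sum>k\<in>K. x k powr p) = 0"
      using x by (intro antisym sum_nonneg) auto
    then have "x k = 0" if "k \<in> K" for k using that assms by (auto simp: sum_nonneg_eq_0_iff)
    then show ?thesis using y \<open>a = 0\<close> by simp
  next
    assume "b = 0"
    then have "(\<Sum>k\<in>K. y k powr p) = 0"
      using y by (intro antisym sum_nonneg) auto
    then have "y k = 0" if "k \<in> K" for k using that assms by (auto simp: sum_nonneg_eq_0_iff)
    then show ?thesis using x \<open>b = 0\<close> by simp
  qed
next
  case False
  then have ab: "a > 0" "b > 0" using assms by auto
  define l where "l = a / (a + b)"
  have l: "0 \<le> l" "l \<le> 1" "1 - l = b / (a + b)" using ab by (auto simp: l_def field_simps)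
  have "(x k + y k) powr p \<le> (a + b) powr p * (l * (x k powr p / a powr p) + (1 - l) * (y k powr p / b powr p))"
    if k: "k \<in> K" for k
  proof -
    have "x k + y k = (a + b) * (l * (x k / a) + (1 - l) * (y k / b))"
    proof -
      have "(a + b) * l = a" "(a + b) * (1 - l) = b" using ab l by (auto simp: l_def)
      then have "(a + b) * (l * (x k / a) + (1 - l) * (y k / b)) = a * (x k / a) + b * (y k / b)"
        by (metis distrib_left mult.assoc)
      then show ?thesis using ab by simp
    qed
    then have "(x k + y k) powr p = (a + b) powr p * (l * (x k / a) + (1 - l) * (y k / b)) powr p"
      using ab l assms k by (simp add: powr_mult)
    moreover have "(l * (x k / a) + (1 - l) * (y k / b)) powr p
        \<le> l * (x k / a) powr p + (1 - l) * (y k / b) powr p"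
      using powr_sum_jensen[of p "{0, 1::nat}" "\<lambda>i. if i = 0 then l else 1 - l"
          "\<lambda>i. if i = 0 then x k / a else y k / b"] l ab assms k by auto
    moreover have "(x k / a) powr p = x k powr p / a powr p" "(y k / b) powr p = y k powr p / b powr p"
      using ab assms k by (auto simp: powr_divide)
    ultimately show ?thesis by (simp add: mult_left_mono)
  qed
  then have "(\<Sum>k\<in>K. (x k + y k) powr p)
      \<le> (\<Sum>k\<in>K. (a + b) powr p * (l * (x k powr p / a powr p) + (1 - l) * (y k powr p / b powr p)))"
    by (rule sum_mono)
  also have "\<dots> = (a + b) powr p * (l * ((\<Sum>k\<in>K. x k powr p) / a powr p)
      + (1 - l) * ((\<Sum>k\<in>K. y k powr p) / b powr p))"
    by (simp add: sum_distrib_left sum_divide_distrib sum.distrib distrib_left)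
  also have "\<dots> \<le> (a + b) powr p * (l * 1 + (1 - l) * 1)"
    using l x y ab by (intro mult_left_mono add_mono) auto
  finally show ?thesis by simp
qed

text \<open>Gaussian elimination, one equation per induction step: an unknown \<open>q\<close> with
  non-zero coefficient in the equation \<open>j\<close> is expressed by the others. It supplies the
  test vector in \<open>schmidt_weyl\<close>.\<close>

lemma homogeneous_system_solution:
  fixes M :: "'a \<Rightarrow> 'b \<Rightarrow> 'k::field"
  assumes "finite J" "finite I" "card J < card I"
  shows "\<exists>c. (\<exists>i\<in>I. c i \<noteq> 0) \<and> (\<forall>j\<in>J. (\<Sum>i\<in>I. c i * M i j) = 0)"
  using assms
proof (induction J arbitrary: I M rule: finite_induct)
  case empty
  then obtain i where "i \<in> I" by (metis card.empty card_gt_0_iff equals0I)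
  then show ?case by (intro exI[of _ "\<lambda>_. 1"]) auto
next
  case (insert j J)
  show ?case
  proof (cases "\<forall>i\<in>I. M i j = 0")
    case True
    obtain c where "\<exists>i\<in>I. c i \<noteq> 0" "\<forall>j\<in>J. (\<Sum>i\<in>I. c i * M i j) = 0"
      using insert.IH[of I M] insert.prems insert.hyps by auto
    then show ?thesis using True by (intro exI[of _ c]) auto
  next
    case False
    then obtain q where q: "q \<in> I" "M q j \<noteq> 0" by blast
    let ?I = "I - {q}"
    define M' where "M' = (\<lambda>i j'. M i j' - M i j / M q j * M q j')"
    have "card J < card ?I" using insert q by auto
    then obtain c where c: "\<exists>i\<in>?I. c i \<noteq> 0" "\<forall>j'\<in>J. (\<Sum>i\<in>?I. c i * M' i j') = 0"
      using insert.IH[of ?I M'] insert.prems by auto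
    define d where "d = (\<lambda>i. if i = q then - (\<Sum>i\<in>?I. c i * M i j) / M q j else c i)"
    have dI: "(\<Sum>i\<in>I. d i * M i j') = d q * M q j' + (\<Sum>i\<in>?I. c i * M i j')" for j'
    proof -
      have "(\<Sum>i\<in>?I. d i * M i j') = (\<Sum>i\<in>?I. c i * M i j')"
        by (rule sum.cong) (auto simp: d_def)
      then show ?thesis using q insert.prems by (simp add: sum.remove)
    qed
    have "(\<Sum>i\<in>I. d i * M i j') = 0" if "j' \<in> insert j J" for j'
    proof (cases "j' = j")
      case True
      then show ?thesis using q by (simp add: dI) (simp add: d_def)
    next
      case False
      then have "(\<Sum>i\<in>?I. c i * M' i j') = 0" using that c by auto
      then have "(\<Sum>i\<in>?I. c i * M i j') = (\<Sum>i\<in>?I. c i * M i j) / M q j * M q j'"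
        by (simp add: M'_def right_diff_distrib sum_subtractf sum_distrib_right sum_divide_distrib mult.assoc)
      then show ?thesis by (simp add: dI) (simp add: d_def)
    qed
    moreover have "\<exists>i\<in>I. d i \<noteq> 0" using c(1) by (auto simp: d_def)
    ultimately show ?thesis by (intro exI[of _ d]) auto
  qed
qed

section \<open>Compact operators\<close>

text \<open>The type of bounded linear maps records real linearity only, so homogeneity over
  \<open>'k\<close> is a predicate of its own.\<close>

definition klin :: "(('i, 'k::rc_scalar) ell2 \<Rightarrow>\<^sub>L ('i, 'k) ell2) \<Rightarrow> bool" where
  "klin A \<longleftrightarrow> (\<forall>c x. blinfun_apply A (ksc c x) = ksc c (blinfun_apply A x))"

text \<open>Compactness as total boundedness of the image of the unit ball, a form in which finite
  nets can be combined for sums and perturbed for norm limits.\<close>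

definition compact_op :: "(('i, 'k::rc_scalar) ell2 \<Rightarrow>\<^sub>L ('i, 'k) ell2) \<Rightarrow> bool" where
  "compact_op A \<longleftrightarrow> klin A \<and>
     (\<forall>\<epsilon>>0. \<exists>K. finite K \<and> blinfun_apply A ` cball 0 1 \<subseteq> (\<Union>x\<in>K. ball x \<epsilon>))"

lemma compact_op_limit:
  assumes "klin A" and "\<And>\<epsilon>. \<epsilon> > 0 \<Longrightarrow> \<exists>B. compact_op B \<and> norm (A - B) < \<epsilon>"
  shows "compact_op A"
  unfolding compact_op_def
proof (intro conjI assms(1) allI impI)
  fix \<epsilon> :: real assume "\<epsilon> > 0"
  then obtain B where B: "compact_op B" "norm (A - B) < \<epsilon> / 2" using assms(2)[of "\<epsilon>/2"] by auto
  then obtain K where K: "finite K" "blinfun_apply B ` cball 0 1 \<subseteq> (\<Union>x\<in>K. ball x (\<epsilon>/2))"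
    unfolding compact_op_def using \<open>\<epsilon> > 0\<close> by (meson half_gt_zero)
  have "blinfun_apply A ` cball 0 1 \<subseteq> (\<Union>x\<in>K. ball x \<epsilon>)"
  proof (intro subsetI, elim imageE)
    fix y x assume y: "y = blinfun_apply A x" and x: "x \<in> cball 0 1"
    then obtain z where z: "z \<in> K" "dist z (blinfun_apply B x) < \<epsilon> / 2" using K(2) by fastforce
    have "dist (blinfun_apply B x) (blinfun_apply A x) = norm (blinfun_apply (A - B) x)"
      by (simp add: dist_norm blinfun.diff_left norm_minus_commute)
    also have "\<dots> \<le> norm (A - B) * 1"
      using norm_blinfun[of "A - B" x] x by (meson mem_cball_0 mult_left_mono norm_ge_zero order_trans)
    finally have "dist z y < \<epsilon>" using z B(2) dist_triangle[of z y "blinfun_apply B x"] y by simp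
    then show "y \<in> (\<Union>x\<in>K. ball x \<epsilon>)" using z by auto
  qed
  with K(1) show "\<exists>K. finite K \<and> blinfun_apply A ` cball 0 1 \<subseteq> (\<Union>x\<in>K. ball x \<epsilon>)"
    by (intro exI conjI)
qed

lemma compact_op_add:
  assumes "compact_op A" "compact_op B"
  shows "compact_op (A + B)"
  unfolding compact_op_def
proof (intro conjI allI impI)
  show "klin (A + B)" using assms by (simp add: compact_op_def klin_def blinfun.add_left ksc_add_right)
  fix \<epsilon> :: real assume "\<epsilon> > 0"
  then obtain K where K: "finite K" "blinfun_apply A ` cball 0 1 \<subseteq> (\<Union>x\<in>K. ball x (\<epsilon>/2))"
    using assms(1) unfolding compact_op_def by (meson half_gt_zero)
  obtain L where L: "finite L" "blinfun_apply B ` cball 0 1 \<subseteq> (\<Union>x\<in>L. ball x (\<epsilon>/2))"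
    using assms(2) \<open>\<epsilon> > 0\<close> unfolding compact_op_def by (meson half_gt_zero)
  let ?S = "(\<lambda>(x, y). x + y) ` (K \<times> L)"
  have "blinfun_apply (A + B) ` cball 0 1 \<subseteq> (\<Union>x\<in>?S. ball x \<epsilon>)"
  proof (intro subsetI, elim imageE)
    fix y x assume y: "y = blinfun_apply (A + B) x" and x: "x \<in> cball 0 1"
    then obtain z where z: "z \<in> K" "dist z (blinfun_apply A x) < \<epsilon> / 2" using K(2) by fastforce
    obtain w where w: "w \<in> L" "dist w (blinfun_apply B x) < \<epsilon> / 2" using L(2) x by fastforce
    have "dist (z + w) y < \<epsilon>"
      using dist_triangle_add[of z w "blinfun_apply A x" "blinfun_apply B x"] z w
      by (simp add: y blinfun.add_left)
    then show "y \<in> (\<Union>x\<in>?S. ball x \<epsilon>)" using z w by force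
  qed
  then show "\<exists>K. finite K \<and> blinfun_apply (A + B) ` cball 0 1 \<subseteq> (\<Union>x\<in>K. ball x \<epsilon>)"
    using K(1) L(1) by (intro exI[of _ ?S]) auto
qed

text \<open>The unit ball is mapped into the multiples of \<open>g\<close> by scalars of modulus at
  most \<open>norm h\<close>, a compact set by \<open>compact_cball_scalar\<close>.\<close>

lemma compact_op_rank_one:
  assumes A: "\<And>x. blinfun_apply A x = ksc (kinner x h) g"
  shows "compact_op A"
  unfolding compact_op_def
proof (intro conjI allI impI)
  show "klin A" by (simp add: klin_def A)
  fix \<epsilon> :: real assume "\<epsilon> > 0"
  have "compact ((\<lambda>c. ksc c g) ` cball 0 (norm h))"
    by (intro compact_continuous_image compact_cball_scalar continuous_intros)
  then obtain K where K: "finite K" "(\<lambda>c. ksc c g) ` cball 0 (norm h) \<subseteq> (\<Union>x\<in>K. ball x \<epsilon>)"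
    using \<open>\<epsilon> > 0\<close> unfolding compact_eq_totally_bounded by meson
  have "blinfun_apply A ` cball 0 1 \<subseteq> (\<lambda>c. ksc c g) ` cball 0 (norm h)"
  proof (intro subsetI, elim imageE)
    fix y x assume y: "y = blinfun_apply A x" and x: "x \<in> cball 0 1"
    have "norm (kinner x h) \<le> norm x * norm h" by (rule kinner_cauchy_schwarz)
    also have "\<dots> \<le> 1 * norm h" using x by (intro mult_right_mono) auto
    finally show "y \<in> (\<lambda>c. ksc c g) ` cball 0 (norm h)" by (auto simp: y A)
  qed
  from this K(2) have "blinfun_apply A ` cball 0 1 \<subseteq> (\<Union>x\<in>K. ball x \<epsilon>)" by (rule subset_trans)
  with K(1) show "\<exists>K. finite K \<and> blinfun_apply A ` cball 0 1 \<subseteq> (\<Union>x\<in>K. ball x \<epsilon>)"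
    by (intro exI conjI)
qed

text \<open>Total boundedness passes to the closure of the image, which is complete and therefore
  compact.\<close>

lemma compact_op_subseq:
  assumes "compact_op A" and x: "\<And>n::nat. norm (x n) \<le> 1"
  shows "\<exists>r y. strict_mono (r :: nat \<Rightarrow> nat) \<and> (\<lambda>n. blinfun_apply A (x (r n))) \<longlonglongrightarrow> y"
proof -
  let ?S = "closure (blinfun_apply A ` cball 0 1)"
  have "compact ?S"
    unfolding compact_eq_totally_bounded
  proof (intro conjI allI impI)
    show "complete ?S" by (simp add: complete_eq_closed)
    fix \<epsilon> :: real assume "\<epsilon> > 0"
    then obtain K where K: "finite K" "blinfun_apply A ` cball 0 1 \<subseteq> (\<Union>x\<in>K. ball x (\<epsilon>/2))"
      using assms(1) unfolding compact_op_def by (meson half_gt_zero)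
    have "?S \<subseteq> (\<Union>x\<in>K. cball x (\<epsilon>/2))"
    proof (rule closure_minimal)
      show "blinfun_apply A ` cball 0 1 \<subseteq> (\<Union>x\<in>K. cball x (\<epsilon>/2))"
        using K(2) by (rule subset_trans) (intro UN_mono subset_refl ball_subset_cball)
      show "closed (\<Union>x\<in>K. cball x (\<epsilon>/2))" using K(1) by auto
    qed
    also have "\<dots> \<subseteq> (\<Union>x\<in>K. ball x \<epsilon>)"
      using \<open>\<epsilon> > 0\<close> by (intro UN_mono subset_refl cball_subset_ball_iff[THEN iffD2]) auto
    finally show "\<exists>k. finite k \<and> ?S \<subseteq> (\<Union>x\<in>k. ball x \<epsilon>)"
      using K(1) by (intro exI conjI)
  qed
  moreover have "\<forall>n. blinfun_apply A (x n) \<in> ?S"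
    using x by (auto intro!: closure_subset[THEN subsetD])
  ultimately obtain y and r :: "nat \<Rightarrow> nat"
    where "strict_mono r" "((\<lambda>n. blinfun_apply A (x n)) \<circ> r) \<longlonglongrightarrow> y"
    by (metis compact_eq_seq_compact_metric seq_compactE)
  then show ?thesis by (auto simp: o_def)
qed

section \<open>Schmidt decompositions\<close>

text \<open>The zero vectors pad an orthonormal system to a sequence.\<close>

definition onz :: "(nat \<Rightarrow> ('i, 'k::rc_scalar) ell2) \<Rightarrow> bool" where
  "onz e \<longleftrightarrow> (\<forall>m n. kinner (e m) (e n) = (if m = n \<and> e n \<noteq> 0 then 1 else 0))"

lemma onz_norm: "onz e \<Longrightarrow> e n \<noteq> 0 \<Longrightarrow> norm (e n) = 1"
  unfolding onz_def norm_ell2_def inner_ell2_def by simp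

lemma onz_norm_le: "onz e \<Longrightarrow> norm (e n) \<le> 1"
  using onz_norm[of e n] by (cases "e n = 0") auto

lemma kinner_self_1: "norm e = 1 \<Longrightarrow> kinner e e = 1"
  by (simp add: kinner_self)

lemma onz_kinner_sum:
  assumes "onz e" "finite F"
  shows "kinner (\<Sum>k\<in>F. ksc (c k) (e k)) (e m) = (if m \<in> F \<and> e m \<noteq> 0 then c m else 0)"
proof -
  have "kinner (\<Sum>k\<in>F. ksc (c k) (e k)) (e m) = (\<Sum>k\<in>F. if k = m then (if e m \<noteq> 0 then c m else 0) else 0)"
    unfolding kinner_sum_left kinner_ksc_left
    by (rule sum.cong) (use assms(1) in \<open>auto simp: onz_def\<close>)
  then show ?thesis using assms(2) by simp
qed

lemma onz_norm_sum:
  assumes "onz e" "finite F"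
  shows "(norm (\<Sum>k\<in>F. ksc (c k) (e k)))\<^sup>2 = (\<Sum>k\<in>F. if e k = 0 then 0 else (norm (c k))\<^sup>2)"
proof -
  let ?x = "\<Sum>k\<in>F. ksc (c k) (e k)"
  have "kinner ?x ?x = (\<Sum>k\<in>F. kconj (c k) * kinner ?x (e k))"
    by (subst (2) kinner_sum_right[symmetric] | simp add: kinner_sum_right)+
  also have "\<dots> = (\<Sum>k\<in>F. of_real (if e k = 0 then 0 else (norm (c k))\<^sup>2))"
    by (rule sum.cong) (auto simp: onz_kinner_sum[OF assms] mult.commute[of "kconj _"] mult_kconj)
  finally have "of_real ((norm ?x)\<^sup>2) = (of_real (\<Sum>k\<in>F. if e k = 0 then 0 else (norm (c k))\<^sup>2) :: 'b)"
    by (simp only: kinner_self of_real_sum)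
  then show ?thesis by (simp only: of_real_eq_iff)
qed

lemma onz_norm_sum_le:
  assumes "onz e" "finite F"
  shows "(norm (\<Sum>k\<in>F. ksc (c k) (e k)))\<^sup>2 \<le> (\<Sum>k\<in>F. (norm (c k))\<^sup>2)"
  unfolding onz_norm_sum[OF assms] by (rule sum_mono) auto

lemma onz_pythagoras:
  assumes "onz e" "finite F"
  shows "(norm (x - (\<Sum>k\<in>F. ksc (kinner x (e k)) (e k))))\<^sup>2 = (norm x)\<^sup>2 - (\<Sum>k\<in>F. (norm (kinner x (e k)))\<^sup>2)"
proof -
  let ?y = "\<Sum>k\<in>F. ksc (kinner x (e k)) (e k)"
  have xy: "kinner x ?y = of_real (\<Sum>k\<in>F. (norm (kinner x (e k)))\<^sup>2)"
    by (simp only: kinner_sum_right kinner_ksc_right mult.commute[of "kconj _"] mult_kconj of_real_sum)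
  have yy: "(norm ?y)\<^sup>2 = (\<Sum>k\<in>F. (norm (kinner x (e k)))\<^sup>2)"
    unfolding onz_norm_sum[OF assms] by (rule sum.cong) auto
  have "(norm (x - ?y))\<^sup>2 = (norm x)\<^sup>2 + (norm ?y)\<^sup>2 - 2 * inner x ?y"
    by (simp add: power2_norm_eq_inner inner_diff inner_commute)
  then show ?thesis unfolding yy inner_ell2_def xy kre_of_real by simp
qed

lemma onz_bessel:
  assumes "onz e" "finite F"
  shows "(\<Sum>k\<in>F. (norm (kinner x (e k)))\<^sup>2) \<le> (norm x)\<^sup>2"
  using onz_pythagoras[OF assms, of x] by (smt (verit) zero_le_power2)

text \<open>The expansion of \<open>A\<close> in singular values \<open>s\<close>, right vectors
  \<open>e\<close> and left vectors \<open>f\<close>, demanded only pointwise in \<open>x\<close>.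
  Vectors vanish exactly where \<open>s\<close> does: this covers finite rank, and a positive
  \<open>s n\<close> guarantees genuine unit vectors up to index \<open>n\<close>.\<close>

definition schmidt :: "(('i, 'k::rc_scalar) ell2 \<Rightarrow>\<^sub>L ('i, 'k) ell2) \<Rightarrow> (nat \<Rightarrow> real) \<Rightarrow>
    (nat \<Rightarrow> ('i, 'k) ell2) \<Rightarrow> (nat \<Rightarrow> ('i, 'k) ell2) \<Rightarrow> bool" where
  "schmidt A s e f \<longleftrightarrow> decseq s \<and> s \<longlonglongrightarrow> 0 \<and> onz e \<and> onz f \<and>
     (\<forall>n. (e n = 0 \<longleftrightarrow> s n = 0) \<and> (f n = 0 \<longleftrightarrow> s n = 0)) \<and>
     (\<forall>x. (\<lambda>N. \<Sum>n<N. ksc (of_real (s n) * kinner x (e n)) (f n)) \<longlonglongrightarrow> blinfun_apply A x)"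

text \<open>Along a maximizing sequence in the unit sphere of \<open>V\<close> the images converge,
  by compactness, after passing to a subsequence. Two almost maximizing unit vectors with almost
  equal images have a sum of norm almost 2, so the parallelogram law makes the vectors Cauchy, and
  their limit attains the supremum. The value \<open>e = 0\<close> stands for an \<open>A\<close>
  that vanishes on \<open>V\<close>.\<close>

lemma maximizing_vector:
  assumes A: "compact_op A" and V: "closed V" "\<And>x y. x \<in> V \<Longrightarrow> y \<in> V \<Longrightarrow> x + y \<in> V"
      "\<And>c x. x \<in> V \<Longrightarrow> ksc c x \<in> V" "0 \<in> V"
  shows "\<exists>e\<in>V. (e = 0 \<or> norm e = 1 \<and> blinfun_apply A e \<noteq> 0) \<and>
    (\<forall>x\<in>V. norm (blinfun_apply A x) \<le> norm (blinfun_apply A e) * norm x)"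
proof (cases "\<forall>x\<in>V. blinfun_apply A x = 0")
  case True
  then show ?thesis using V by (intro bexI[of _ 0]) auto
next
  case False
  then obtain x0 where x0: "x0 \<in> V" "blinfun_apply A x0 \<noteq> 0" by blast
  then have "x0 \<noteq> 0" by (auto simp: blinfun.zero_right)
  let ?N = "\<lambda>x. norm (blinfun_apply A x)"
  let ?S = "{x\<in>V. norm x = 1}"
  define s where "s = (SUP x\<in>?S. ?N x)"
  have scaled: "(inverse (norm x)) *\<^sub>R x \<in> ?S" if "x \<in> V" "x \<noteq> 0" for x
  proof -
    have "(inverse (norm x)) *\<^sub>R x \<in> V" unfolding scaleR_ksc by (rule V(3)[OF that(1)])
    then show ?thesis using that(2) by simp
  qed
  have bdd: "bdd_above (?N ` ?S)"
  proof (rule bdd_aboveI2[where M="norm A"])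
    fix x assume "x \<in> ?S"
    then show "?N x \<le> norm A" using norm_blinfun[of A x] by simp
  qed
  have le: "?N x \<le> s * norm x" if x: "x \<in> V" for x
  proof (cases "x = 0")
    case False
    have "?N (inverse (norm x) *\<^sub>R x) \<le> s"
      unfolding s_def by (rule cSUP_upper[OF scaled[OF x False] bdd])
    then show ?thesis using False by (simp add: blinfun.scaleR_right divide_simps mult.commute)
  qed (simp add: blinfun.zero_right)
  have "0 < ?N x0" using x0 by simp
  also have "\<dots> \<le> s * norm x0" by (rule le[OF x0(1)])
  finally have "s > 0" using \<open>x0 \<noteq> 0\<close> by (simp add: zero_less_mult_iff)
  have "\<exists>x. x \<in> ?S \<and> s - 1 / real (Suc n) < ?N x" for n
  proof -
    have "?S \<noteq> {}" using scaled[OF x0(1) \<open>x0 \<noteq> 0\<close>] by blast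
    from less_cSUP_iff[OF this bdd, of "s - 1 / real (Suc n)"] show ?thesis
      unfolding s_def[symmetric] by auto
  qed
  then obtain z where z: "\<And>n. z n \<in> ?S" "\<And>n. s - 1 / real (Suc n) < ?N (z n)" by metis
  obtain r y where r: "strict_mono (r :: nat \<Rightarrow> nat)" and y: "(\<lambda>n. blinfun_apply A (z (r n))) \<longlonglongrightarrow> y"
    using compact_op_subseq[OF A, of z] z(1) by auto
  have "(\<lambda>n. ?N (z n)) \<longlonglongrightarrow> s"
  proof (rule tendsto_sandwich[OF _ _ _ tendsto_const])
    show "\<forall>\<^sub>F n in sequentially. s - 1 / real (Suc n) \<le> ?N (z n)"
      by (intro always_eventually allI less_imp_le z(2))
    show "\<forall>\<^sub>F n in sequentially. ?N (z n) \<le> s" 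
      using le z(1) by (intro always_eventually allI) (metis (mono_tags, lifting) mem_Collect_eq mult.right_neutral)
    show "(\<lambda>n. s - 1 / real (Suc n)) \<longlonglongrightarrow> s"
      using tendsto_diff[OF tendsto_const LIMSEQ_inverse_real_of_nat, of s] by (simp add: inverse_eq_divide)
  qed
  then have "(\<lambda>n. ?N (z (r n))) \<longlonglongrightarrow> s" using LIMSEQ_subseq_LIMSEQ[OF _ r] by (simp add: o_def)
  then have ny: "norm y = s" using tendsto_norm[OF y] LIMSEQ_unique by blast
  have "Cauchy (\<lambda>n. z (r n))"
  proof (rule CauchyI)
    fix \<epsilon> :: real assume "\<epsilon> > 0"
    \<comment> \<open>\<open>\<delta> \<le> s\<close> keeps \<open>2 * s - 2 * \<delta>\<close>
      non-negative before squaring; the other bound pushes the error \<open>8 * \<delta> * s\<close>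
      below \<open>(s * \<epsilon>)\<^sup>2\<close>.\<close>
    define \<delta> where "\<delta> = min s (\<epsilon>\<^sup>2 * s / 16)"
    have \<delta>: "0 < \<delta>" "\<delta> \<le> s" "8 * \<delta> \<le> \<epsilon>\<^sup>2 * s / 2" using \<open>s > 0\<close> \<open>\<epsilon> > 0\<close> by (auto simp: \<delta>_def)
    obtain n0 where n0: "\<And>n. n \<ge> n0 \<Longrightarrow> norm (blinfun_apply A (z (r n)) - y) < \<delta>"
      using LIMSEQ_D[OF y \<delta>(1)] by blast
    have "norm (z (r m) - z (r n)) < \<epsilon>" if mn: "m \<ge> n0" "n \<ge> n0" for m n
    proof -
      let ?a = "z (r m)" and ?b = "z (r n)"
      have ab: "?a \<in> V" "?b \<in> V" "norm ?a = 1" "norm ?b = 1" using z(1) by auto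
      have "norm (2 *\<^sub>R y) \<le> ?N (?a + ?b) + norm (blinfun_apply A ?a - y) + norm (blinfun_apply A ?b - y)"
      proof -
        have "2 *\<^sub>R y = blinfun_apply A (?a + ?b) - (blinfun_apply A ?a - y) - (blinfun_apply A ?b - y)"
          by (simp add: blinfun.add_right scaleR_2)
        then show ?thesis
          using norm_triangle_ineq4[of "blinfun_apply A (?a + ?b)" "blinfun_apply A ?a - y"]
            norm_triangle_ineq4[of "blinfun_apply A (?a + ?b) - (blinfun_apply A ?a - y)" "blinfun_apply A ?b - y"]
          by simp
      qed
      then have "2 * s - 2 * \<delta> \<le> ?N (?a + ?b)" using n0[OF mn(1)] n0[OF mn(2)] ny by simp
      also have "\<dots> \<le> s * norm (?a + ?b)" using le V(2) ab by blast
      finally have "(2 * s - 2 * \<delta>)\<^sup>2 \<le> (s * norm (?a + ?b))\<^sup>2"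
        using \<delta> by (intro power_mono) auto
      moreover have "(norm (?a - ?b))\<^sup>2 + (norm (?a + ?b))\<^sup>2 = 4"
        using ab by (simp add: power2_norm_eq_inner inner_diff inner_add inner_commute norm_eq_1)
      then have "(norm (?a - ?b))\<^sup>2 = 4 - (norm (?a + ?b))\<^sup>2" by simp
      then have "(s * norm (?a - ?b))\<^sup>2 = 4 * s\<^sup>2 - (s * norm (?a + ?b))\<^sup>2"
        by (simp only: power_mult_distrib) (simp add: algebra_simps)
      ultimately have "(s * norm (?a - ?b))\<^sup>2 \<le> 4 * s\<^sup>2 - (2 * s - 2 * \<delta>)\<^sup>2" by simp
      also have "\<dots> \<le> 8 * \<delta> * s" by (simp add: power2_eq_square algebra_simps)
      also have "\<dots> < (s * \<epsilon>)\<^sup>2"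
      proof -
        have "8 * \<delta> * s \<le> \<epsilon>\<^sup>2 * s / 2 * s" using \<delta>(3) \<open>s > 0\<close> by (intro mult_right_mono) auto
        also have "\<dots> < \<epsilon>\<^sup>2 * s * s" using \<open>s > 0\<close> \<open>\<epsilon> > 0\<close> by simp
        finally show ?thesis by (simp add: power2_eq_square mult_ac)
      qed
      finally have "s * norm (?a - ?b) < s * \<epsilon>"
        by (rule power_less_imp_less_base) (use \<open>s > 0\<close> \<open>\<epsilon> > 0\<close> in auto)
      then show ?thesis using \<open>s > 0\<close> by simp
    qed
    then show "\<exists>M. \<forall>m\<ge>M. \<forall>n\<ge>M. norm (z (r m) - z (r n)) < \<epsilon>" by blast
  qed
  then obtain e where e: "(\<lambda>n. z (r n)) \<longlonglongrightarrow> e" by (auto simp: Cauchy_convergent_iff convergent_def)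
  have "e \<in> V" by (rule closed_sequentially[OF V(1) _ e]) (use z(1) in auto)
  have "(\<lambda>n. norm (z (r n))) \<longlonglongrightarrow> norm e" by (rule tendsto_norm[OF e])
  moreover have "norm (z (r n)) = 1" for n using z(1) by auto
  ultimately have "norm e = 1" by (simp add: LIMSEQ_const_iff)
  have "blinfun_apply A e = y"
    by (rule LIMSEQ_unique[OF blinfun.tendsto[OF tendsto_const e] y])
  then show ?thesis using \<open>e \<in> V\<close> \<open>norm e = 1\<close> le ny \<open>s > 0\<close> by (intro bexI[of _ e]) auto
qed

text \<open>Moving \<open>e\<close> by a small multiple of \<open>x\<close>, with the phase taken
  from the inner product \<open>a\<close>, would raise the norm of the image to first order, while
  the norm of the orthogonal sum \<open>e + c x\<close> grows to second order only.\<close>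

lemma maximizer_orthogonal:
  assumes "klin A" and V: "e \<in> V" "x \<in> V" "\<And>x y. x \<in> V \<Longrightarrow> y \<in> V \<Longrightarrow> x + y \<in> V"
      "\<And>c x. x \<in> V \<Longrightarrow> ksc c x \<in> V"
    and e: "norm e = 1" and max: "\<And>x. x \<in> V \<Longrightarrow> norm (blinfun_apply A x) \<le> norm (blinfun_apply A e) * norm x"
    and xe: "kinner x e = 0"
  shows "kinner (blinfun_apply A x) (blinfun_apply A e) = 0"
proof (rule ccontr)
  define a where "a = kinner (blinfun_apply A x) (blinfun_apply A e)"
  assume "kinner (blinfun_apply A x) (blinfun_apply A e) \<noteq> 0"
  then have a: "norm a > 0" by (simp add: a_def)
  let ?s = "norm (blinfun_apply A e)"
  define B where "B = ?s\<^sup>2 * (norm x)\<^sup>2"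
  have key: "2 * r * (norm a)\<^sup>2 \<le> r\<^sup>2 * (norm a)\<^sup>2 * B" if "r > 0" for r :: real
  proof -
    define c where "c = of_real r * kconj a"
    have nc: "(norm c)\<^sup>2 = r\<^sup>2 * (norm a)\<^sup>2" using \<open>r > 0\<close> by (simp add: c_def norm_mult power_mult_distrib)
    have "(norm (blinfun_apply A (e + ksc c x)))\<^sup>2 \<le> (?s * norm (e + ksc c x))\<^sup>2"
      using V max by (intro power_mono) auto
    also have "\<dots> = ?s\<^sup>2 * ((norm e)\<^sup>2 + (norm (ksc c x))\<^sup>2)"
    proof -
      have "inner e (ksc c x) = 0"
        using xe kinner_commute[of x e] by (simp add: inner_ell2_def)
      then have "(norm (e + ksc c x))\<^sup>2 = (norm e)\<^sup>2 + (norm (ksc c x))\<^sup>2"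
        unfolding power2_norm_eq_inner by (simp add: inner_add inner_commute)
      then show ?thesis by (simp add: power_mult_distrib)
    qed
    also have "\<dots> = ?s\<^sup>2 + r\<^sup>2 * (norm a)\<^sup>2 * B" using e nc by (simp add: B_def power_mult_distrib algebra_simps)
    finally have 1: "(norm (blinfun_apply A (e + ksc c x)))\<^sup>2 \<le> ?s\<^sup>2 + r\<^sup>2 * (norm a)\<^sup>2 * B" .
    have "blinfun_apply A (e + ksc c x) = blinfun_apply A e + ksc c (blinfun_apply A x)"
      using assms(1) by (simp add: klin_def blinfun.add_right)
    moreover have "inner (ksc c (blinfun_apply A x)) (blinfun_apply A e) = r * (norm a)\<^sup>2"
      by (simp add: inner_ell2_def a_def[symmetric] c_def mult.assoc)
    ultimately have "(norm (blinfun_apply A (e + ksc c x)))\<^sup>2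
        = ?s\<^sup>2 + 2 * (r * (norm a)\<^sup>2) + (norm (ksc c (blinfun_apply A x)))\<^sup>2"
      by (simp only: power2_norm_eq_inner inner_add) (simp add: inner_commute)
    then show ?thesis using 1 zero_le_power2[of "norm (ksc c (blinfun_apply A x))"] by linarith
  qed
  have B: "B \<ge> 0" by (simp add: B_def)
  \<comment> \<open>Cancelling \<open>r * (norm a)\<^sup>2\<close> in \<open>key\<close> leaves
    \<open>2 \<le> r * B\<close>, which this \<open>r\<close> violates.\<close>
  define r where "r = 1 / (B + 1)"
  have "r > 0" "r * B < 1" using B by (auto simp: r_def)
  have "r * (norm a)\<^sup>2 * 2 \<le> r * (norm a)\<^sup>2 * (r * B)"
    using key[OF \<open>r > 0\<close>] by (simp add: power2_eq_square mult_ac)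
  moreover have "r * (norm a)\<^sup>2 > 0" using \<open>r > 0\<close> a by simp
  ultimately have "2 \<le> r * B" by (metis mult_le_cancel_left_pos)
  with \<open>r * B < 1\<close> show False by simp
qed

lemma orthogonal_complement_props:
  fixes e :: "nat \<Rightarrow> ('i, 'k::rc_scalar) ell2"
  defines "V \<equiv> \<lambda>n. {x. \<forall>i<n. kinner x (e i) = 0}"
  shows "closed (V n)" "0 \<in> V n" "x \<in> V n \<Longrightarrow> y \<in> V n \<Longrightarrow> x + y \<in> V n"
    "x \<in> V n \<Longrightarrow> ksc c x \<in> V n"
proof -
  have "V n = (\<Inter>i\<in>{..<n}. {x. kinner x (e i) = 0})" by (auto simp: V_def)
  also have "closed \<dots>"
    by (intro closed_INT ballI closed_Collect_eq continuous_intros)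
  finally show "closed (V n)" .
qed (auto simp: V_def kinner_add_left)

text \<open>Each \<open>e n\<close> maximizes the norm of \<open>A\<close> on the unit sphere of the orthogonal complement of its
  predecessors; the first variation shows that the images are orthogonal as well.\<close>

theorem schmidt_exists:
  assumes A: "compact_op A"
  shows "\<exists>s e f. schmidt A s e f"
proof -
  define V where "V = (\<lambda>(e :: nat \<Rightarrow> ('a, 'b) ell2) n. {x. \<forall>i<n. kinner x (e i) = 0})"
  have V: "closed (V e n)" "0 \<in> V e n" "x \<in> V e n \<Longrightarrow> y \<in> V e n \<Longrightarrow> x + y \<in> V e n"
    "x \<in> V e n \<Longrightarrow> ksc c x \<in> V e n" for e n x y c
    unfolding V_def by (rule orthogonal_complement_props; assumption)+
  have "\<exists>e. \<forall>n. e n \<in> V e n \<and> (e n = 0 \<or> norm (e n) = 1 \<and> blinfun_apply A (e n) \<noteq> 0) \<and>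
      (\<forall>x\<in>V e n. norm (blinfun_apply A x) \<le> norm (blinfun_apply A (e n)) * norm x)"
  \<comment> \<open>\<open>V f n\<close> reads only the values of \<open>f\<close> below
    \<open>n\<close>, which permits the recursive choice.\<close>
  proof (rule dependent_wellorder_choice)
    fix r and f g :: "nat \<Rightarrow> ('a, 'b) ell2" and n
    assume "\<And>y. y < n \<Longrightarrow> f y = g y"
    then have "V f n = V g n" by (auto simp: V_def)
    then show "(r \<in> V f n \<and> (r = 0 \<or> norm r = 1 \<and> blinfun_apply A r \<noteq> 0) \<and>
        (\<forall>x\<in>V f n. norm (blinfun_apply A x) \<le> norm (blinfun_apply A r) * norm x)) =
      (r \<in> V g n \<and> (r = 0 \<or> norm r = 1 \<and> blinfun_apply A r \<noteq> 0) \<and>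
        (\<forall>x\<in>V g n. norm (blinfun_apply A x) \<le> norm (blinfun_apply A r) * norm x))" by simp
  next
    fix n and f :: "nat \<Rightarrow> ('a, 'b) ell2"
    show "\<exists>r. r \<in> V f n \<and> (r = 0 \<or> norm r = 1 \<and> blinfun_apply A r \<noteq> 0) \<and>
        (\<forall>x\<in>V f n. norm (blinfun_apply A x) \<le> norm (blinfun_apply A r) * norm x)"
      using maximizing_vector[OF A V(1,3,4,2), of f n] by blast
  qed
  then obtain e where eV: "\<And>n. e n \<in> V e n"
    and e1: "\<And>n. e n = 0 \<or> norm (e n) = 1 \<and> blinfun_apply A (e n) \<noteq> 0"
    and emax: "\<And>n x. x \<in> V e n \<Longrightarrow> norm (blinfun_apply A x) \<le> norm (blinfun_apply A (e n)) * norm x"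
    by blast
  define s where "s = (\<lambda>n. norm (blinfun_apply A (e n)))"
  define f where "f = (\<lambda>n. inverse (s n) *\<^sub>R blinfun_apply A (e n))"
  have Vmono: "V e n \<subseteq> V e m" if "m \<le> n" for m n using that by (auto simp: V_def)
  have s0: "s n \<ge> 0" for n by (simp add: s_def)
  have es: "e n = 0 \<longleftrightarrow> s n = 0" for n using e1[of n] by (auto simp: s_def blinfun.zero_right)
  have fs: "f n = 0 \<longleftrightarrow> s n = 0" for n by (auto simp: f_def s_def)
  have ne: "norm (e n) \<le> 1" for n using e1[of n] by auto
  have dec: "decseq s"
  proof (rule decseq_SucI)
    fix n
    have "s (Suc n) \<le> s n * norm (e (Suc n))"
      unfolding s_def using emax eV[of "Suc n"] Vmono[of n "Suc n"] by auto
    also have "\<dots> \<le> s n" using ne s0 by (simp add: mult_left_le)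
    finally show "s (Suc n) \<le> s n" .
  qed
  have orth: "kinner (e m) (e n) = 0" if "n < m" for m n
    using eV[of m] that by (simp add: V_def)
  have "onz e"
    unfolding onz_def
  proof (intro allI)
    fix m n
    show "kinner (e m) (e n) = (if m = n \<and> e n \<noteq> 0 then 1 else 0)"
    proof (cases m n rule: linorder_cases)
      case less
      then show ?thesis using orth[OF less] kinner_commute[of "e n" "e m"] by simp
    next
      case equal
      then show ?thesis using e1[of n] by (auto simp: kinner_self_1)
    qed (use orth in auto)
  qed
  have Aorth: "kinner (blinfun_apply A (e m)) (blinfun_apply A (e n)) = 0" if "n < m" for m n
  proof (cases "e n = 0")
    case False
    then have "norm (e n) = 1" using e1 by blast
    show ?thesis
      by (rule maximizer_orthogonal[where V="V e n"])
        (use A eV Vmono[of n m] that V emax orth \<open>norm (e n) = 1\<close> in \<open>auto simp: compact_op_def\<close>)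
  qed (simp add: blinfun.zero_right)
  have "onz f"
    unfolding onz_def
  proof (intro allI)
    fix m n
    show "kinner (f m) (f n) = (if m = n \<and> f n \<noteq> 0 then 1 else 0)"
    proof (cases m n rule: linorder_cases)
      case less
      then show ?thesis
        using Aorth[OF less] kinner_commute[of "blinfun_apply A (e n)" "blinfun_apply A (e m)"] by (simp add: f_def)
    next
      case equal
      show ?thesis
      proof (cases "s n = 0")
        case False
        then have "norm (f n) = 1" by (simp add: f_def s_def)
        then show ?thesis using equal by (auto simp: kinner_self_1)
      next
        case True
        then have "f n = 0" using fs by blast
        then show ?thesis using equal by simp
      qed
    qed (use Aorth in \<open>auto simp: f_def\<close>)
  qed
  \<comment> \<open>Otherwise the images of the \<open>e n\<close> would be orthogonal and bounded
    away from 0, leaving no Cauchy subsequence.\<close>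
  have "s \<longlonglongrightarrow> 0"
  proof -
    obtain L where L: "s \<longlonglongrightarrow> L" "\<And>n. L \<le> s n"
      using decseq_convergent[OF dec, of 0] s0 by auto
    have "L \<ge> 0" by (rule LIMSEQ_le_const[OF L(1)]) (use s0 in auto)
    moreover have False if pos: "L > 0"
    proof -
      obtain r y where r: "strict_mono (r :: nat \<Rightarrow> nat)" and y: "(\<lambda>n. blinfun_apply A (e (r n))) \<longlonglongrightarrow> y"
        using compact_op_subseq[OF A, of e] ne by blast
      obtain N where N: "\<And>m n. m \<ge> N \<Longrightarrow> n \<ge> N \<Longrightarrow> norm (blinfun_apply A (e (r m)) - blinfun_apply A (e (r n))) < L"
        using CauchyD[OF LIMSEQ_imp_Cauchy[OF y] pos] by blast
      let ?a = "blinfun_apply A (e (r (Suc N)))" and ?b = "blinfun_apply A (e (r N))"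
      have "inner ?a ?b = 0"
        using Aorth[OF strict_monoD[OF r, of N "Suc N"]] by (simp add: inner_ell2_def)
      then have "(norm (?a - ?b))\<^sup>2 = (norm ?a)\<^sup>2 + (norm ?b)\<^sup>2"
        unfolding power2_norm_eq_inner by (simp add: inner_diff inner_commute)
      also have "\<dots> \<ge> L\<^sup>2"
      proof -
        have "L\<^sup>2 \<le> (norm ?b)\<^sup>2" using L(2)[of "r N"] pos by (intro power_mono) (auto simp: s_def)
        then show ?thesis using zero_le_power2[of "norm ?a"] by linarith
      qed
      finally have "L \<le> norm (?a - ?b)" by (rule power2_le_imp_le) simp
      then show False using N[of "Suc N" N] by simp
    qed
    ultimately show ?thesis using L(1) by (cases "L = 0") auto
  qed
  have "(\<lambda>N. \<Sum>n<N. ksc (of_real (s n) * kinner x (e n)) (f n)) \<longlonglongrightarrow> blinfun_apply A x" for x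
  proof -
    let ?p = "\<lambda>N. \<Sum>n<N. ksc (kinner x (e n)) (e n)"
    have Ap: "blinfun_apply A (?p N) = (\<Sum>n<N. ksc (of_real (s n) * kinner x (e n)) (f n))" for N
    proof -
      have "blinfun_apply A (ksc (kinner x (e n)) (e n)) = ksc (of_real (s n) * kinner x (e n)) (f n)" for n
      proof -
        have "blinfun_apply A (e n) = ksc (of_real (s n)) (f n)"
          unfolding scaleR_ksc[symmetric] f_def by (cases "s n = 0") (auto simp: s_def)
        then show ?thesis using A by (simp add: compact_op_def klin_def mult.commute)
      qed
      then show ?thesis by (simp add: blinfun.sum_right)
    qed
    \<comment> \<open>The remainder of \<open>x\<close> after \<open>N\<close> terms is orthogonal
      to the first \<open>N\<close> vectors, so the maximality of \<open>e N\<close> bounds its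
      image.\<close>
    have "norm (blinfun_apply A x - blinfun_apply A (?p N)) \<le> s N * norm x" for N
    proof -
      have "x - ?p N \<in> V e N"
        using onz_kinner_sum[OF \<open>onz e\<close> finite_lessThan, of "\<lambda>n. kinner x (e n)" N]
        by (auto simp: V_def kinner_diff_left)
      then have "norm (blinfun_apply A (x - ?p N)) \<le> s N * norm (x - ?p N)" unfolding s_def by (rule emax)
      also have "\<dots> \<le> s N * norm x"
      proof (rule mult_left_mono[OF _ s0])
        have "(norm (x - ?p N))\<^sup>2 \<le> (norm x)\<^sup>2"
          unfolding onz_pythagoras[OF \<open>onz e\<close> finite_lessThan] by (simp add: sum_nonneg)
        then show "norm (x - ?p N) \<le> norm x" by (rule power2_le_imp_le) simp
      qed
      finally show ?thesis by (simp add: blinfun.diff_right)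
    qed
    moreover have "(\<lambda>N. s N * norm x) \<longlonglongrightarrow> 0" using tendsto_mult_left_zero[OF \<open>s \<longlonglongrightarrow> 0\<close>] by blast
    ultimately have "(\<lambda>N. blinfun_apply A x - blinfun_apply A (?p N)) \<longlonglongrightarrow> 0"
      by (rule Lim_null_comparison[OF always_eventually[OF allI]])
    then have "(\<lambda>N. blinfun_apply A x - (blinfun_apply A x - blinfun_apply A (?p N))) \<longlonglongrightarrow> blinfun_apply A x - 0"
      by (intro tendsto_diff tendsto_const)
    then show ?thesis by (simp add: Ap)
  qed
  then have "schmidt A s e f"
    unfolding schmidt_def using dec \<open>s \<longlonglongrightarrow> 0\<close> \<open>onz e\<close> \<open>onz f\<close> es fs by blast
  then show ?thesis by blast
qed

section \<open>Consequences of a Schmidt decomposition\<close>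

lemma schmidtD:
  assumes "schmidt A s e f"
  shows "decseq s" "s \<longlonglongrightarrow> 0" "onz e" "onz f" "e n = 0 \<longleftrightarrow> s n = 0" "f n = 0 \<longleftrightarrow> s n = 0"
    "(\<lambda>N. \<Sum>n<N. ksc (of_real (s n) * kinner x (e n)) (f n)) \<longlonglongrightarrow> blinfun_apply A x"
    "0 \<le> s n"
  using assms decseq_ge unfolding schmidt_def by auto

lemma schmidt_apply:
  assumes S: "schmidt A s e f"
  shows "blinfun_apply A (e n) = ksc (of_real (s n)) (f n)"
proof (rule LIMSEQ_unique[OF schmidtD(7)[OF S]])
  have "(\<Sum>k<N. ksc (of_real (s k) * kinner (e n) (e k)) (f k)) = ksc (of_real (s n)) (f n)" if "N \<ge> Suc n" for N
  proof -
    have "(\<Sum>k<N. ksc (of_real (s k) * kinner (e n) (e k)) (f k))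
        = (\<Sum>k<N. if k = n then ksc (of_real (s n)) (f n) else 0)"
      by (rule sum.cong) (use schmidtD(3,5)[OF S] in \<open>auto simp: onz_def\<close>)
    then show ?thesis using that by simp
  qed
  then show "(\<lambda>N. \<Sum>k<N. ksc (of_real (s k) * kinner (e n) (e k)) (f k)) \<longlonglongrightarrow> ksc (of_real (s n)) (f n)"
    by (intro tendsto_eventually eventually_sequentiallyI)
qed

text \<open>The relation \<open>A* (f n) = s n e n\<close> in weak form, obtained by pairing the
  expansion with \<open>f n\<close>.\<close>

lemma schmidt_kinner:
  assumes S: "schmidt A s e f"
  shows "kinner (blinfun_apply A x) (f n) = of_real (s n) * kinner x (e n)"
proof (rule LIMSEQ_unique)
  show "(\<lambda>N. kinner (\<Sum>k<N. ksc (of_real (s k) * kinner x (e k)) (f k)) (f n)) \<longlonglongrightarrow> kinner (blinfun_apply A x) (f n)"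
    by (intro tendsto_kinner schmidtD(7)[OF S] tendsto_const)
  have "kinner (\<Sum>k<N. ksc (of_real (s k) * kinner x (e k)) (f k)) (f n) = of_real (s n) * kinner x (e n)"
    if "N \<ge> Suc n" for N
    using that schmidtD(6)[OF S, of n]
    by (subst onz_kinner_sum[OF schmidtD(4)[OF S]]) auto
  then show "(\<lambda>N. kinner (\<Sum>k<N. ksc (of_real (s k) * kinner x (e k)) (f k)) (f n)) \<longlonglongrightarrow> of_real (s n) * kinner x (e n)"
    by (intro tendsto_eventually eventually_sequentiallyI)
qed

text \<open>Only the terms from index \<open>n\<close> on survive, with coefficients at most
  \<open>s n\<close>; orthonormality of \<open>f\<close> and Bessel's inequality for
  \<open>e\<close> do the rest.\<close>

lemma schmidt_bound:
  assumes S: "schmidt A s e f" and x: "\<And>i. i < n \<Longrightarrow> kinner x (e i) = 0"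
  shows "norm (blinfun_apply A x) \<le> s n * norm x"
proof (rule LIMSEQ_le_const2[OF tendsto_norm[OF schmidtD(7)[OF S]]])
  have "norm (\<Sum>k<N. ksc (of_real (s k) * kinner x (e k)) (f k)) \<le> s n * norm x" for N
  proof (rule power2_le_imp_le)
    have "(norm (\<Sum>k<N. ksc (of_real (s k) * kinner x (e k)) (f k)))\<^sup>2
        \<le> (\<Sum>k<N. (norm (of_real (s k) * kinner x (e k)))\<^sup>2)"
      by (rule onz_norm_sum_le[OF schmidtD(4)[OF S]]) simp
    also have "\<dots> \<le> (\<Sum>k<N. (s n)\<^sup>2 * (norm (kinner x (e k)))\<^sup>2)"
    proof (rule sum_mono)
      fix k
      show "(norm (of_real (s k) * kinner x (e k)))\<^sup>2 \<le> (s n)\<^sup>2 * (norm (kinner x (e k)))\<^sup>2"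
      proof (cases "k < n")
        case False
        then have "s k \<le> s n" using schmidtD(1)[OF S] by (simp add: decseq_def)
        then show ?thesis
          using schmidtD(8)[OF S, of k] by (auto simp: norm_mult power_mult_distrib intro!: mult_right_mono power_mono)
      qed (use x in auto)
    qed
    also have "\<dots> \<le> (s n)\<^sup>2 * (norm x)\<^sup>2"
      unfolding sum_distrib_left[symmetric]
      by (intro mult_left_mono onz_bessel[OF schmidtD(3)[OF S]]) auto
    finally show "(norm (\<Sum>k<N. ksc (of_real (s k) * kinner x (e k)) (f k)))\<^sup>2 \<le> (s n * norm x)\<^sup>2"
      by (simp add: power_mult_distrib)
  qed (use schmidtD(8)[OF S] in auto)
  then show "\<exists>N. \<forall>n'\<ge>N. norm (\<Sum>k<n'. ksc (of_real (s k) * kinner x (e k)) (f k)) \<le> s n * norm x" by blast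
qed

lemma klin_sum:
  assumes "klin A"
  shows "blinfun_apply A (\<Sum>k\<in>F. ksc (c k) (e k)) = (\<Sum>k\<in>F. ksc (c k) (blinfun_apply A (e k)))"
  using assms by (simp add: klin_def blinfun.sum_right)

lemma schmidt_klin:
  assumes S: "schmidt A s e f"
  shows "klin A"
  unfolding klin_def
proof (intro allI)
  fix c x
  show "blinfun_apply A (ksc c x) = ksc c (blinfun_apply A x)"
  proof (rule LIMSEQ_unique[OF schmidtD(7)[OF S]])
    have "(\<lambda>N. ksc c (\<Sum>n<N. ksc (of_real (s n) * kinner x (e n)) (f n))) \<longlonglongrightarrow> ksc c (blinfun_apply A x)"
      by (intro tendsto_ksc tendsto_const schmidtD(7)[OF S])
    then show "(\<lambda>N. \<Sum>n<N. ksc (of_real (s n) * kinner (ksc c x) (e n)) (f n)) \<longlonglongrightarrow> ksc c (blinfun_apply A x)"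
      by (simp add: ksc_sum_right mult.left_commute)
  qed
qed

lemma schmidt_norm:
  assumes S: "schmidt A s e f"
  shows "norm A = s 0"
proof (rule antisym)
  show "norm A \<le> s 0" by (rule norm_blinfun_bound) (use schmidtD(8)[OF S] schmidt_bound[OF S, of 0] in auto)
  show "s 0 \<le> norm A"
  proof (cases "s 0 = 0")
    case False
    then have "norm (e 0) = 1" "norm (f 0) = 1"
      using schmidtD(3-6)[OF S] onz_norm by blast+
    then show ?thesis
      using norm_blinfun[of A "e 0"] schmidtD(8)[OF S, of 0] by (simp add: schmidt_apply[OF S])
  qed simp
qed

text \<open>The span of the first \<open>m + n + 1\<close> singular vectors of \<open>A + B\<close> meets the space where \<open>A\<close> is bounded by its
  \<open>m\<close>-th and \<open>B\<close> by its \<open>n\<close>-th singular value, by counting equations.\<close>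

lemma schmidt_weyl:
  assumes S: "schmidt A s e f" and S': "schmidt B s' e' f'" and S'': "schmidt (A + B) s'' e'' f''"
  shows "s'' (m + n) \<le> s m + s' n"
proof (cases "s'' (m + n) = 0")
  case True
  then show ?thesis using schmidtD(8)[OF S, of m] schmidtD(8)[OF S', of n] by simp
next
  case False
  then have pos: "s'' (m + n) > 0" using schmidtD(8)[OF S'', of "m + n"] by simp
  have ge: "s'' (m + n) \<le> s'' i" if "i \<le> m + n" for i
    using schmidtD(1)[OF S''] that by (simp add: decseq_def)
  \<comment> \<open>Equations \<open>j < m\<close> ask for orthogonality to the leading vectors of
    \<open>A\<close>, the remaining \<open>n\<close> for orthogonality to those of \<open>B\<close>:
    \<open>m + n\<close> equations in \<open>m + n + 1\<close> unknowns.\<close>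
  define M where "M = (\<lambda>i j. if j < m then kinner (e'' i) (e j) else kinner (e'' i) (e' (j - m)))"
  obtain c where c: "\<exists>i\<in>{..m+n}. c i \<noteq> 0" "\<forall>j\<in>{..<m+n}. (\<Sum>i\<in>{..m+n}. c i * M i j) = 0"
    using homogeneous_system_solution[of "{..<m+n}" "{..m+n}" M] by auto
  define x where "x = (\<Sum>i\<in>{..m+n}. ksc (c i) (e'' i))"
  have 1: "kinner x (e j) = 0" if "j < m" for j
    using c(2)[rule_format, of j] that by (simp add: x_def kinner_sum_left M_def)
  have 2: "kinner x (e' j) = 0" if "j < n" for j
    using c(2)[rule_format, of "m + j"] that by (simp add: x_def kinner_sum_left M_def)
  have nz: "e'' i \<noteq> 0" "f'' i \<noteq> 0" if "i \<le> m + n" for i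
    using ge[OF that] pos schmidtD(5,6)[OF S'', of i] by auto
  have nx: "(norm x)\<^sup>2 = (\<Sum>i\<in>{..m+n}. (norm (c i))\<^sup>2)"
    unfolding x_def onz_norm_sum[OF schmidtD(3)[OF S''] finite_atMost] by (rule sum.cong) (use nz in auto)
  have "norm x \<noteq> 0"
  proof
    assume "norm x = 0"
    then have "\<forall>i\<in>{..m+n}. (norm (c i))\<^sup>2 = 0" using nx by (simp add: sum_nonneg_eq_0_iff)
    with c(1) show False by auto
  qed
  \<comment> \<open>On the span of the vectors up to index \<open>m + n\<close> the operator
    \<open>A + B\<close> stretches norms by at least its smallest coefficient there,
    \<open>s'' (m + n)\<close>.\<close>
  have "(s'' (m + n) * norm x)\<^sup>2 = (\<Sum>i\<in>{..m+n}. (s'' (m + n))\<^sup>2 * (norm (c i))\<^sup>2)"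
    by (simp add: power_mult_distrib nx sum_distrib_left)
  also have "\<dots> \<le> (\<Sum>i\<in>{..m+n}. (norm (c i * of_real (s'' i)))\<^sup>2)"
  proof (rule sum_mono)
    fix i assume "i \<in> {..m+n}"
    then have "(s'' (m + n))\<^sup>2 \<le> (s'' i)\<^sup>2" using ge[of i] pos by (intro power_mono) auto
    then show "(s'' (m + n))\<^sup>2 * (norm (c i))\<^sup>2 \<le> (norm (c i * of_real (s'' i)))\<^sup>2"
      using mult_right_mono[of _ _ "(norm (c i))\<^sup>2"] by (fastforce simp: norm_mult power_mult_distrib mult.commute)
  qed
  also have "\<dots> = (norm (\<Sum>i\<in>{..m+n}. ksc (c i * of_real (s'' i)) (f'' i)))\<^sup>2"
    unfolding onz_norm_sum[OF schmidtD(4)[OF S''] finite_atMost] by (rule sum.cong) (use nz in auto)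
  also have "(\<Sum>i\<in>{..m+n}. ksc (c i * of_real (s'' i)) (f'' i)) = blinfun_apply (A + B) x"
    unfolding x_def klin_sum[OF schmidt_klin[OF S'']] schmidt_apply[OF S''] by simp
  finally have "s'' (m + n) * norm x \<le> norm (blinfun_apply (A + B) x)"
    by (rule power2_le_imp_le) simp
  also have "\<dots> \<le> norm (blinfun_apply A x) + norm (blinfun_apply B x)"
    by (simp add: blinfun.add_left norm_triangle_ineq)
  also have "\<dots> \<le> s m * norm x + s' n * norm x"
    by (intro add_mono schmidt_bound[OF S 1] schmidt_bound[OF S' 2])
  finally show ?thesis using \<open>norm x \<noteq> 0\<close> by (simp add: distrib_right[symmetric])
qed

text \<open>Singular values must stay non-negative, so the modulus of \<open>c\<close> goes into
  \<open>s\<close> and its phase into the left vectors.\<close>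

lemma schmidt_scale:
  assumes S: "schmidt A s e f" and "c \<noteq> 0" and B: "\<And>x. blinfun_apply B x = ksc c (blinfun_apply A x)"
  shows "schmidt B (\<lambda>n. norm c * s n) e (\<lambda>n. ksc (c / of_real (norm c)) (f n))"
  unfolding schmidt_def
proof (intro conjI allI)
  show "decseq (\<lambda>n. norm c * s n)"
    using schmidtD(1)[OF S] by (auto simp: decseq_def intro: mult_left_mono)
  show "(\<lambda>n. norm c * s n) \<longlonglongrightarrow> 0" using tendsto_mult_right_zero[OF schmidtD(2)[OF S]] by blast
  show "onz e" by (rule schmidtD(3)[OF S])
  define u where "u = c / of_real (norm c)"
  have unit: "norm u = 1" using \<open>c \<noteq> 0\<close> by (simp add: norm_divide u_def)
  then have "u * kconj u = 1" by (simp only: mult_kconj) simp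
  then have uu: "u * kconj u = 1" "kconj u * u = 1" by (simp_all add: mult.commute)
  have kz: "ksc u y = 0 \<longleftrightarrow> y = 0" for y :: "('a, 'b) ell2"
    using norm_ksc[of u y] unit by (metis mult_1 norm_eq_zero)
  have "kinner (ksc u x) (ksc u y) = kinner x y" for x y
    by (simp add: mult.assoc[symmetric] uu)
  then show "onz (\<lambda>n. ksc (c / of_real (norm c)) (f n))"
    using schmidtD(4)[OF S] unfolding onz_def u_def[symmetric] by (simp add: kz uu)
  show "e n = 0 \<longleftrightarrow> norm c * s n = 0" for n using schmidtD(5)[OF S] \<open>c \<noteq> 0\<close> by simp
  show "ksc (c / of_real (norm c)) (f n) = 0 \<longleftrightarrow> norm c * s n = 0" for n
    unfolding u_def[symmetric] kz using schmidtD(6)[OF S] \<open>c \<noteq> 0\<close> by simp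
  fix x
  have "(\<lambda>N. ksc c (\<Sum>n<N. ksc (of_real (s n) * kinner x (e n)) (f n))) \<longlonglongrightarrow> ksc c (blinfun_apply A x)"
    by (intro tendsto_ksc tendsto_const schmidtD(7)[OF S])
  moreover have "ksc (of_real (norm c * s n) * kinner x (e n)) (ksc (c / of_real (norm c)) (f n))
      = ksc c (ksc (of_real (s n) * kinner x (e n)) (f n))" for n
    using \<open>c \<noteq> 0\<close> by (simp add: mult_ac)
  ultimately show "(\<lambda>N. \<Sum>n<N. ksc (of_real (norm c * s n) * kinner x (e n)) (ksc (c / of_real (norm c)) (f n)))
      \<longlonglongrightarrow> blinfun_apply B x"
    by (simp only: B ksc_sum_right)
qed

lemma schmidt_zero: "schmidt 0 (\<lambda>_. 0) (\<lambda>_. 0) (\<lambda>_. 0)"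
  by (simp add: schmidt_def onz_def)

section \<open>The triangle inequality for Schatten norms\<close>

text \<open>\<open>|\<langle>A g\<^sub>k, h\<^sub>k\<rangle>| \<le> \<Sum>\<^sub>n a\<^sub>k\<^sub>n s\<^sub>n\<close> with the doubly substochastic
  \<open>a\<^sub>k\<^sub>n = (|\<langle>g\<^sub>k, e\<^sub>n\<rangle>|\<^sup>2 + |\<langle>f\<^sub>n, h\<^sub>k\<rangle>|\<^sup>2) / 2\<close>.\<close>

lemma schmidt_diagonal_powr_sum:
  assumes S: "schmidt A s e f" and g: "onz g" and h: "onz h" and p: "1 \<le> p"
    and b: "\<And>N. (\<Sum>n<N. s n powr p) \<le> b"
  shows "(\<Sum>k<K. norm (kinner (blinfun_apply A (g k)) (h k)) powr p) \<le> b"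
proof (rule LIMSEQ_le_const2)
  let ?q = "\<lambda>N k. kinner (\<Sum>n<N. ksc (of_real (s n) * kinner (g k) (e n)) (f n)) (h k)"
  have "(\<lambda>N. norm (?q N k) powr p) \<longlonglongrightarrow> norm (kinner (blinfun_apply A (g k)) (h k)) powr p" for k
    by (rule tendsto_powr'[OF tendsto_norm tendsto_const])
      (use p in \<open>auto intro!: tendsto_kinner schmidtD(7)[OF S] tendsto_const\<close>)
  then show "(\<lambda>N. \<Sum>k<K. norm (?q N k) powr p) \<longlonglongrightarrow> (\<Sum>k<K. norm (kinner (blinfun_apply A (g k)) (h k)) powr p)"
    by (intro tendsto_sum)
  have "(\<Sum>k<K. norm (?q N k) powr p) \<le> b" for N
  proof -
    \<comment> \<open>Replacing the product of the two inner products by the mean of their squares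
      opens either index to Bessel's inequality.\<close>
    define a where "a = (\<lambda>k n. ((norm (kinner (g k) (e n)))\<^sup>2 + (norm (kinner (f n) (h k)))\<^sup>2) / 2)"
    have a0: "0 \<le> a k n" for k n by (simp add: a_def)
    have sym: "norm (kinner x y) = norm (kinner y x)" for x y :: "('a, 'b) ell2"
      by (subst kinner_commute) simp
    have arow: "(\<Sum>n<N. a k n) \<le> 1" for k
    proof -
      have "(\<Sum>n<N. (norm (kinner (g k) (e n)))\<^sup>2) \<le> (norm (g k))\<^sup>2"
        by (rule onz_bessel[OF schmidtD(3)[OF S]]) simp
      moreover have "(\<Sum>n<N. (norm (kinner (f n) (h k)))\<^sup>2) \<le> (norm (h k))\<^sup>2"
        unfolding sym[of "f _"] by (rule onz_bessel[OF schmidtD(4)[OF S]]) simp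
      moreover have "(norm (g k))\<^sup>2 \<le> 1" "(norm (h k))\<^sup>2 \<le> 1"
        using onz_norm_le g h by (auto intro!: power_le_one)
      ultimately show ?thesis by (simp add: a_def sum_divide_distrib[symmetric] sum.distrib)
    qed
    have acol: "(\<Sum>k<K. a k n) \<le> 1" for n
    proof -
      have "(\<Sum>k<K. (norm (kinner (g k) (e n)))\<^sup>2) \<le> (norm (e n))\<^sup>2"
        unfolding sym[of "g _"] by (rule onz_bessel[OF g]) simp
      moreover have "(\<Sum>k<K. (norm (kinner (f n) (h k)))\<^sup>2) \<le> (norm (f n))\<^sup>2"
        by (rule onz_bessel[OF h]) simp
      moreover have "(norm (e n))\<^sup>2 \<le> 1" "(norm (f n))\<^sup>2 \<le> 1"
        using onz_norm_le schmidtD(3,4)[OF S] by (auto intro!: power_le_one)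
      ultimately show ?thesis by (simp add: a_def sum_divide_distrib[symmetric] sum.distrib)
    qed
    have "norm (?q N k) powr p \<le> (\<Sum>n<N. a k n * s n powr p)" for k
    proof -
      have "norm (?q N k) \<le> (\<Sum>n<N. norm (of_real (s n) * kinner (g k) (e n) * kinner (f n) (h k)))"
        unfolding kinner_sum_left kinner_ksc_left by (rule norm_sum)
      also have "\<dots> \<le> (\<Sum>n<N. a k n * s n)"
      proof (rule sum_mono)
        fix n
        have "norm (kinner (g k) (e n)) * norm (kinner (f n) (h k)) \<le> a k n"
          using sum_squares_bound[of "norm (kinner (g k) (e n))" "norm (kinner (f n) (h k))"]
          by (simp add: a_def)
        then show "norm (of_real (s n) * kinner (g k) (e n) * kinner (f n) (h k)) \<le> a k n * s n"
          using mult_right_mono[OF _ schmidtD(8)[OF S, of n]] schmidtD(8)[OF S, of n]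
          by (fastforce simp: norm_mult mult_ac)
      qed
      finally have "norm (?q N k) powr p \<le> (\<Sum>n<N. a k n * s n) powr p"
        using p by (intro powr_mono2) auto
      also have "\<dots> \<le> (\<Sum>n<N. a k n * s n powr p)"
        by (rule powr_sum_jensen) (use p a0 arow schmidtD(8)[OF S] in auto)
      finally show ?thesis .
    qed
    then have "(\<Sum>k<K. norm (?q N k) powr p) \<le> (\<Sum>k<K. \<Sum>n<N. a k n * s n powr p)"
      by (rule sum_mono)
    also have "\<dots> = (\<Sum>n<N. (\<Sum>k<K. a k n) * s n powr p)"
      by (subst sum.swap) (simp add: sum_distrib_right)
    also have "\<dots> \<le> (\<Sum>n<N. 1 * s n powr p)"
      by (intro sum_mono mult_right_mono acol) auto
    also have "\<dots> \<le> b" using b by simp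
    finally show ?thesis .
  qed
  then show "\<exists>N. \<forall>n\<ge>N. (\<Sum>k<K. norm (?q n k) powr p) \<le> b" by blast
qed

text \<open>In its own singular vectors \<open>A + B\<close> has the diagonal \<open>s''\<close>,
  which is dominated by the moduli of the diagonals of \<open>A\<close> and \<open>B\<close>;
  Minkowski's inequality combines the two diagonal estimates. Bounds \<open>a\<close> and
  \<open>b\<close> in place of the sums themselves allow suprema over all fibres to be
  inserted.\<close>

lemma schmidt_powr_sum_triangle:
  assumes S: "schmidt A s e f" and S': "schmidt B s' e' f'" and S'': "schmidt (A + B) s'' e'' f''"
    and p: "1 \<le> p" and a: "0 \<le> a" "\<And>N. (\<Sum>n<N. s n powr p) \<le> a powr p"
    and b: "0 \<le> b" "\<And>N. (\<Sum>n<N. s' n powr p) \<le> b powr p"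
  shows "(\<Sum>n<N. s'' n powr p) \<le> (a + b) powr p"
proof -
  let ?x = "\<lambda>n. norm (kinner (blinfun_apply A (e'' n)) (f'' n))"
  let ?y = "\<lambda>n. norm (kinner (blinfun_apply B (e'' n)) (f'' n))"
  have "s'' n \<le> ?x n + ?y n" for n
  proof -
    have "kinner (blinfun_apply (A + B) (e'' n)) (f'' n) = of_real (s'' n)"
      using schmidtD(3,5)[OF S''] by (auto simp: schmidt_kinner[OF S''] onz_def)
    then have "norm (of_real (s'' n) :: 'b) \<le> ?x n + ?y n"
      by (metis blinfun.add_left kinner_add_left norm_triangle_ineq)
    then show ?thesis by simp
  qed
  then have "(\<Sum>n<N. s'' n powr p) \<le> (\<Sum>n<N. (?x n + ?y n) powr p)"
    using p schmidtD(8)[OF S''] by (intro sum_mono powr_mono2) auto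
  also have "\<dots> \<le> (a + b) powr p"
    by (rule powr_minkowski)
      (use p a b schmidt_diagonal_powr_sum[OF S schmidtD(3,4)[OF S''] p]
        schmidt_diagonal_powr_sum[OF S' schmidtD(3,4)[OF S''] p] in auto)
  finally show ?thesis .
qed

section \<open>Identification of the singular values\<close>

text \<open>Leads back from bounded operators on \<open>ell2\<close> to functions on families that
  vanish outside \<open>l2\<close>, the shape in which \<open>phi\<close> and hence
  \<open>singular_values\<close> are given.\<close>

definition raw_op :: "(('i, 'k::rc_scalar) ell2 \<Rightarrow>\<^sub>L ('i, 'k) ell2) \<Rightarrow> ('i \<Rightarrow> 'k) \<Rightarrow> 'i \<Rightarrow> 'k" where
  "raw_op A \<zeta> = (if \<zeta> \<in> l2 then coord (blinfun_apply A (of_coord \<zeta>)) else 0)"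

text \<open>\<open>l2_adj\<close> is a definite description and needs an adjoint known to exist. For
  a fibre of an adjointable operator the module adjoint provides one.\<close>

definition has_adjoint :: "(('i, 'k::rc_scalar) ell2 \<Rightarrow>\<^sub>L ('i, 'k) ell2) \<Rightarrow> bool" where
  "has_adjoint A \<longleftrightarrow> (\<exists>B. \<forall>x y. kinner (blinfun_apply A x) y = kinner x (B y))"

lemma kinner_ext:
  assumes "\<And>x. kinner x y = kinner x z"
  shows "y = z"
proof -
  have "kinner (y - z) (y - z) = 0" using assms[of "y - z"] by (simp add: kinner_diff_right)
  then show ?thesis by (simp only: kinner_self of_real_eq_0_iff) simp
qed

lemma l2_inner_coord: "l2_inner (coord x) (coord y) = kinner x y"
  by (simp add: l2_inner_def kinner_def)

lemma l2_adj_raw_op: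
  assumes B: "\<And>x y. kinner (blinfun_apply A x) y = kinner x (B y)"
  shows "l2_adj (raw_op A) (coord y) = coord (B y)"
proof -
  have "(THE \<omega>'. \<omega>' \<in> l2 \<and> (\<forall>\<zeta>\<in>l2. l2_inner (raw_op A \<zeta>) (coord y) = l2_inner \<zeta> \<omega>')) = coord (B y)"
  proof (rule the_equality)
    have "l2_inner (raw_op A \<zeta>) (coord y) = l2_inner \<zeta> (coord (B y))" if "\<zeta> \<in> l2" for \<zeta>
      using B[of "of_coord \<zeta>" y] that by (simp add: raw_op_def l2_inner_coord[symmetric] of_coord_inverse)
    then show "coord (B y) \<in> l2 \<and> (\<forall>\<zeta>\<in>l2. l2_inner (raw_op A \<zeta>) (coord y) = l2_inner \<zeta> (coord (B y)))" by simp
    fix \<omega>' assume *: "\<omega>' \<in> l2 \<and> (\<forall>\<zeta>\<in>l2. l2_inner (raw_op A \<zeta>) (coord y) = l2_inner \<zeta> \<omega>')"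
    then obtain z where z: "\<omega>' = coord z" by (metis of_coord_inverse)
    have "kinner x z = kinner x (B y)" for x
      using *[THEN conjunct2, rule_format, of "coord x"] B[of x y]
      by (simp add: raw_op_def coord_inverse l2_inner_coord z)
    then show "\<omega>' = coord (B y)" using kinner_ext z by metis
  qed
  then show ?thesis by (simp add: l2_adj_def)
qed

text \<open>At the first index of disagreement, the larger of the two values is positive and is
  attained strictly more often by the sequence that takes it there.\<close>

lemma null_decseq_eqI:
  fixes s s' :: "nat \<Rightarrow> real"
  assumes s: "decseq s" "s \<longlonglongrightarrow> 0" and s': "decseq s'" "s' \<longlonglongrightarrow> 0"
    and card: "\<And>\<mu>. \<mu> > 0 \<Longrightarrow> card {n. s n = \<mu>} = card {n. s' n = \<mu>}"
  shows "s = s'"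
proof (rule ccontr)
  have fin: "finite {n. s n = \<mu>}" if pos: "\<mu> > 0" and lim: "s \<longlonglongrightarrow> 0" for \<mu> and s :: "nat \<Rightarrow> real"
  proof -
    obtain n0 where "\<And>n. n \<ge> n0 \<Longrightarrow> \<bar>s n\<bar> < \<mu>" using LIMSEQ_D[OF lim pos] by auto
    then have "{n. s n = \<mu>} \<subseteq> {..<n0}" using pos by (force simp: not_less[symmetric])
    then show ?thesis by (rule finite_subset) simp
  qed
  have aux: "\<not> s n > s' n" if "\<And>k. k < n \<Longrightarrow> s k = s' k" "decseq s'" "s' \<longlonglongrightarrow> 0" "s \<longlonglongrightarrow> 0"
      "\<And>\<mu>. \<mu> > 0 \<Longrightarrow> card {n. s n = \<mu>} = card {n. s' n = \<mu>}" for n and s s' :: "nat \<Rightarrow> real"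
  proof
    assume gt: "s n > s' n"
    have "0 \<le> s' n" using decseq_ge[OF that(2,3)] .
    with gt have pos: "s n > 0" by simp
    have "{k. s' k = s n} \<subset> {k. s k = s n}"
    proof
      show "{k. s' k = s n} \<subseteq> {k. s k = s n}"
      proof
        fix k assume "k \<in> {k. s' k = s n}"
        then have "s' k > s' n" using gt by simp
        then have "k < n" using that(2) by (metis decseq_def linorder_not_le)
        then show "k \<in> {k. s k = s n}" using that(1) \<open>k \<in> _\<close> by simp
      qed
      have "n \<in> {k. s k = s n}" "n \<notin> {k. s' k = s n}" using gt by auto
      then show "{k. s' k = s n} \<noteq> {k. s k = s n}" by blast
    qed
    then have "card {k. s' k = s n} < card {k. s k = s n}"
      using fin[OF pos that(4)] by (intro psubset_card_mono)
    with that(5)[OF pos] show False by simp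
  qed
  assume "s \<noteq> s'"
  then have "\<exists>n. s n \<noteq> s' n" by auto
  then obtain n where n: "s n \<noteq> s' n" "\<And>k. k < n \<Longrightarrow> s k = s' k"
    using exists_least_iff[of "\<lambda>n. s n \<noteq> s' n"] by auto
  have "\<not> s n > s' n" by (rule aux) (use n s s' card in auto)
  moreover have "\<not> s' n > s n" by (rule aux) (use n s s' card in auto)
  ultimately show False using n(1) by simp
qed

text \<open>Every \<open>e n\<close> is an eigenvector of \<open>A* A\<close> for
  \<open>(s n)\<^sup>2\<close>, and an eigenvector \<open>x\<close> for \<open>\<mu>\<^sup>2\<close>
  is orthogonal to all \<open>e n\<close> with \<open>s n \<noteq> \<mu>\<close>. The rest
  \<open>y\<close> of \<open>x\<close> after projection to the remaining ones is orthogonal to every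
  \<open>e n\<close>, so \<open>A y = 0\<close>; the eigenvalue equation then gives
  \<open>kinner y x = 0\<close>, as \<open>\<mu>\<close> is not 0, and \<open>y = 0\<close>
  follows.\<close>

lemma schmidt_eigenspace:
  assumes S: "schmidt A s e f" and B: "\<And>x y. kinner (blinfun_apply A x) y = kinner x (B y)" and "\<mu> > 0"
  shows "{\<zeta>\<in>l2. l2_adj (raw_op A) (raw_op A \<zeta>) = l2_scale (of_real (\<mu>\<^sup>2)) \<zeta>}
    = l2v.span (coord ` e ` {n. s n = \<mu>})"
proof -
  have fin: "finite {n. s n = \<mu>}"
  proof -
    obtain n0 where "\<And>n. n \<ge> n0 \<Longrightarrow> \<bar>s n\<bar> < \<mu>" using LIMSEQ_D[OF schmidtD(2)[OF S] \<open>\<mu> > 0\<close>] by auto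
    then have "{n. s n = \<mu>} \<subseteq> {..<n0}" using \<open>\<mu> > 0\<close> by (force simp: not_less[symmetric])
    then show ?thesis by (rule finite_subset) simp
  qed
  have eig: "l2_adj (raw_op A) (raw_op A (coord x)) = l2_scale (of_real (\<mu>\<^sup>2)) (coord x)
      \<longleftrightarrow> B (blinfun_apply A x) = ksc (of_real (\<mu>\<^sup>2)) x" for x
  proof -
    have "l2_adj (raw_op A) (raw_op A (coord x)) = coord (B (blinfun_apply A x))"
      by (subst raw_op_def) (simp add: l2_adj_raw_op[OF B] coord_inverse)
    moreover have "l2_scale (of_real (\<mu>\<^sup>2)) (coord x) = coord (ksc (of_real (\<mu>\<^sup>2)) x)"
      by (simp add: l2_scale_def fun_eq_iff)
    ultimately show ?thesis by (simp add: coord_inject)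
  qed
  \<comment> \<open>In weak form the adjoint \<open>B\<close>, about which only its pairing is
    known, disappears, and linearity in \<open>x\<close> becomes visible.\<close>
  have eig': "B (blinfun_apply A x) = ksc (of_real (\<mu>\<^sup>2)) x \<longleftrightarrow>
      (\<forall>y. kinner (blinfun_apply A y) (blinfun_apply A x) = of_real (\<mu>\<^sup>2) * kinner y x)" for x
  proof -
    have "kinner y (ksc (of_real (\<mu>\<^sup>2)) x) = of_real (\<mu>\<^sup>2) * kinner y x" for y
      by (simp only: kinner_ksc_right kconj_of_real)
    then show ?thesis
      unfolding B using kinner_ext[of "B (blinfun_apply A x)" "ksc (of_real (\<mu>\<^sup>2)) x"] by metis
  qed
  have Ae: "kinner (blinfun_apply A y) (blinfun_apply A (e n)) = of_real ((s n)\<^sup>2) * kinner y (e n)" for y n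
    by (simp add: schmidt_apply[OF S] schmidt_kinner[OF S] power2_eq_square)
  show ?thesis
  proof (intro equalityI subsetI)
    fix \<zeta> assume \<zeta>: "\<zeta> \<in> {\<zeta>\<in>l2. l2_adj (raw_op A) (raw_op A \<zeta>) = l2_scale (of_real (\<mu>\<^sup>2)) \<zeta>}"
    then obtain x where x: "\<zeta> = coord x" by (metis (no_types, lifting) of_coord_inverse mem_Collect_eq)
    have ex: "kinner (blinfun_apply A y) (blinfun_apply A x) = of_real (\<mu>\<^sup>2) * kinner y x" for y
      using \<zeta> eig[of x] eig'[of x] by (auto simp: x)
    have xe: "kinner x (e n) = 0" if "s n \<noteq> \<mu>" for n
    proof -
      have "of_real ((s n)\<^sup>2) * kinner (e n) x = of_real (\<mu>\<^sup>2) * kinner (e n) x"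
        using ex[of "e n"] Ae[of x n]
        by (metis kinner_commute kconj_mult kconj_of_real)
      moreover have "(s n)\<^sup>2 \<noteq> \<mu>\<^sup>2"
        using that \<open>\<mu> > 0\<close> schmidtD(8)[OF S, of n] by (simp add: power2_eq_iff_nonneg)
      ultimately have "kinner (e n) x = 0" by (metis mult_right_cancel of_real_eq_iff)
      then show ?thesis by (metis kinner_commute kconj_0)
    qed
    define y where "y = x - (\<Sum>n\<in>{n. s n = \<mu>}. ksc (kinner x (e n)) (e n))"
    have ye: "kinner y (e n) = 0" for n
      using xe[of n] onz_kinner_sum[OF schmidtD(3)[OF S] fin, of "\<lambda>n. kinner x (e n)" n]
      by (auto simp: y_def kinner_diff_left)
    have "norm (blinfun_apply A y) = 0"
    proof (rule antisym)
      have "norm (blinfun_apply A y) \<le> s n * norm y" for n by (rule schmidt_bound[OF S ye])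
      then show "norm (blinfun_apply A y) \<le> 0"
        by (intro LIMSEQ_le_const[OF tendsto_mult_left_zero[OF schmidtD(2)[OF S], of "norm y"]]) auto
    qed simp
    then have "kinner y x = 0" using ex[of y] \<open>\<mu> > 0\<close> by simp
    moreover have "kinner y (\<Sum>n\<in>{n. s n = \<mu>}. ksc (kinner x (e n)) (e n)) = 0"
      by (simp add: kinner_sum_right ye)
    ultimately have "kinner y y = 0" by (subst (2) y_def) (simp add: kinner_diff_right)
    then have "y = 0" by (simp only: kinner_self of_real_eq_0_iff) simp
    then have "x = (\<Sum>n\<in>{n. s n = \<mu>}. ksc (kinner x (e n)) (e n))" by (simp add: y_def)
    moreover have "coord (\<Sum>n\<in>F. ksc (c n) (e n)) = (\<Sum>n\<in>F. l2_scale (c n) (coord (e n)))" if "finite F" for F c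
      using that by (induction F rule: finite_induct) (auto simp: fun_eq_iff l2_scale_def)
    ultimately have "\<zeta> = (\<Sum>n\<in>{n. s n = \<mu>}. l2_scale (kinner x (e n)) (coord (e n)))"
      unfolding x using fin by metis
    then show "\<zeta> \<in> l2v.span (coord ` e ` {n. s n = \<mu>})"
      by (simp only:) (rule l2v.span_sum, rule l2v.span_scale, rule l2v.span_base, auto)
  next
    fix \<zeta> assume "\<zeta> \<in> l2v.span (coord ` e ` {n. s n = \<mu>})"
    moreover have "l2v.subspace (coord ` {x. B (blinfun_apply A x) = ksc (of_real (\<mu>\<^sup>2)) x})"
    proof (rule l2v.subspaceI)
      have B0: "B (blinfun_apply A 0) = ksc (of_real (\<mu>\<^sup>2)) 0"
        unfolding eig' by (simp add: blinfun.zero_right)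
      have "0 = coord (0 :: ('a, 'b) ell2)" by (simp add: fun_eq_iff)
      then show "0 \<in> coord ` {x. B (blinfun_apply A x) = ksc (of_real (\<mu>\<^sup>2)) x}"
        using B0 by blast
    next
      fix v w assume "v \<in> coord ` {x. B (blinfun_apply A x) = ksc (of_real (\<mu>\<^sup>2)) x}"
        "w \<in> coord ` {x. B (blinfun_apply A x) = ksc (of_real (\<mu>\<^sup>2)) x}"
      then obtain x y where xy: "v = coord x" "w = coord y"
        "B (blinfun_apply A x) = ksc (of_real (\<mu>\<^sup>2)) x" "B (blinfun_apply A y) = ksc (of_real (\<mu>\<^sup>2)) y" by blast
      have "B (blinfun_apply A (x + y)) = ksc (of_real (\<mu>\<^sup>2)) (x + y)"
        using xy(3,4) unfolding eig' by (simp add: blinfun.add_right kinner_add_right distrib_left)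
      moreover have "v + w = coord (x + y)" by (simp add: xy fun_eq_iff)
      ultimately show "v + w \<in> coord ` {x. B (blinfun_apply A x) = ksc (of_real (\<mu>\<^sup>2)) x}" by blast
    next
      fix c v assume "v \<in> coord ` {x. B (blinfun_apply A x) = ksc (of_real (\<mu>\<^sup>2)) x}"
      then obtain x where x: "v = coord x" "B (blinfun_apply A x) = ksc (of_real (\<mu>\<^sup>2)) x" by blast
      have "B (blinfun_apply A (ksc c x)) = ksc (of_real (\<mu>\<^sup>2)) (ksc c x)"
        using x(2) schmidt_klin[OF S] unfolding eig' by (simp add: klin_def mult.left_commute)
      moreover have "l2_scale c v = coord (ksc c x)" by (simp add: x l2_scale_def fun_eq_iff)
      ultimately show "l2_scale c v \<in> coord ` {x. B (blinfun_apply A x) = ksc (of_real (\<mu>\<^sup>2)) x}" by blast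
    qed
    moreover have "coord ` e ` {n. s n = \<mu>} \<subseteq> coord ` {x. B (blinfun_apply A x) = ksc (of_real (\<mu>\<^sup>2)) x}"
    proof (intro image_mono subsetI)
      fix x assume "x \<in> e ` {n. s n = \<mu>}"
      then obtain n where "x = e n" "s n = \<mu>" by blast
      then show "x \<in> {x. B (blinfun_apply A x) = ksc (of_real (\<mu>\<^sup>2)) x}" unfolding eig' mem_Collect_eq using Ae by simp
    qed
    ultimately have "\<zeta> \<in> coord ` {x. B (blinfun_apply A x) = ksc (of_real (\<mu>\<^sup>2)) x}"
      using l2v.span_minimal by blast
    then show "\<zeta> \<in> {\<zeta>\<in>l2. l2_adj (raw_op A) (raw_op A \<zeta>) = l2_scale (of_real (\<mu>\<^sup>2)) \<zeta>}"
      using eig by auto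
  qed
qed

lemma dim_span_onz:
  assumes e: "onz e" and ne: "\<And>n. n \<in> F \<Longrightarrow> e n \<noteq> 0" and "finite F"
  shows "l2v.dim (l2v.span (coord ` e ` F)) = card F"
proof -
  have inj: "inj_on (\<lambda>n. coord (e n)) F"
  proof (rule inj_onI)
    fix m n assume mn: "m \<in> F" "n \<in> F" "coord (e m) = coord (e n)"
    then have "kinner (e m) (e n) = 1"
      using onz_norm[OF e ne[OF mn(2)]] by (simp add: coord_inject kinner_self_1)
    then show "m = n" using e unfolding onz_def by (metis zero_neq_one)
  qed
  have "l2v.independent (coord ` e ` F)"
  proof (rule l2v.independent_if_scalars_zero)
    fix u v
    assume sum: "(\<Sum>v\<in>coord ` e ` F. l2_scale (u v) v) = 0" and v: "v \<in> coord ` e ` F"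
    then obtain n where n: "n \<in> F" "v = coord (e n)" by blast
    have "(\<Sum>n\<in>F. l2_scale (u (coord (e n))) (coord (e n))) = 0"
      using sum unfolding image_image by (subst (asm) sum.reindex[OF inj]) (simp add: o_def)
    moreover have "coord (\<Sum>n\<in>F. ksc (c n) (e n)) = (\<Sum>n\<in>F. l2_scale (c n) (coord (e n)))" for c
      using \<open>finite F\<close> by (induction F rule: finite_induct) (auto simp: fun_eq_iff l2_scale_def)
    ultimately have "(\<Sum>n\<in>F. ksc (u (coord (e n))) (e n)) = 0"
      by (intro ell2_eqI) (metis coord_0 zero_fun_apply)
    then show "u v = 0"
      using onz_kinner_sum[OF e \<open>finite F\<close>, of "\<lambda>n. u (coord (e n))" n] n ne by simp
  qed (use \<open>finite F\<close> in auto)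
  then have "l2v.dim (l2v.span (coord ` e ` F)) = card (coord ` e ` F)"
    by (rule l2v.dim_span_eq_card_independent)
  then show ?thesis by (simp only: image_image card_image[OF inj])
qed

text \<open>Each multiplicity in the description of \<open>singular_values\<close> is a number of
  indices by \<open>schmidt_eigenspace\<close>, and \<open>null_decseq_eqI\<close> says that these
  numbers fix the sequence. Later proofs may therefore use whichever decomposition of a fibre is at
  hand.\<close>

theorem schmidt_singular_values:
  assumes S: "schmidt A s e f" and A: "has_adjoint A"
  shows "singular_values (raw_op A) = s"
proof -
  obtain B where B: "\<And>x y. kinner (blinfun_apply A x) y = kinner x (B y)"
    using A unfolding has_adjoint_def by blast
  have card: "card {n. s n = \<mu>} = l2v.dim {\<zeta>\<in>l2. l2_adj (raw_op A) (raw_op A \<zeta>) = l2_scale (of_real (\<mu>\<^sup>2)) \<zeta>}"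
    if "\<mu> > 0" for \<mu>
  proof -
    have "finite {n. s n = \<mu>}"
    proof -
      obtain n0 where "\<And>n. n \<ge> n0 \<Longrightarrow> \<bar>s n\<bar> < \<mu>" using LIMSEQ_D[OF schmidtD(2)[OF S] \<open>\<mu> > 0\<close>] by auto
      then have "{n. s n = \<mu>} \<subseteq> {..<n0}" using \<open>\<mu> > 0\<close> by (force simp: not_less[symmetric])
      then show ?thesis by (rule finite_subset) simp
    qed
    then show ?thesis
      unfolding schmidt_eigenspace[OF S B that]
      by (intro dim_span_onz[symmetric] schmidtD(3)[OF S]) (use schmidtD(5)[OF S] that in auto)
  qed
  show ?thesis
    unfolding singular_values_def
  proof (rule the_equality)
    show "decseq s \<and> s \<longlonglongrightarrow> 0 \<and> (\<forall>\<mu>>0. card {n. s n = \<mu>} =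
        l2v.dim {\<zeta>\<in>l2. l2_adj (raw_op A) (raw_op A \<zeta>) = l2_scale (of_real (\<mu>\<^sup>2)) \<zeta>})"
      using schmidtD(1,2)[OF S] card by blast
    fix s' assume "decseq s' \<and> s' \<longlonglongrightarrow> 0 \<and> (\<forall>\<mu>>0. card {n. s' n = \<mu>} =
        l2v.dim {\<zeta>\<in>l2. l2_adj (raw_op A) (raw_op A \<zeta>) = l2_scale (of_real (\<mu>\<^sup>2)) \<zeta>})"
    then show "s' = s"
      using schmidtD(1,2)[OF S] card by (intro null_decseq_eqI) auto
  qed
qed

section \<open>Continuous functions on a compact space\<close>

lemma apply_times_bcontfun [simp]: "apply_bcontfun (f * g) t = apply_bcontfun f t * apply_bcontfun g t"
  by (simp add: times_bcontfun.rep_eq)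

lemma apply_cstar [simp]: "apply_bcontfun (cstar f) t = kconj (apply_bcontfun f t)"
  by (simp add: cstar.rep_eq)

lemma apply_sum_bcontfun [simp]: "apply_bcontfun (\<Sum>i\<in>A. f i) t = (\<Sum>i\<in>A. apply_bcontfun (f i) t)"
  by (induction A rule: infinite_finite_induct) auto

lemma apply_one_bcontfun [simp]: "apply_bcontfun 1 t = 1"
  by (simp add: one_bcontfun_def)

lemma apply_Bcontfun:
  fixes f :: "'t::topological_space \<Rightarrow> 'b::metric_space"
  assumes "compact (UNIV :: 't set)" "continuous_on UNIV f"
  shows "apply_bcontfun (Bcontfun f) t = f t"
proof -
  have "f \<in> bcontfun"
    using assms compact_imp_bounded[OF compact_continuous_image[OF assms(2,1)]] by (simp add: bcontfun_def)
  then show ?thesis by (simp add: Bcontfun_inverse)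
qed

lemma bounded_linear_apply_bcontfun: "bounded_linear (\<lambda>f. apply_bcontfun f t)"
  by (rule bounded_linear_intro[where K=1]) (auto simp: norm_bounded)

lemma apply_of_real_bcontfun [simp]: "apply_bcontfun (of_real r) t = of_real r"
  by (simp add: of_real_def)

lemma apply_numeral_bcontfun [simp]: "apply_bcontfun (numeral n) t = numeral n"
  using apply_of_real_bcontfun[of "numeral n" t] by simp

text \<open>The library has this only for metric domains.\<close>

instance bcontfun :: (topological_space, complete_space) complete_space
proof
  fix X :: "nat \<Rightarrow> 'a \<Rightarrow>\<^sub>C 'b"
  assume "Cauchy X"
  then have "\<forall>e>0. \<exists>N. \<forall>m n x. N \<le> m \<and> N \<le> n \<and> True \<longrightarrow> dist (X m x) (X n x) < e"
    unfolding Cauchy_def by (meson dist_fun_lt_imp_dist_val_lt)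
  then obtain l where "uniform_limit UNIV X l sequentially"
    unfolding uniformly_convergent_eq_cauchy[symmetric] uniform_limit_sequentially_iff by auto
  from uniform_limit_bcontfunE[OF this] show "convergent X"
    by (metis convergentI sequentially_bot)
qed

instance bcontfun :: (topological_space, banach) banach ..

lemma continuous_on_indicator_clopen:
  assumes "open V" "closed V"
  shows "continuous_on UNIV (indicator V :: 'a::topological_space \<Rightarrow> 'b::{zero_neq_one, topological_space})"
proof -
  have "continuous_on (V \<union> - V) (\<lambda>t. if t \<in> V then 1 else 0 :: 'b)"
    using assms by (intro continuous_on_If) (auto simp: closed_Compl)
  then show ?thesis by (simp add: indicator_def of_bool_def)
qed

section \<open>Positivity and order of scalar functions\<close>

lemma spos_iff_ex: "spos c \<longleftrightarrow> (\<exists>r\<ge>0. c = of_real r)"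
proof
  assume "spos c" then show "\<exists>r\<ge>0. c = of_real r" unfolding spos_def by (intro exI[of _ "norm c"]) auto
qed (auto simp: spos_def)

lemma spos_of_real [simp]: "spos (of_real r :: 'k::rc_scalar) \<longleftrightarrow> 0 \<le> r"
  unfolding spos_iff_ex by (auto simp: of_real_eq_iff)

lemma spos_real [simp]: "spos (r::real) \<longleftrightarrow> 0 \<le> r"
  using spos_of_real[where 'k=real, of r] by simp

lemma spos_kre: "spos c \<Longrightarrow> c = of_real (kre c) \<and> 0 \<le> kre c"
  unfolding spos_iff_ex by auto

lemma cposD:
  assumes "cpos f"
  shows "0 \<le> kre (apply_bcontfun f t)" "apply_bcontfun f t = of_real (kre (apply_bcontfun f t))"
  using spos_kre assms unfolding cpos_def by blast+

lemma cle_iff: "cle f g \<longleftrightarrow> (\<forall>t. spos (apply_bcontfun g t - apply_bcontfun f t))"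
  by (simp add: cle_def cpos_def)

lemma cle_real_iff: "cle f g \<longleftrightarrow> (\<forall>t. apply_bcontfun f t \<le> (apply_bcontfun g t :: real))"
  by (simp add: cle_iff)

lemma cle_kre: "cle f g \<Longrightarrow> kre (apply_bcontfun f t) \<le> kre (apply_bcontfun g t)"
  using spos_kre[THEN conjunct2, of "apply_bcontfun g t - apply_bcontfun f t"] by (simp add: cle_iff kre_diff)

definition cre :: "('t::topological_space \<Rightarrow>\<^sub>C 'k::rc_scalar) \<Rightarrow> 't \<Rightarrow>\<^sub>C real" where
  "cre f = Bcontfun (\<lambda>t. kre (apply_bcontfun f t))"

lemma apply_cre [simp]: "apply_bcontfun (cre f) t = kre (apply_bcontfun f t)"
proof -
  have "(\<lambda>t. kre (apply_bcontfun f t)) \<in> bcontfun"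
    by (rule bcontfun_normI[where b="norm f"])
      (auto intro!: continuous_intros intro: order_trans[OF abs_kre_le norm_bounded])
  then show ?thesis by (simp add: cre_def Bcontfun_inverse)
qed

text \<open>The Cauchy criterion for unconditional sums, obtained from completeness along the filter
  of finite sets.\<close>

lemma summable_on_iff_Cauchy:
  fixes f :: "'i \<Rightarrow> 'b::banach"
  shows "f summable_on UNIV \<longleftrightarrow>
    (\<forall>\<epsilon>>0. \<exists>F0. finite F0 \<and> (\<forall>F. finite F \<and> F \<inter> F0 = {} \<longrightarrow> norm (sum f F) < \<epsilon>))"
proof
  assume "f summable_on UNIV"
  then obtain x where x: "(f has_sum x) UNIV" by (auto simp: summable_on_def)
  show "\<forall>\<epsilon>>0. \<exists>F0. finite F0 \<and> (\<forall>F. finite F \<and> F \<inter> F0 = {} \<longrightarrow> norm (sum f F) < \<epsilon>)"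
  proof (intro allI impI)
    fix \<epsilon> :: real assume "\<epsilon> > 0"
    then have "\<epsilon> / 2 > 0" by simp
    from tendstoD[OF x[unfolded has_sum_def] this]
    obtain F0 where F0: "finite F0" "\<And>F. finite F \<Longrightarrow> F0 \<subseteq> F \<Longrightarrow> dist (sum f F) x < \<epsilon> / 2"
      unfolding eventually_finite_subsets_at_top by auto
    have "norm (sum f F) < \<epsilon>" if F: "finite F" "F \<inter> F0 = {}" for F
    proof -
      have "sum f F = (sum f (F \<union> F0) - x) - (sum f F0 - x)"
        using F F0(1) by (simp add: sum.union_disjoint)
      then have "norm (sum f F) \<le> dist (sum f (F \<union> F0)) x + dist (sum f F0) x"
        unfolding dist_norm by (metis norm_triangle_ineq4)
      then show ?thesis using F0(2)[of "F \<union> F0"] F0(2)[of F0] F F0(1) by simp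
    qed
    with F0(1) show "\<exists>F0. finite F0 \<and> (\<forall>F. finite F \<and> F \<inter> F0 = {} \<longrightarrow> norm (sum f F) < \<epsilon>)"
      by (intro exI[of _ F0]) simp
  qed
next
  assume *: "\<forall>\<epsilon>>0. \<exists>F0. finite F0 \<and> (\<forall>F. finite F \<and> F \<inter> F0 = {} \<longrightarrow> norm (sum f F) < \<epsilon>)"
  have "cauchy_filter (filtermap (sum f) (finite_subsets_at_top UNIV))"
    unfolding cauchy_filter_metric_filtermap
  proof (intro allI impI)
    fix \<epsilon> :: real assume "\<epsilon> > 0"
    then obtain F0 where F0: "finite F0" "\<And>F. finite F \<Longrightarrow> F \<inter> F0 = {} \<Longrightarrow> norm (sum f F) < \<epsilon> / 2"
      using *[rule_format, of "\<epsilon>/2"] by auto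
    have d: "dist (sum f F) (sum f F0) < \<epsilon> / 2" if "finite F" "F0 \<subseteq> F" for F
    proof -
      have "sum f F - sum f F0 = sum f (F - F0)" using that by (simp add: sum_diff F0(1))
      then show ?thesis using F0(2)[of "F - F0"] that by (simp add: dist_norm Int_commute)
    qed
    show "\<exists>Q. eventually Q (finite_subsets_at_top UNIV) \<and> (\<forall>x y. Q x \<and> Q y \<longrightarrow> dist (sum f x) (sum f y) < \<epsilon>)"
    proof (intro exI conjI allI impI)
      show "eventually (\<lambda>F. finite F \<and> F0 \<subseteq> F) (finite_subsets_at_top UNIV)"
        unfolding eventually_finite_subsets_at_top using F0(1) by auto
      fix x y assume "(finite x \<and> F0 \<subseteq> x) \<and> (finite y \<and> F0 \<subseteq> y)"
      then show "dist (sum f x) (sum f y) < \<epsilon>"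
        using d[of x] d[of y] dist_triangle2[of "sum f x" "sum f y" "sum f F0"] by simp
    qed
  qed
  moreover have "complete (UNIV :: 'b set)" by (rule complete_UNIV)
  ultimately obtain L where "(sum f \<longlongrightarrow> L) (finite_subsets_at_top UNIV)"
    using complete_uniform[where S="UNIV :: 'b set"] by (force simp add: filterlim_def)
  then show "f summable_on UNIV" using summable_on_def has_sum_def by blast
qed

text \<open>For non-negative functions the norm of a finite sum is the supremum of the pointwise
  sums, so norm summability means pointwise tails that are small uniformly in \<open>t\<close>. Both
  \<open>modH\<close> and \<open>Lp\<close> are unfolded through this.\<close>

lemma nonneg_bcontfun_summable_iff:
  fixes f :: "'i \<Rightarrow> ('t::topological_space \<Rightarrow>\<^sub>C 'k::rc_scalar)"
  assumes f: "\<And>i t. apply_bcontfun (f i) t = of_real (g i t)" and g: "\<And>i t. 0 \<le> g i t"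
  shows "f summable_on UNIV \<longleftrightarrow>
    (\<forall>\<epsilon>>0. \<exists>F0. finite F0 \<and> (\<forall>F t. finite F \<and> F \<inter> F0 = {} \<longrightarrow> (\<Sum>i\<in>F. g i t) \<le> \<epsilon>))"
proof -
  have norm: "norm (apply_bcontfun (sum f F) t) = (\<Sum>i\<in>F. g i t)" for F t
  proof -
    have "apply_bcontfun (sum f F) t = of_real (\<Sum>i\<in>F. g i t)" by (simp add: f)
    then show ?thesis by (simp only: norm_of_real) (simp add: g sum_nonneg)
  qed
  show ?thesis
  proof (intro iffI allI impI)
    fix \<epsilon> :: real
    assume *: "f summable_on UNIV" and "\<epsilon> > 0"
    obtain F0 where F0: "finite F0" "\<forall>F. finite F \<and> F \<inter> F0 = {} \<longrightarrow> norm (sum f F) < \<epsilon>"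
      using *[unfolded summable_on_iff_Cauchy, rule_format, OF \<open>\<epsilon> > 0\<close>] by (metis (no_types, lifting))
    have "(\<Sum>i\<in>F. g i t) \<le> \<epsilon>" if "finite F \<and> F \<inter> F0 = {}" for F t
      using F0(2)[rule_format, OF that] norm_bounded[of "sum f F" t] norm[of F t] by simp
    with F0(1) show "\<exists>F0. finite F0 \<and> (\<forall>F t. finite F \<and> F \<inter> F0 = {} \<longrightarrow> (\<Sum>i\<in>F. g i t) \<le> \<epsilon>)"
      by (intro exI[of _ F0]) simp
  next
    assume *: "\<forall>\<epsilon>>0. \<exists>F0. finite F0 \<and> (\<forall>F t. finite F \<and> F \<inter> F0 = {} \<longrightarrow> (\<Sum>i\<in>F. g i t) \<le> \<epsilon>)"
    show "f summable_on UNIV"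
      unfolding summable_on_iff_Cauchy
    proof (intro allI impI)
      fix \<epsilon> :: real assume "\<epsilon> > 0"
      then have "\<epsilon> / 2 > 0" by simp
      obtain F0 where F0: "finite F0" "\<forall>F t. finite F \<and> F \<inter> F0 = {} \<longrightarrow> (\<Sum>i\<in>F. g i t) \<le> \<epsilon> / 2"
        using *[rule_format, OF \<open>\<epsilon> / 2 > 0\<close>] by blast
      have "norm (sum f F) < \<epsilon>" if F: "finite F \<and> F \<inter> F0 = {}" for F
      proof -
        have "norm (sum f F) \<le> \<epsilon> / 2"
          by (rule norm_bound) (use F0(2) F norm[of F] in \<open>simp del: apply_sum_bcontfun\<close>)
        then show ?thesis using \<open>\<epsilon> > 0\<close> by simp
      qed
      with F0(1) show "\<exists>F0. finite F0 \<and> (\<forall>F. finite F \<and> F \<inter> F0 = {} \<longrightarrow> norm (sum f F) < \<epsilon>)"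
        by (intro exI[of _ F0]) simp
    qed
  qed
qed

section \<open>Weak* sums\<close>

lemma hyperstonian_compact: "hyperstonian TYPE('t::t2_space) \<Longrightarrow> compact (UNIV :: 't set)"
  by (simp add: hyperstonian_def)

lemma hyperstonian_open_closure: "hyperstonian TYPE('t::t2_space) \<Longrightarrow> open U \<Longrightarrow> open (closure (U::'t set))"
  by (simp add: hyperstonian_def)

lemma pos_normalD:
  assumes "pos_normal \<phi>"
  shows "\<phi> (x + y) = \<phi> x + \<phi> y" "\<phi> (const_bcontfun c * x) = c * \<phi> x" "cpos x \<Longrightarrow> spos (\<phi> x)"
  using assms by (simp_all add: pos_normal_def)

lemma pos_normal_sup:
  assumes "pos_normal \<phi>" "D \<noteq> {}" "\<And>f. f \<in> D \<Longrightarrow> cpos f"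
    "\<And>f f'. f \<in> D \<Longrightarrow> f' \<in> D \<Longrightarrow> \<exists>h\<in>D. cle f h \<and> cle f' h" "is_csup D g"
  shows "norm (\<phi> g) = (SUP f\<in>D. norm (\<phi> f))"
proof -
  have "\<forall>D g. D \<noteq> {} \<and> (\<forall>f\<in>D. cpos f) \<and> (\<forall>f\<in>D. \<forall>f'\<in>D. \<exists>h\<in>D. cle f h \<and> cle f' h) \<and> is_csup D g
      \<longrightarrow> norm (\<phi> g) = (SUP f\<in>D. norm (\<phi> f))"
    using assms(1) unfolding pos_normal_def by (elim conjE)
  then show ?thesis using assms(2-) by simp
qed

lemma pos_normal_linear:
  assumes \<phi>: "pos_normal \<phi>"
  shows "\<phi> 0 = 0" "\<phi> (- x) = - \<phi> x" "\<phi> (x - y) = \<phi> x - \<phi> y" "\<phi> (sum f F) = (\<Sum>i\<in>F. \<phi> (f i))"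
    "\<phi> (r *\<^sub>R x) = of_real r * \<phi> x"
proof -
  show 0: "\<phi> 0 = 0" using pos_normalD(1)[OF \<phi>, of 0 0] by simp
  show 1: "\<phi> (- x) = - \<phi> x" for x using pos_normalD(1)[OF \<phi>, of "- x" x] 0 by (simp add: eq_neg_iff_add_eq_0)
  show "\<phi> (x - y) = \<phi> x - \<phi> y" using pos_normalD(1)[OF \<phi>, of x "- y"] 1 by simp
  show "\<phi> (sum f F) = (\<Sum>i\<in>F. \<phi> (f i))"
    by (induction F rule: infinite_finite_induct) (auto simp: 0 pos_normalD(1)[OF \<phi>])
  have "r *\<^sub>R x = const_bcontfun (of_real r) * x" by (rule bcontfun_eqI) (simp add: scaleR_conv_of_real)
  then show "\<phi> (r *\<^sub>R x) = of_real r * \<phi> x" by (simp only: pos_normalD(2)[OF \<phi>])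
qed

text \<open>Positivity forces continuity. A real function with values in \<open>[-M, M]\<close>
  satisfies \<open>0 \<le> f + M \<le> 2 M\<close>, hence its image is at most
  \<open>2 M C + M C\<close> with \<open>C = norm (\<phi> 1)\<close>; a general function consists of
  two real ones, which doubles the constant 3 to 6.\<close>

lemma pos_normal_bounded:
  fixes \<phi> :: "('t::topological_space \<Rightarrow>\<^sub>C 'k::rc_scalar) \<Rightarrow> 'k"
  assumes \<phi>: "pos_normal \<phi>"
  shows "bounded_linear \<phi>"
proof -
  define C where "C = norm (\<phi> 1)"
  have mono: "norm (\<phi> f) \<le> norm (\<phi> g)" if "cpos f" "cle f g" for f g
  proof -
    have "\<phi> g = \<phi> f + \<phi> (g - f)" using pos_normalD(1)[OF \<phi>, of f "g - f"] by simp
    moreover have "spos (\<phi> f)" "spos (\<phi> (g - f))" using that pos_normalD(3)[OF \<phi>] by (auto simp: cle_def)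
    ultimately show ?thesis unfolding spos_iff_ex by (auto simp flip: of_real_add)
  qed
  have real: "norm (\<phi> f) \<le> 3 * M * C" if f: "\<And>t. apply_bcontfun f t = of_real (r t)" "\<And>t. \<bar>r t\<bar> \<le> M" "M \<ge> 0" for f r M
  proof -
    let ?M = "M *\<^sub>R (1 :: 't \<Rightarrow>\<^sub>C 'k)"
    have nM: "norm (\<phi> ?M) = M * C" using \<open>M \<ge> 0\<close> by (simp add: pos_normal_linear[OF \<phi>] norm_mult C_def)
    have 1: "cpos (f + ?M)"
      unfolding cpos_def
    proof
      fix t
      have "apply_bcontfun (f + ?M) t = of_real (r t + M)" by (simp add: f scaleR_conv_of_real)
      then show "spos (apply_bcontfun (f + ?M) t)" using f(2)[of t] by (simp only: spos_of_real)
    qed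
    have 2: "cle (f + ?M) (2 *\<^sub>R ?M)"
      unfolding cle_iff
    proof
      fix t
      have "apply_bcontfun (2 *\<^sub>R ?M) t - apply_bcontfun (f + ?M) t = of_real (M - r t)"
        by (simp add: f scaleR_conv_of_real)
      then show "spos (apply_bcontfun (2 *\<^sub>R ?M) t - apply_bcontfun (f + ?M) t)"
        using f(2)[of t] by (simp only: spos_of_real)
    qed
    have "norm (\<phi> (f + ?M)) \<le> 2 * (M * C)"
      using mono[OF 1 2] nM by (simp add: pos_normal_linear(5)[OF \<phi>, of 2] norm_mult del: scaleR_scaleR)
    moreover have "\<phi> f = \<phi> (f + ?M) - \<phi> ?M" by (simp add: pos_normalD(1)[OF \<phi>])
    ultimately show ?thesis using norm_triangle_ineq4[of "\<phi> (f + ?M)" "\<phi> ?M"] nM by simp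
  qed
  obtain j :: 'k where j: "norm j \<le> 1" "\<And>x. x = of_real (kre x) - j * of_real (kre (j * x))"
    using ex_imaginary_unit by blast
  define cr :: "('t \<Rightarrow>\<^sub>C real) \<Rightarrow> 't \<Rightarrow>\<^sub>C 'k" where "cr = (\<lambda>h. Bcontfun (\<lambda>t. of_real (apply_bcontfun h t)))"
  have cr: "apply_bcontfun (cr h) t = of_real (apply_bcontfun h t)" for h t
  proof -
    have "(\<lambda>t. of_real (apply_bcontfun h t) :: 'k) \<in> bcontfun"
      by (rule bcontfun_normI[where b="norm h"]) (auto intro!: continuous_intros simp: norm_bounded[of h, simplified])
    then show ?thesis by (simp add: cr_def Bcontfun_inverse)
  qed
  have "norm (\<phi> f) \<le> norm f * (6 * C)" for f
  proof -
    have n: "norm (apply_bcontfun f t) \<le> norm f" for t by (rule norm_bounded)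
    have "\<bar>kre (apply_bcontfun f t)\<bar> \<le> norm f" for t
      using n[of t] abs_kre_le[of "apply_bcontfun f t"] by linarith
    then have 1: "norm (\<phi> (cr (cre f))) \<le> 3 * norm f * C"
      by (intro real[where r="\<lambda>t. kre (apply_bcontfun f t)"]) (auto simp: cr)
    have "\<bar>kre (j * apply_bcontfun f t)\<bar> \<le> norm f" for t
    proof -
      have "norm (j * apply_bcontfun f t) \<le> 1 * norm f"
        unfolding norm_mult using j(1) n by (intro mult_mono) auto
      then show ?thesis using abs_kre_le[of "j * apply_bcontfun f t"] by linarith
    qed
    then have 2: "norm (\<phi> (cr (cre (const_bcontfun j * f)))) \<le> 3 * norm f * C"
      by (intro real[where r="\<lambda>t. kre (j * apply_bcontfun f t)"]) (auto simp: cr)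
    have "f = cr (cre f) - const_bcontfun j * cr (cre (const_bcontfun j * f))"
      by (rule bcontfun_eqI) (use j(2) in \<open>simp add: cr\<close>)
    then have "\<phi> f = \<phi> (cr (cre f)) - j * \<phi> (cr (cre (const_bcontfun j * f)))"
      by (metis pos_normal_linear(3)[OF \<phi>] pos_normalD(2)[OF \<phi>])
    then have "norm (\<phi> f) \<le> norm (\<phi> (cr (cre f))) + norm j * norm (\<phi> (cr (cre (const_bcontfun j * f))))"
      by (metis norm_mult norm_triangle_ineq4)
    also have "norm j * norm (\<phi> (cr (cre (const_bcontfun j * f)))) \<le> 1 * norm (\<phi> (cr (cre (const_bcontfun j * f))))"
      using j(1) by (intro mult_right_mono) auto
    finally show ?thesis using 1 2 by (simp add: mult_ac)
  qed
  then show ?thesis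
  proof (rule bounded_linear_intro[rotated 2])
    show "\<phi> (f + g) = \<phi> f + \<phi> g" for f g by (rule pos_normalD(1)[OF \<phi>])
    show "\<phi> (r *\<^sub>R f) = r *\<^sub>R \<phi> f" for r f
      unfolding pos_normal_linear(5)[OF \<phi>] by (simp add: scaleR_conv_of_real)
  qed
qed

text \<open>Bounded functionals commute with norm sums. Together with uniqueness this computes
  \<open>minner\<close> wherever its series converges in norm.\<close>

lemma has_sum_imp_weak_star_has_sum: "(f has_sum x) UNIV \<Longrightarrow> weak_star_has_sum f x"
  unfolding weak_star_has_sum_def by (intro allI impI has_sum_bounded_linear[OF pos_normal_bounded])

text \<open>The separating functionals of a hyperstonian space are real; the extension is
  \<open>\<Phi> f = \<phi> (1\<^sub>V Re f) - j \<phi> (1\<^sub>V Re (j f))\<close>.\<close>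

lemma pos_normal_restrict_extend:
  fixes \<phi> :: "('t::topological_space \<Rightarrow>\<^sub>C real) \<Rightarrow> real" and \<kappa> :: "'t \<Rightarrow>\<^sub>C real"
  assumes \<phi>: "pos_normal \<phi>" and V: "open V" "closed V" and \<kappa>: "\<And>t. apply_bcontfun \<kappa> t = indicator V t"
  obtains \<Phi> :: "('t \<Rightarrow>\<^sub>C 'k::rc_scalar) \<Rightarrow> 'k"
  where "pos_normal \<Phi>" "\<And>f. kre (\<Phi> f) = \<phi> (\<kappa> * cre f)"
proof -
  obtain j :: 'k where j: "j = 0 \<or> j * j = - 1" "\<And>x. x = of_real (kre x) - j * of_real (kre (j * x))"
    using ex_imaginary_unit by blast
  \<comment> \<open>Decomposing 1 shows that \<open>j\<close> has real part 0; this makes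
    \<open>R\<close> the real part of \<open>\<Phi>\<close>.\<close>
  have "j * of_real (kre j) = 0" using j(2)[of 1] by simp
  then have kj: "kre j = 0" by auto
  define R where "R = (\<lambda>f :: 't \<Rightarrow>\<^sub>C 'k. \<phi> (\<kappa> * cre f))"
  have Radd: "R (f + g) = R f + R g" for f g
  proof -
    have "\<kappa> * cre (f + g) = \<kappa> * cre f + \<kappa> * cre g" by (rule bcontfun_eqI) (simp add: kre_add distrib_left)
    then show ?thesis by (simp add: R_def pos_normalD(1)[OF \<phi>])
  qed
  have Rscale: "R (const_bcontfun (of_real r) * f) = r * R f" for r f
  proof -
    have "\<kappa> * cre (const_bcontfun (of_real r) * f) = const_bcontfun r * (\<kappa> * cre f)"
      by (rule bcontfun_eqI) simp
    then show ?thesis by (simp only: R_def pos_normalD(2)[OF \<phi>])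
  qed
  define \<Phi> where "\<Phi> = (\<lambda>f. of_real (R f) - j * of_real (R (const_bcontfun j * f)))"
  have kre\<Phi>: "kre (\<Phi> f) = R f" for f
  proof -
    have "kre (j * of_real (R (const_bcontfun j * f))) = 0"
      using kj kre_of_real_mult[of "R (const_bcontfun j * f)" j] by (simp add: mult.commute)
    then show ?thesis by (simp add: \<Phi>_def kre_diff)
  qed
  have \<Phi>add: "\<Phi> (f + g) = \<Phi> f + \<Phi> g" for f g
    by (simp add: \<Phi>_def distrib_left Radd algebra_simps)
  have \<Phi>r: "\<Phi> (const_bcontfun (of_real r) * f) = of_real r * \<Phi> f" for r f
  proof -
    have "const_bcontfun j * (const_bcontfun (of_real r) * f) = const_bcontfun (of_real r) * (const_bcontfun j * f)"
      by (simp add: mult.left_commute)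
    then have "\<Phi> (const_bcontfun (of_real r) * f) = of_real (r * R f) - j * of_real (r * R (const_bcontfun j * f))"
      by (simp only: \<Phi>_def Rscale)
    then show ?thesis by (simp add: \<Phi>_def right_diff_distrib)
  qed
  have \<Phi>j: "\<Phi> (const_bcontfun j * f) = j * \<Phi> f" for f
    using j(1)
  proof
    assume "j = 0"
    then show ?thesis using \<Phi>r[of 0 f] by simp
  next
    assume jj: "j * j = - 1"
    have "const_bcontfun j * (const_bcontfun j * f) = const_bcontfun (of_real (- 1)) * f"
      by (rule bcontfun_eqI) (simp add: jj mult.assoc[symmetric])
    then have "R (const_bcontfun j * (const_bcontfun j * f)) = - R f"
      by (simp only: Rscale)
    then show ?thesis by (simp add: \<Phi>_def right_diff_distrib jj mult.assoc[symmetric])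
  qed
  have \<Phi>c: "\<Phi> (const_bcontfun c * f) = c * \<Phi> f" for c f
  proof -
    let ?a = "kre c" and ?b = "- kre (j * c)"
    have c: "c = of_real ?a + of_real ?b * j" using j(2)[of c] by (simp add: mult.commute)
    have "const_bcontfun c * f = const_bcontfun (of_real ?a) * f + const_bcontfun (of_real ?b) * (const_bcontfun j * f)"
      by (rule bcontfun_eqI) (subst c, simp add: algebra_simps)
    then have "\<Phi> (const_bcontfun c * f) = of_real ?a * \<Phi> f + of_real ?b * (j * \<Phi> f)"
      by (simp only: \<Phi>add \<Phi>r \<Phi>j)
    also have "\<dots> = c * \<Phi> f" by (subst (3) c) (simp add: algebra_simps)
    finally show ?thesis .
  qed
  have pos: "R f \<ge> 0 \<and> \<Phi> f = of_real (R f)" if f: "cpos f" for f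
  proof
    have f0: "0 \<le> kre (apply_bcontfun f t)" "apply_bcontfun f t = of_real (kre (apply_bcontfun f t))" for t
      by (rule cposD[OF f])+
    have "cpos (\<kappa> * cre f)" by (simp add: cpos_def \<kappa> f0(1))
    then show "R f \<ge> 0" using pos_normalD(3)[OF \<phi>] by (simp add: R_def)
    have "kre (j * apply_bcontfun f t) = 0" for t
      by (subst f0(2)) (simp only: mult.commute[of j] kre_of_real_mult kj mult_zero_right)
    then have "\<kappa> * cre (const_bcontfun j * f) = 0" by (intro bcontfun_eqI) simp
    then show "\<Phi> f = of_real (R f)" by (simp add: \<Phi>_def R_def pos_normal_linear[OF \<phi>])
  qed
  have "pos_normal \<Phi>"
    unfolding pos_normal_def
  proof (intro conjI allI impI \<Phi>add \<Phi>c)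
    show "spos (\<Phi> f)" if "cpos f" for f using pos[OF that] by simp
    fix D and g :: "'t \<Rightarrow>\<^sub>C 'k" assume "D \<noteq> {} \<and> (\<forall>f\<in>D. cpos f) \<and> (\<forall>f\<in>D. \<forall>f'\<in>D. \<exists>h\<in>D. cle f h \<and> cle f' h) \<and> is_csup D g"
    then have D: "D \<noteq> {}" "\<And>f. f \<in> D \<Longrightarrow> cpos f" "\<And>f f'. f \<in> D \<Longrightarrow> f' \<in> D \<Longrightarrow> \<exists>h\<in>D. cle f h \<and> cle f' h"
      and sup: "\<And>f. f \<in> D \<Longrightarrow> cle f g" "\<And>h. (\<And>f. f \<in> D \<Longrightarrow> cle f h) \<Longrightarrow> cle g h"
      by (auto simp: is_csup_def)
    have D0: "0 \<le> kre (apply_bcontfun f t)" if "f \<in> D" for f t by (rule cposD(1)[OF D(2)[OF that]])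
    have cposg: "cpos g"
    proof -
      obtain f where f: "f \<in> D" using D(1) by blast
      have "apply_bcontfun g t = apply_bcontfun f t + (apply_bcontfun g t - apply_bcontfun f t)" for t by simp
      then show ?thesis
        using D(2)[OF f] sup(1)[OF f] unfolding cpos_def cle_iff spos_iff_ex
        by (metis add_nonneg_nonneg of_real_add)
    qed
    let ?D = "(\<lambda>f. \<kappa> * cre f) ` D"
    have "norm (\<phi> (\<kappa> * cre g)) = (SUP f\<in>?D. norm (\<phi> f))"
    proof (rule pos_normal_sup[OF \<phi>])
      show "?D \<noteq> {}" using D(1) by simp
      show "cpos f" if "f \<in> ?D" for f using that D0 by (auto simp: cpos_def \<kappa>)
      show "\<exists>h\<in>?D. cle f h \<and> cle f' h" if ff: "f \<in> ?D" "f' \<in> ?D" for f f'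
      proof -
        obtain a b where "a \<in> D" "f = \<kappa> * cre a" "b \<in> D" "f' = \<kappa> * cre b" using ff by blast
        moreover obtain h where "h \<in> D" "cle a h" "cle b h" using D(3) calculation by blast
        ultimately show ?thesis
          by (intro bexI[of _ "\<kappa> * cre h"]) (auto simp: cle_real_iff \<kappa> intro!: mult_left_mono cle_kre)
      qed
      show "is_csup ?D (\<kappa> * cre g)"
        unfolding is_csup_def
      proof (intro conjI ballI allI impI)
        show "cle f (\<kappa> * cre g)" if "f \<in> ?D" for f
          using that sup(1) by (auto simp: cle_real_iff \<kappa> intro!: mult_left_mono cle_kre)
        fix h assume h: "\<forall>f\<in>?D. cle f h"
        \<comment> \<open>An upper bound \<open>h\<close> of the truncated functions is completed by
          \<open>g\<close> off \<open>V\<close> to an upper bound of all of \<open>D\<close>; the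
          gluing is continuous because \<open>V\<close> is clopen. Minimality of \<open>g\<close>
          then gives the inequality on \<open>V\<close>.\<close>
        define h' :: "'t \<Rightarrow> 'k" where "h' = (\<lambda>t. if t \<in> V then of_real (apply_bcontfun h t) else apply_bcontfun g t)"
        have "h' \<in> bcontfun"
        proof (rule bcontfun_normI)
          have "continuous_on (V \<union> - V) h'"
            unfolding h'_def using V
            by (intro continuous_on_If) (auto intro!: continuous_intros simp: closed_Compl)
          then show "continuous_on UNIV h'" by simp
          show "norm (h' t) \<le> max (norm h) (norm g)" for t
            using norm_bounded[of h t] norm_bounded[of g t] by (auto simp: h'_def)
        qed
        then have h'ap: "apply_bcontfun (Bcontfun h') = h'" by (rule Bcontfun_inverse)
        have hge: "indicator V t * kre (apply_bcontfun f t) \<le> apply_bcontfun h t" if "f \<in> D" for f t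
          using h that by (auto simp: cle_real_iff \<kappa>)
        have "cle g (Bcontfun h')"
        proof (rule sup(2))
          fix f assume f: "f \<in> D"
          show "cle f (Bcontfun h')"
            unfolding cle_iff h'ap
          proof
            fix t
            have ft: "apply_bcontfun f t = of_real (kre (apply_bcontfun f t))"
              by (rule cposD(2)[OF D(2)[OF f]])
            show "spos (h' t - apply_bcontfun f t)"
            proof (cases "t \<in> V")
              case True
              then have "h' t - apply_bcontfun f t = of_real (apply_bcontfun h t - kre (apply_bcontfun f t))"
                using ft by (simp add: h'_def)
              then show ?thesis using hge[OF f, of t] True by (simp only: spos_of_real) simp
            next
              case False
              then show ?thesis using sup(1)[OF f] by (simp add: h'_def cle_iff)
            qed
          qed
        qed
        show "cle (\<kappa> * cre g) h"
          unfolding cle_real_iff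
        proof
          fix t
          obtain f where f: "f \<in> D" using D(1) by blast
          show "apply_bcontfun (\<kappa> * cre g) t \<le> apply_bcontfun h t"
          proof (cases "t \<in> V")
            case True
            then have "h' t = of_real (apply_bcontfun h t)" by (simp add: h'_def)
            then show ?thesis using cle_kre[OF \<open>cle g (Bcontfun h')\<close>, of t] True by (simp add: h'ap \<kappa>)
          next
            case False
            then show ?thesis using hge[OF f, of t] by (simp add: \<kappa>)
          qed
        qed
      qed
    qed
    moreover have "norm (\<Phi> f) = norm (\<phi> (\<kappa> * cre f))" if "cpos f" for f
      using pos[OF that] by (simp add: R_def)
    ultimately show "norm (\<Phi> g) = (SUP f\<in>D. norm (\<Phi> f))"
      using cposg D(2) by (simp add: image_image)
  qed
  then show ?thesis by (rule that) (simp add: kre\<Phi> R_def)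
qed

text \<open>If \<open>d = x - y\<close> is not 0, a scalar multiple of it has real part at least
  some \<open>\<epsilon> > 0\<close> on a non-empty clopen set \<open>V\<close>. A normal functional
  not vanishing on the indicator of \<open>V\<close>, restricted to \<open>V\<close> and extended to
  \<open>'k\<close>-valued functions, would then tell \<open>x\<close> from \<open>y\<close>. This
  makes the description in \<open>minner\<close> usable.\<close>

lemma weak_star_sum_unique:
  fixes x y :: "'t::t2_space \<Rightarrow>\<^sub>C 'k::rc_scalar"
  assumes T: "hyperstonian TYPE('t)" and x: "weak_star_has_sum f x" and y: "weak_star_has_sum f y"
  shows "x = y"
proof (rule ccontr)
  assume "x \<noteq> y"
  define d where "d = x - y"
  obtain t0 where t0: "apply_bcontfun d t0 \<noteq> 0" using \<open>x \<noteq> y\<close> bcontfun_eqI[of x y] by (auto simp: d_def)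
  define c where "c = kconj (apply_bcontfun d t0)"
  \<comment> \<open>Half of the value of \<open>?r\<close> at \<open>t0\<close>: the strict
    inequality holds at \<open>t0\<close>, and the weak one survives on the closure.\<close>
  define \<epsilon> where "\<epsilon> = (norm (apply_bcontfun d t0))\<^sup>2 / 2"
  have "\<epsilon> > 0" using t0 by (simp add: \<epsilon>_def)
  let ?r = "\<lambda>t. kre (c * apply_bcontfun d t)"
  have cr: "continuous_on UNIV ?r" by (intro continuous_intros continuous_on_apply_bcontfun)
  define V where "V = closure {t. \<epsilon> < ?r t}"
  have "open {t. \<epsilon> < ?r t}" using cr by (intro open_Collect_less continuous_on_const)
  then have V: "open V" "closed V" using hyperstonian_open_closure[OF T] by (auto simp: V_def)
  have "V \<subseteq> {t. \<epsilon> \<le> ?r t}"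
    unfolding V_def by (rule closure_minimal) (auto intro!: closed_Collect_le cr continuous_on_const)
  then have Vr: "\<epsilon> \<le> ?r t" if "t \<in> V" for t using that by blast
  have "?r t0 = 2 * \<epsilon>" by (simp add: c_def \<epsilon>_def)
  then have "t0 \<in> V" using \<open>\<epsilon> > 0\<close> closure_subset by (force simp: V_def)
  define \<kappa> :: "'t \<Rightarrow>\<^sub>C real" where "\<kappa> = Bcontfun (indicator V)"
  have "continuous_on UNIV (indicator V :: 't \<Rightarrow> real)"
    by (rule continuous_on_indicator_clopen[OF V])
  then have \<kappa>: "apply_bcontfun \<kappa> t = indicator V t" for t
    unfolding \<kappa>_def by (rule apply_Bcontfun[OF hyperstonian_compact[OF T]])
  have "cpos \<kappa>" by (simp add: cpos_def \<kappa>)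
  moreover have "\<kappa> \<noteq> 0" using \<kappa>[of t0] \<open>t0 \<in> V\<close> by auto
  ultimately obtain \<phi> where \<phi>: "pos_normal \<phi>" "\<phi> \<kappa> \<noteq> 0" using T unfolding hyperstonian_def by blast
  obtain \<Phi> :: "('t \<Rightarrow>\<^sub>C 'k) \<Rightarrow> 'k" where \<Phi>: "pos_normal \<Phi>" "\<And>f. kre (\<Phi> f) = \<phi> (\<kappa> * cre f)"
    using pos_normal_restrict_extend[OF \<phi>(1) V \<kappa>] by blast
  have "\<Phi> x = \<Phi> y" using x y \<Phi>(1) has_sum_unique unfolding weak_star_has_sum_def by blast
  then have "\<Phi> (const_bcontfun c * d) = 0"
    by (simp add: d_def pos_normalD(2)[OF \<Phi>(1)] pos_normal_linear[OF \<Phi>(1)])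
  then have 0: "\<phi> (\<kappa> * cre (const_bcontfun c * d)) = 0" using \<Phi>(2)[of "const_bcontfun c * d"] by simp
  have "cpos (\<kappa> * cre (const_bcontfun c * d) - \<epsilon> *\<^sub>R \<kappa>)"
    using Vr by (auto simp: cpos_def \<kappa> indicator_def)
  then have "0 \<le> \<phi> (\<kappa> * cre (const_bcontfun c * d) - \<epsilon> *\<^sub>R \<kappa>)" using pos_normalD(3)[OF \<phi>(1)] by simp
  then have "\<epsilon> * \<phi> \<kappa> \<le> 0" by (simp add: pos_normal_linear[OF \<phi>(1)] 0)
  moreover have "0 \<le> \<phi> \<kappa>" using pos_normalD(3)[OF \<phi>(1) \<open>cpos \<kappa>\<close>] by simp
  ultimately show False using \<phi>(2) \<open>\<epsilon> > 0\<close> by (simp add: mult_le_0_iff)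
qed

text \<open>The supremum \<open>g t\<close> collects the levels \<open>r\<close> for which
  \<open>t\<close> lies in the closure \<open>W r\<close> of the set where some \<open>u a\<close>
  exceeds \<open>r\<close>. Extremal disconnectedness makes each \<open>W r\<close> clopen, so both
  \<open>{t. a < g t}\<close> and \<open>{t. g t < a}\<close> are open. A continuous upper bound is
  at least \<open>r\<close> on \<open>W r\<close>, which gives minimality.\<close>

lemma stonean_sup:
  fixes u :: "'a \<Rightarrow> 't::t2_space \<Rightarrow> real"
  assumes T: "hyperstonian TYPE('t)" and u: "\<And>a. continuous_on UNIV (u a)" "\<And>a t. u a t \<le> M"
    and u0: "\<And>t. 0 \<le> u a0 t"
  shows "\<exists>g. continuous_on UNIV g \<and> (\<forall>a t. u a t \<le> g t) \<and>
    (\<forall>h t. continuous_on UNIV h \<longrightarrow> (\<forall>a t. u a t \<le> h t) \<longrightarrow> g t \<le> h t)"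
proof -
  define W where "W = (\<lambda>r. closure (\<Union>a. {t. r < u a t}))"
  have W: "open (W r)" "closed (W r)" for r
    unfolding W_def
    by (auto intro!: hyperstonian_open_closure[OF T] open_UN open_Collect_less continuous_on_const u)
  have mono: "W r \<subseteq> W r'" if "r' \<le> r" for r r'
    unfolding W_def using that by (intro closure_mono UN_mono) (auto intro: order.strict_trans1)
  \<comment> \<open>The member \<open>u a0\<close> bounds the family from below; without a level
    common to all points the supremum could be over an empty set.\<close>
  have neg: "t \<in> W (-1)" for t
  proof -
    have "-1 < u a0 t" using u0[of t] by simp
    then have "t \<in> (\<Union>a. {t. -1 < u a t})" by blast
    then show ?thesis unfolding W_def by (rule closure_subset[THEN subsetD])
  qed
  have "W r = {}" if "r \<ge> M" for r
  proof -
    have "{t. r < u a t} = {}" for a using order_trans[OF u(2) that] by (simp add: not_less)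
    then show ?thesis by (simp add: W_def)
  qed
  then have bound: "r \<le> M" if "t \<in> W r" for r t
    using that by (cases "r \<le> M") auto
  define g where "g = (\<lambda>t. Sup {r. t \<in> W r})"
  have bdd: "bdd_above {r. t \<in> W r}" for t using bound by (auto intro!: bdd_aboveI)
  have ne: "{r. t \<in> W r} \<noteq> {}" for t using neg by blast
  have less: "a < g t \<longleftrightarrow> (\<exists>r>a. t \<in> W r)" for a t
    unfolding g_def using less_cSup_iff[OF ne bdd] by auto
  have greater: "g t < a \<longleftrightarrow> (\<exists>r<a. t \<notin> W r)" for a t
  proof
    assume "g t < a"
    then obtain r where "g t < r" "r < a" using dense by blast
    have "r \<le> g t" if "t \<in> W r" unfolding g_def using that by (intro cSup_upper bdd) simp
    with \<open>g t < r\<close> \<open>r < a\<close> show "\<exists>r<a. t \<notin> W r" by auto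
  next
    assume "\<exists>r<a. t \<notin> W r"
    then obtain r where r: "r < a" "t \<notin> W r" by blast
    have "g t \<le> r" unfolding g_def
    proof (rule cSup_least[OF ne])
      fix r' assume "r' \<in> {r. t \<in> W r}"
      then show "r' \<le> r" using r(2) mono[of r r'] by (cases "r' \<le> r") auto
    qed
    with r show "g t < a" by simp
  qed
  show ?thesis
  proof (intro exI[of _ g] conjI allI impI)
    show "continuous_on UNIV g"
      unfolding continuous_on_def
    proof (intro ballI order_tendstoI)
      fix t a
      have "open (\<Union>r\<in>{a<..}. W r)" "open (\<Union>r\<in>{..<a}. - W r)" using W by auto
      moreover have "(\<Union>r\<in>{a<..}. W r) = {t. a < g t}" "(\<Union>r\<in>{..<a}. - W r) = {t. g t < a}"
        by (auto simp: less greater)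
      ultimately have "open {t. a < g t}" "open {t. g t < a}" by simp_all
      then show "a < g t \<Longrightarrow> eventually (\<lambda>x. a < g x) (at t)" "g t < a \<Longrightarrow> eventually (\<lambda>x. g x < a) (at t)"
        by (auto simp: eventually_at_topological)
    qed
    show "u a t \<le> g t" for a t
    proof (rule dense_le)
      fix r assume "r < u a t"
      then have "t \<in> (\<Union>a. {t. r < u a t})" by blast
      then have "t \<in> W r" unfolding W_def by (rule closure_subset[THEN subsetD])
      then show "r \<le> g t" unfolding g_def by (intro cSup_upper bdd) simp
    qed
    fix h t assume h: "continuous_on UNIV h" "\<forall>a t. u a t \<le> h t"
    have "W r \<subseteq> {t. r \<le> h t}" for r
      unfolding W_def
    proof (rule closure_minimal)
      show "(\<Union>a. {t. r < u a t}) \<subseteq> {t. r \<le> h t}"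
      proof (clarsimp)
        fix a t assume "r < u a t"
        then show "r \<le> h t" using h(2)[rule_format, of a t] by simp
      qed
      show "closed {t. r \<le> h t}" by (intro closed_Collect_le h(1) continuous_on_const)
    qed
    then show "g t \<le> h t" unfolding g_def by (intro cSup_least[OF ne]) auto
  qed
qed

section \<open>Differences of compact operators and Lipschitz dependence of singular values\<close>

lemma compact_op_uminus:
  assumes "compact_op A"
  shows "compact_op (- A)"
proof -
  have "blinfun_apply (- A) ` cball 0 1 = blinfun_apply A ` uminus ` cball 0 1"
    by (simp add: image_image blinfun.minus_left blinfun.minus_right)
  also have "uminus ` cball (0 :: ('a, 'b) ell2) 1 = cball 0 1"
  proof (intro equalityI subsetI)
    fix x :: "('a, 'b) ell2" assume "x \<in> cball 0 1"
    then have "x = - (- x)" "- x \<in> cball 0 1" by auto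
    then show "x \<in> uminus ` cball 0 1" by (rule image_eqI)
  qed auto
  finally have "blinfun_apply (- A) ` cball 0 1 = blinfun_apply A ` cball 0 1" .
  moreover have "ksc c (- x) = - ksc c x" for c and x :: "('a, 'b) ell2" by (rule ell2_eqI) simp
  ultimately show ?thesis using assms by (simp add: compact_op_def klin_def blinfun.minus_left)
qed

lemma compact_op_diff: "compact_op A \<Longrightarrow> compact_op B \<Longrightarrow> compact_op (A - B)"
  using compact_op_add[of A "- B"] compact_op_uminus[of B] by simp

text \<open>Weyl's inequality for \<open>A = B + (A - B)\<close> with index 0 for the difference,
  whose largest singular value is its norm.\<close>

lemma schmidt_lipschitz:
  assumes S: "schmidt A s e f" and S': "schmidt B s' e' f'" and AB: "compact_op (A - B)"
  shows "s n \<le> s' n + norm (A - B)"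
proof -
  obtain s'' e'' f'' where S'': "schmidt (A - B) s'' e'' f''" using schmidt_exists[OF AB] by blast
  have "schmidt (B + (A - B)) s e f" using S by simp
  from schmidt_weyl[OF S' S'' this, of n 0] show ?thesis using schmidt_norm[OF S''] by simp
qed

section \<open>The modules as bundles of Hilbert spaces\<close>

text \<open>The value of a family at \<open>t\<close> as a vector of the Hilbert space; meaningful
  for members of \<open>K\<close>, whose values are square-summable.\<close>

definition fib :: "'t::topological_space \<Rightarrow> ('i, 't, 'k::rc_scalar) family \<Rightarrow> ('i, 'k) ell2" where
  "fib t \<xi> = of_coord (ev_at t \<xi>)"

lemma fib_eqI: "(\<And>\<iota>. apply_bcontfun (\<xi> \<iota>) t = coord x \<iota>) \<Longrightarrow> fib t \<xi> = x"
  by (metis coord_inverse ev_at_def ext fib_def)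

lemma apply_sum_cstar:
  "apply_bcontfun (\<Sum>\<iota>\<in>F. cstar (\<xi> \<iota>) * \<xi> \<iota>) t = of_real (\<Sum>\<iota>\<in>F. (norm (apply_bcontfun (\<xi> \<iota>) t))\<^sup>2)"
  by (simp only: apply_sum_bcontfun apply_times_bcontfun apply_cstar of_real_sum mult.commute[of "kconj _"] mult_kconj)

locale hilbert_family =
  fixes P :: "'i \<Rightarrow> ('t::t2_space \<Rightarrow>\<^sub>C 'k::rc_scalar)"
  assumes hyperstonian: "hyperstonian TYPE('t)"
    and projection: "cprojection (P \<iota>)"
begin

abbreviation H where "H \<equiv> modH P"
abbreviation K where "K \<equiv> modK P"

lemmas compact_T = hyperstonian_compact[OF hyperstonian]

lemma apply_Bcontfun_T [simp]:
  "continuous_on UNIV f \<Longrightarrow> apply_bcontfun (Bcontfun f) t = f t"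
  for f :: "'t \<Rightarrow> 'b::metric_space"
  by (rule apply_Bcontfun[OF compact_T])

lemma P_mult: "P \<iota> * P \<iota> = P \<iota>"
  using projection[of \<iota>] by (simp add: cprojection_def)

lemma P_apply_idem: "apply_bcontfun (P \<iota>) t * apply_bcontfun (P \<iota>) t = apply_bcontfun (P \<iota>) t"
  by (metis P_mult apply_times_bcontfun)

lemma P_apply_kconj: "kconj (apply_bcontfun (P \<iota>) t) = apply_bcontfun (P \<iota>) t"
  using projection[of \<iota>] by (metis apply_cstar cprojection_def)

text \<open>An idempotent of a field is 0 or 1. So every projection is an indicator function, and
  \<open>psi\<close> followed by evaluation at \<open>t\<close> keeps exactly the coordinates whose
  projection is 1 at \<open>t\<close>.\<close>

lemma P_01: "apply_bcontfun (P \<iota>) t = 0 \<or> apply_bcontfun (P \<iota>) t = 1"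
  using P_apply_idem[of \<iota> t] by simp

lemma P_norm_le: "norm (apply_bcontfun (P \<iota>) t) \<le> 1"
  using P_01[of \<iota> t] by auto

lemma in_range_P: "x \<in> range (\<lambda>x. P \<iota> * x) \<longleftrightarrow> P \<iota> * x = x"
  by (metis P_mult mult.assoc rangeE rangeI)

section \<open>Square sums and fibres of the modules\<close>

lemma modH_iff: "\<xi> \<in> H \<longleftrightarrow> (\<forall>\<iota>. P \<iota> * \<xi> \<iota> = \<xi> \<iota>) \<and> (\<forall>\<epsilon>>0. \<exists>F0. finite F0 \<and>
    (\<forall>F t. finite F \<and> F \<inter> F0 = {} \<longrightarrow> (\<Sum>\<iota>\<in>F. (norm (apply_bcontfun (\<xi> \<iota>) t))\<^sup>2) \<le> \<epsilon>))"
proof -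
  have "(\<lambda>\<iota>. cstar (\<xi> \<iota>) * \<xi> \<iota>) summable_on UNIV \<longleftrightarrow> (\<forall>\<epsilon>>0. \<exists>F0. finite F0 \<and>
    (\<forall>F t. finite F \<and> F \<inter> F0 = {} \<longrightarrow> (\<Sum>\<iota>\<in>F. (norm (apply_bcontfun (\<xi> \<iota>) t))\<^sup>2) \<le> \<epsilon>))"
  proof (rule nonneg_bcontfun_summable_iff)
    show "apply_bcontfun (cstar (\<xi> \<iota>) * \<xi> \<iota>) t = of_real ((norm (apply_bcontfun (\<xi> \<iota>) t))\<^sup>2)" for \<iota> t
      by (simp only: apply_times_bcontfun apply_cstar mult.commute[of "kconj _"] mult_kconj)
  qed simp
  then show ?thesis by (simp only: modH_def mem_Collect_eq in_range_P)
qed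

lemma modK_iff: "\<xi> \<in> K \<longleftrightarrow> (\<forall>\<iota>. P \<iota> * \<xi> \<iota> = \<xi> \<iota>) \<and>
    (\<exists>C\<ge>0. \<forall>F t. finite F \<longrightarrow> (\<Sum>\<iota>\<in>F. (norm (apply_bcontfun (\<xi> \<iota>) t))\<^sup>2) \<le> C\<^sup>2)"
proof -
  let ?g = "\<lambda>F t. \<Sum>\<iota>\<in>F. (norm (apply_bcontfun (\<xi> \<iota>) t))\<^sup>2"
  let ?s = "\<lambda>F. \<Sum>\<iota>\<in>F. cstar (\<xi> \<iota>) * \<xi> \<iota>"
  have n: "norm (apply_bcontfun (?s F) t) = ?g F t" for F t
    unfolding apply_sum_cstar norm_of_real by (simp add: sum_nonneg)
  have "bounded {?s F | F. finite F} \<longleftrightarrow> (\<exists>C\<ge>0. \<forall>F t. finite F \<longrightarrow> ?g F t \<le> C\<^sup>2)"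
  proof
    assume "bounded {?s F | F. finite F}"
    then obtain B where B: "\<And>x. x \<in> {?s F | F. finite F} \<Longrightarrow> norm x \<le> B" unfolding bounded_iff by auto
    have "?g F t \<le> (sqrt (max B 0))\<^sup>2" if "finite F" for F t
    proof -
      have "norm (?s F) \<le> B" by (rule B) (use that in auto)
      then have "?g F t \<le> max B 0" using norm_bounded[of "?s F" t] by (simp only: n)
      then show ?thesis by simp
    qed
    then show "\<exists>C\<ge>0. \<forall>F t. finite F \<longrightarrow> ?g F t \<le> C\<^sup>2" by (intro exI[of _ "sqrt (max B 0)"]) simp
  next
    assume "\<exists>C\<ge>0. \<forall>F t. finite F \<longrightarrow> ?g F t \<le> C\<^sup>2"
    then obtain C where C: "\<And>F t. finite F \<Longrightarrow> ?g F t \<le> C\<^sup>2" by blast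
    have "norm (?s F) \<le> C\<^sup>2" if "finite F" for F
      by (rule norm_bound) (simp only: n C[OF that])
    then show "bounded {?s F | F. finite F}" unfolding bounded_iff by (intro exI[of _ "C\<^sup>2"]) auto
  qed
  then show ?thesis by (simp only: modK_def mem_Collect_eq in_range_P)
qed

lemma P_absorb: "\<xi> \<in> K \<Longrightarrow> apply_bcontfun (P \<iota>) t * apply_bcontfun (\<xi> \<iota>) t = apply_bcontfun (\<xi> \<iota>) t"
  by (metis apply_times_bcontfun modK_iff)

lemma modH_subset_modK: "\<xi> \<in> H \<Longrightarrow> \<xi> \<in> K"
proof -
  assume \<xi>: "\<xi> \<in> H"
  let ?n = "\<lambda>\<iota> t. (norm (apply_bcontfun (\<xi> \<iota>) t))\<^sup>2"
  have *: "\<forall>\<epsilon>>0. \<exists>F0. finite F0 \<and> (\<forall>F t. finite F \<and> F \<inter> F0 = {} \<longrightarrow> (\<Sum>\<iota>\<in>F. ?n \<iota> t) \<le> \<epsilon>)"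
    using \<xi> unfolding modH_iff by (elim conjE)
  obtain F0 where F0: "finite F0" "\<forall>F t. finite F \<and> F \<inter> F0 = {} \<longrightarrow> (\<Sum>\<iota>\<in>F. ?n \<iota> t) \<le> 1"
    using *[rule_format, of 1] by auto
  define B where "B = (\<Sum>\<iota>\<in>F0. (norm (\<xi> \<iota>))\<^sup>2) + 1"
  have "B \<ge> 0" by (simp add: B_def sum_nonneg)
  have "(\<Sum>\<iota>\<in>F. ?n \<iota> t) \<le> (sqrt B)\<^sup>2" if "finite F" for F t
  proof -
    have "(\<Sum>\<iota>\<in>F. ?n \<iota> t) = (\<Sum>\<iota>\<in>F \<inter> F0. ?n \<iota> t) + (\<Sum>\<iota>\<in>F - F0. ?n \<iota> t)"
      using that by (subst sum.union_disjoint[symmetric]) (auto simp: Int_Diff_Un)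
    also have "(\<Sum>\<iota>\<in>F - F0. ?n \<iota> t) \<le> 1" using F0(2) that by auto
    also have "(\<Sum>\<iota>\<in>F \<inter> F0. ?n \<iota> t) \<le> (\<Sum>\<iota>\<in>F0. ?n \<iota> t)"
      by (rule sum_mono2) (use F0(1) in auto)
    also have "\<dots> \<le> (\<Sum>\<iota>\<in>F0. (norm (\<xi> \<iota>))\<^sup>2)"
      by (intro sum_mono power_mono norm_bounded) simp
    finally show ?thesis using \<open>B \<ge> 0\<close> by (simp add: B_def)
  qed
  then show "\<xi> \<in> K"
    using \<xi> \<open>B \<ge> 0\<close> unfolding modK_iff modH_iff by (intro conjI exI[of _ "sqrt B"]) auto
qed

lemma coord_fib: "\<xi> \<in> K \<Longrightarrow> coord (fib t \<xi>) \<iota> = apply_bcontfun (\<xi> \<iota>) t"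
proof -
  assume "\<xi> \<in> K"
  then obtain C where "\<And>F t. finite F \<Longrightarrow> (\<Sum>\<iota>\<in>F. (norm (apply_bcontfun (\<xi> \<iota>) t))\<^sup>2) \<le> C\<^sup>2"
    unfolding modK_iff by blast
  then have "ev_at t \<xi> \<in> l2" unfolding l2_iff_bounded_sums ev_at_def by blast
  then show ?thesis by (simp add: fib_def of_coord_inverse) (simp add: ev_at_def)
qed

lemma coord_fib_fun: "\<xi> \<in> K \<Longrightarrow> coord (fib t \<xi>) = ev_at t \<xi>"
  by (rule ext) (simp add: coord_fib ev_at_def)

lemma modK_family_eqI:
  assumes "\<xi> \<in> K" "\<eta> \<in> K" "\<And>t. fib t \<xi> = fib t \<eta>"
  shows "\<xi> = \<eta>"
  by (intro ext bcontfun_eqI) (metis assms coord_fib)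

lemma fib_add: "\<xi> \<in> K \<Longrightarrow> \<eta> \<in> K \<Longrightarrow> fib t (\<xi> + \<eta>) = fib t \<xi> + fib t \<eta>"
  by (rule fib_eqI) (simp add: coord_fib)

lemma fib_diff: "\<xi> \<in> K \<Longrightarrow> \<eta> \<in> K \<Longrightarrow> fib t (\<xi> - \<eta>) = fib t \<xi> - fib t \<eta>"
  by (rule fib_eqI) (simp add: coord_fib)

lemma fib_mscale: "\<xi> \<in> K \<Longrightarrow> fib t (mscale \<xi> x) = ksc (apply_bcontfun x t) (fib t \<xi>)"
  by (rule fib_eqI) (simp add: coord_fib mscale_def mult.commute)

lemma fib_0 [simp]: "fib t 0 = 0"
  by (rule fib_eqI) simp

lemma norm_fib_le_iff:
  assumes "\<xi> \<in> K" "0 \<le> C"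
  shows "(\<forall>t. norm (fib t \<xi>) \<le> C) \<longleftrightarrow>
    (\<forall>F t. finite F \<longrightarrow> (\<Sum>\<iota>\<in>F. (norm (apply_bcontfun (\<xi> \<iota>) t))\<^sup>2) \<le> C\<^sup>2)"
proof (intro iffI allI impI)
  fix F :: "'i set" and t assume *: "\<forall>t. norm (fib t \<xi>) \<le> C" and "finite F"
  have "(\<Sum>\<iota>\<in>F. (norm (coord (fib t \<xi>) \<iota>))\<^sup>2) \<le> (norm (fib t \<xi>))\<^sup>2"
    by (rule finite_sum_le_has_sum[OF norm_ell2_has_sum]) (use \<open>finite F\<close> in auto)
  also have "\<dots> \<le> C\<^sup>2" using * by (intro power_mono) auto
  finally show "(\<Sum>\<iota>\<in>F. (norm (apply_bcontfun (\<xi> \<iota>) t))\<^sup>2) \<le> C\<^sup>2"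
    using assms(1) by (simp add: coord_fib)
next
  fix t assume *: "\<forall>F t. finite F \<longrightarrow> (\<Sum>\<iota>\<in>F. (norm (apply_bcontfun (\<xi> \<iota>) t))\<^sup>2) \<le> C\<^sup>2"
  show "norm (fib t \<xi>) \<le> C"
    unfolding fib_def by (rule coord_of_coord_bounded(2)) (use * assms(2) in \<open>auto simp: ev_at_def\<close>)
qed

lemma modK_norm_bounded: "\<xi> \<in> K \<Longrightarrow> \<exists>C\<ge>0. \<forall>t. norm (fib t \<xi>) \<le> C"
  using norm_fib_le_iff[of \<xi>] unfolding modK_iff by metis

lemma modK_I:
  assumes "\<And>\<iota>. P \<iota> * \<xi> \<iota> = \<xi> \<iota>" "0 \<le> C" "\<And>t. \<exists>x. (\<forall>\<iota>. apply_bcontfun (\<xi> \<iota>) t = coord x \<iota>) \<and> norm x \<le> C"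
  shows "\<xi> \<in> K"
  unfolding modK_iff
proof (intro conjI allI impI assms exI[of _ C])
  fix F :: "'i set" and t assume "finite F"
  obtain x where x: "\<And>\<iota>. apply_bcontfun (\<xi> \<iota>) t = coord x \<iota>" "norm x \<le> C" using assms(3) by blast
  have "(\<Sum>\<iota>\<in>F. (norm (coord x \<iota>))\<^sup>2) \<le> (norm x)\<^sup>2"
    by (rule finite_sum_le_has_sum[OF norm_ell2_has_sum]) (use \<open>finite F\<close> in auto)
  also have "\<dots> \<le> C\<^sup>2" using x by (intro power_mono) auto
  finally show "(\<Sum>\<iota>\<in>F. (norm (apply_bcontfun (\<xi> \<iota>) t))\<^sup>2) \<le> C\<^sup>2" by (simp add: x)
qed

lemma modK_add: "\<xi> \<in> K \<Longrightarrow> \<eta> \<in> K \<Longrightarrow> \<xi> + \<eta> \<in> K"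
proof -
  assume K: "\<xi> \<in> K" "\<eta> \<in> K"
  then obtain C D where CD: "C \<ge> 0" "\<And>t. norm (fib t \<xi>) \<le> C" "D \<ge> 0" "\<And>t. norm (fib t \<eta>) \<le> D"
    using modK_norm_bounded by metis
  show "\<xi> + \<eta> \<in> K"
  proof (rule modK_I)
    show "P \<iota> * (\<xi> + \<eta>) \<iota> = (\<xi> + \<eta>) \<iota>" for \<iota> using K by (simp add: modK_iff distrib_left)
    show "0 \<le> C + D" using CD by simp
    show "\<exists>x. (\<forall>\<iota>. apply_bcontfun ((\<xi> + \<eta>) \<iota>) t = coord x \<iota>) \<and> norm x \<le> C + D" for t
      using CD(2,4)[of t] K by (intro exI[of _ "fib t \<xi> + fib t \<eta>"]) (auto simp: coord_fib intro: norm_triangle_le)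
  qed
qed

lemma modK_mscale: "\<xi> \<in> K \<Longrightarrow> mscale \<xi> x \<in> K"
proof -
  assume K: "\<xi> \<in> K"
  then obtain C where C: "C \<ge> 0" "\<And>t. norm (fib t \<xi>) \<le> C"
    using modK_norm_bounded by metis
  show "mscale \<xi> x \<in> K"
  proof (rule modK_I)
    show "P \<iota> * mscale \<xi> x \<iota> = mscale \<xi> x \<iota>" for \<iota>
      using K by (simp add: modK_iff mscale_def mult.assoc[symmetric])
    show "0 \<le> norm x * C" using C by simp
    show "\<exists>y. (\<forall>\<iota>. apply_bcontfun (mscale \<xi> x \<iota>) t = coord y \<iota>) \<and> norm y \<le> norm x * C" for t
      using C(2)[of t] K
      by (intro exI[of _ "ksc (apply_bcontfun x t) (fib t \<xi>)"])
        (auto simp: coord_fib mscale_def mult.commute[of "apply_bcontfun x t"] intro!: mult_mono norm_bounded)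
  qed
qed

text \<open>On \<open>K\<close> the sum of squares converges only weak*. Its value is the least
  continuous function \<open>g\<close> above all finite sums, since normal functionals preserve
  suprema of directed sets. At a single point \<open>g\<close> may exceed the pointwise sum, so it
  is described by bounds: it dominates the finite sums and stays below every constant that
  does.\<close>

lemma minner_self:
  assumes \<xi>: "\<xi> \<in> K"
  shows "\<exists>g. (\<forall>t. apply_bcontfun (minner \<xi> \<xi>) t = of_real (g t)) \<and>
    (\<forall>F t. finite F \<longrightarrow> (\<Sum>\<iota>\<in>F. (norm (apply_bcontfun (\<xi> \<iota>) t))\<^sup>2) \<le> g t) \<and>
    (\<forall>C. (\<forall>F t. finite F \<longrightarrow> (\<Sum>\<iota>\<in>F. (norm (apply_bcontfun (\<xi> \<iota>) t))\<^sup>2) \<le> C) \<longrightarrow> (\<forall>t. g t \<le> C))"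
proof -
  let ?s = "\<lambda>F. \<Sum>\<iota>\<in>F. cstar (\<xi> \<iota>) * \<xi> \<iota>"
  let ?g = "\<lambda>F t. \<Sum>\<iota>\<in>F. (norm (apply_bcontfun (\<xi> \<iota>) t))\<^sup>2"
  \<comment> \<open>The supremum is taken over a whole type, so infinite index sets get the value 0
    of the empty sum.\<close>
  define u where "u = (\<lambda>F t. if finite F then ?g F t else 0)"
  obtain M where M: "\<And>F t. finite F \<Longrightarrow> ?g F t \<le> M\<^sup>2" using \<xi> unfolding modK_iff by blast
  have cont: "continuous_on UNIV (?g F)" for F
    by (intro continuous_intros continuous_on_apply_bcontfun)
  have ucont: "continuous_on UNIV (u F)" for F
    by (cases "finite F") (simp_all add: u_def cont)
  have ule: "u F t \<le> M\<^sup>2" for F t by (simp add: u_def M)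
  have u0: "0 \<le> u {} t" for t by (simp add: u_def)
  obtain g where gc: "continuous_on UNIV g" and gu: "\<And>F t. u F t \<le> g t"
    and gl: "\<And>h t. continuous_on UNIV h \<Longrightarrow> (\<And>F t. u F t \<le> h t) \<Longrightarrow> g t \<le> h t"
    using stonean_sup[of u "M\<^sup>2" "{}", OF hyperstonian ucont ule u0] by (elim exE conjE) (metis (no_types, lifting))
  define G :: "'t \<Rightarrow>\<^sub>C 'k" where "G = Bcontfun (\<lambda>t. of_real (g t))"
  have G: "apply_bcontfun G t = of_real (g t)" for t
    unfolding G_def by (rule apply_Bcontfun_T) (intro continuous_intros gc)
  have sup: "is_csup (?s ` {F. finite F}) G"
    unfolding is_csup_def
  proof (intro conjI ballI allI impI)
    fix f assume "f \<in> ?s ` {F. finite F}"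
    then obtain F where F: "finite F" "f = ?s F" by blast
    show "cle f G"
      unfolding cle_iff
    proof
      fix t
      have "apply_bcontfun G t - apply_bcontfun f t = of_real (g t - ?g F t)"
        unfolding F(2) G apply_sum_cstar by simp
      moreover have "?g F t \<le> g t" using gu[of F t] F(1) by (simp add: u_def)
      ultimately show "spos (apply_bcontfun G t - apply_bcontfun f t)" by (simp only: spos_of_real)
    qed
  next
    fix h assume h: "\<forall>f\<in>?s ` {F. finite F}. cle f h"
    have h': "cle (?s F) h" if "finite F" for F using h that by blast
    have h0: "apply_bcontfun h t = of_real (kre (apply_bcontfun h t))" for t
      using h'[of "{}"] by (intro cposD(2)) (simp add: cle_def)
    have "g t \<le> kre (apply_bcontfun h t)" for t
    proof (rule gl)
      show "continuous_on UNIV (\<lambda>t. kre (apply_bcontfun h t))"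
        by (intro continuous_intros continuous_on_apply_bcontfun)
      show "u F t \<le> kre (apply_bcontfun h t)" for F t
      proof (cases "finite F")
        case True
        then show ?thesis
          using cle_kre[OF h'[OF True], of t] unfolding apply_sum_cstar kre_of_real by (simp add: u_def)
      next
        case False
        then show ?thesis using cle_kre[OF h'[of "{}"], of t] by (simp add: u_def)
      qed
    qed
    then show "cle G h"
      unfolding cle_iff G by (subst h0) (simp del: of_real_diff add: of_real_diff[symmetric])
  qed
  have pos: "cpos (?s F)" for F unfolding cpos_def apply_sum_cstar spos_of_real by (simp add: sum_nonneg)
  have "weak_star_has_sum (\<lambda>\<iota>. cstar (\<xi> \<iota>) * \<xi> \<iota>) G"
    unfolding weak_star_has_sum_def
  proof (intro allI impI)
    fix \<phi> :: "('t \<Rightarrow>\<^sub>C 'k) \<Rightarrow> 'k" assume \<phi>: "pos_normal \<phi>"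
    let ?a = "\<lambda>\<iota>. norm (\<phi> (cstar (\<xi> \<iota>) * \<xi> \<iota>))"
    have sposi: "\<phi> (cstar (\<xi> \<iota>) * \<xi> \<iota>) = of_real (?a \<iota>)" for \<iota>
      using pos_normalD(3)[OF \<phi> pos[of "{\<iota>}"]] by (simp add: spos_def)
    have sumn: "norm (\<phi> (?s F)) = sum ?a F" for F
    proof -
      have "\<phi> (?s F) = of_real (sum ?a F)"
        unfolding pos_normal_linear(4)[OF \<phi>] of_real_sum by (rule sum.cong[OF refl sposi])
      then show ?thesis by (simp only: norm_of_real) (simp add: sum_nonneg)
    qed
    \<comment> \<open>Normality enters here: the finite sums are upward directed with supremum
      \<open>G\<close>. For non-negative numbers the supremum of the finite sums is the sum.\<close>
    have "norm (\<phi> G) = (SUP f\<in>?s ` {F. finite F}. norm (\<phi> f))"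
    proof (rule pos_normal_sup[OF \<phi> _ _ _ sup])
      show "?s ` {F. finite F} \<noteq> {}" by blast
      show "cpos f" if "f \<in> ?s ` {F. finite F}" for f using that pos by blast
      fix f f' assume "f \<in> ?s ` {F. finite F}" "f' \<in> ?s ` {F. finite F}"
      then obtain F F' where F: "finite F" "f = ?s F" "finite F'" "f' = ?s F'" by blast
      have le: "cle (?s F) (?s F')" if "F \<subseteq> F'" "finite F'" for F F'
        unfolding cle_iff
      proof
        fix t
        have "?g F t \<le> ?g F' t" by (rule sum_mono2) (use that in auto)
        then show "spos (apply_bcontfun (?s F') t - apply_bcontfun (?s F) t)"
          unfolding apply_sum_cstar of_real_diff[symmetric] spos_of_real by simp
      qed
      show "\<exists>h\<in>?s ` {F. finite F}. cle f h \<and> cle f' h"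
        using F by (intro bexI[of _ "?s (F \<union> F')"]) (auto intro!: le)
    qed
    then have S: "norm (\<phi> G) = (SUP F\<in>{F. finite F \<and> F \<subseteq> UNIV}. sum ?a F)"
      by (simp add: image_image sumn)
    have "(?a has_sum (SUP F\<in>{F. finite F \<and> F \<subseteq> UNIV}. sum ?a F)) UNIV"
    proof (rule nonneg_bdd_above_has_sum)
      have "sum ?a F \<le> norm (\<phi> G)" if "finite F" for F
      proof -
        have "spos (\<phi> (G - ?s F))" "spos (\<phi> (?s F))"
          using sup that pos_normalD(3)[OF \<phi>] pos by (auto simp: is_csup_def cle_def)
        moreover have "\<phi> G = \<phi> (?s F) + \<phi> (G - ?s F)"
          using pos_normalD(1)[OF \<phi>, of "?s F" "G - ?s F"] by simp
        ultimately have "norm (\<phi> (?s F)) \<le> norm (\<phi> G)"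
          unfolding spos_iff_ex by (auto simp flip: of_real_add)
        then show ?thesis by (simp only: sumn)
      qed
      then show "bdd_above (sum ?a ` {F. F \<subseteq> UNIV \<and> finite F})" by (intro bdd_aboveI2[where M="norm (\<phi> G)"]) auto
    qed simp
    then have "(?a has_sum norm (\<phi> G)) UNIV" by (simp only: S)
    then have "((\<lambda>\<iota>. of_real (?a \<iota>) :: 'k) has_sum of_real (norm (\<phi> G))) UNIV"
      by (rule has_sum_bounded_linear[OF bounded_linear_of_real])
    moreover have "of_real (norm (\<phi> G)) = \<phi> G"
    proof -
      have "cpos G"
        unfolding cpos_def G spos_of_real using gu[of "{}"] by (simp add: u_def)
      then show ?thesis using pos_normalD(3)[OF \<phi>] by (simp add: spos_def)
    qed
    ultimately show "((\<lambda>\<iota>. \<phi> (cstar (\<xi> \<iota>) * \<xi> \<iota>)) has_sum \<phi> G) UNIV"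
      by (simp only: sposi[symmetric])
  qed
  then have mG: "minner \<xi> \<xi> = G"
    unfolding minner_def using weak_star_sum_unique[OF hyperstonian] by (intro the_equality) auto
  show ?thesis
  proof (intro exI[of _ g] conjI allI impI)
    show "apply_bcontfun (minner \<xi> \<xi>) t = of_real (g t)" for t by (simp add: mG G)
    show "?g F t \<le> g t" if "finite F" for F t using gu[of F t] that by (simp add: u_def)
    fix C t assume C: "\<forall>F t. finite F \<longrightarrow> ?g F t \<le> C"
    show "g t \<le> C"
    proof (rule gl[of "\<lambda>_. C"])
      have "0 \<le> C" using C[rule_format, of "{}"] by simp
      then show "u F t \<le> C" for F t using C by (simp add: u_def)
    qed (rule continuous_on_const)
  qed
qed

text \<open>Although \<open>minner \<xi> \<xi>\<close> need not equal the squared fibre norm at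
  every point, both have the same constant upper bounds, so the module norm is the supremum of the
  fibre norms.\<close>

lemma mnorm_le_iff:
  assumes \<xi>: "\<xi> \<in> K" and C: "0 \<le> C"
  shows "mnorm \<xi> \<le> C \<longleftrightarrow> (\<forall>t. norm (fib t \<xi>) \<le> C)"
  unfolding norm_fib_le_iff[OF assms]
proof -
  obtain g where g: "\<forall>t. apply_bcontfun (minner \<xi> \<xi>) t = of_real (g t)"
    "\<forall>F t. finite F \<longrightarrow> (\<Sum>\<iota>\<in>F. (norm (apply_bcontfun (\<xi> \<iota>) t))\<^sup>2) \<le> g t"
    "\<forall>C. (\<forall>F t. finite F \<longrightarrow> (\<Sum>\<iota>\<in>F. (norm (apply_bcontfun (\<xi> \<iota>) t))\<^sup>2) \<le> C) \<longrightarrow> (\<forall>t. g t \<le> C)"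
    using minner_self[OF \<xi>] by blast
  have g0: "0 \<le> g t" for t using g(2)[rule_format, of "{}" t] by simp
  have "mnorm \<xi> \<le> C \<longleftrightarrow> norm (minner \<xi> \<xi>) \<le> C\<^sup>2"
    unfolding mnorm_def using C real_sqrt_le_iff[of "norm (minner \<xi> \<xi>)" "C\<^sup>2"] by simp
  also have "\<dots> \<longleftrightarrow> (\<forall>t. g t \<le> C\<^sup>2)"
  proof
    assume "norm (minner \<xi> \<xi>) \<le> C\<^sup>2"
    then show "\<forall>t. g t \<le> C\<^sup>2"
      using norm_bounded[of "minner \<xi> \<xi>"] g0 by (auto simp: g(1) intro: order_trans)
  next
    assume "\<forall>t. g t \<le> C\<^sup>2"
    then show "norm (minner \<xi> \<xi>) \<le> C\<^sup>2" by (intro norm_bound) (simp add: g(1) g0)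
  qed
  also have "\<dots> \<longleftrightarrow> (\<forall>F t. finite F \<longrightarrow> (\<Sum>\<iota>\<in>F. (norm (apply_bcontfun (\<xi> \<iota>) t))\<^sup>2) \<le> C\<^sup>2)"
    using g(2,3) by (meson order_trans)
  finally show "mnorm \<xi> \<le> C \<longleftrightarrow> (\<forall>F t. finite F \<longrightarrow> (\<Sum>\<iota>\<in>F. (norm (apply_bcontfun (\<xi> \<iota>) t))\<^sup>2) \<le> C\<^sup>2)" .
qed

lemma mnorm_nonneg [simp]: "0 \<le> mnorm \<xi>"
  by (simp add: mnorm_def)

lemma norm_fib_le_mnorm: "\<xi> \<in> K \<Longrightarrow> norm (fib t \<xi>) \<le> mnorm \<xi>"
  using mnorm_le_iff[of \<xi> "mnorm \<xi>"] by simp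

text \<open>The tails of \<open>\<eta>\<close> are uniformly small, so the Cauchy-Schwarz inequality
  makes the series converge in norm, and evaluation at \<open>t\<close> passes through the
  sum.\<close>

lemma minner_apply:
  assumes \<zeta>: "\<zeta> \<in> K" and \<eta>: "\<eta> \<in> H"
  shows "apply_bcontfun (minner \<zeta> \<eta>) t = kinner (fib t \<zeta>) (fib t \<eta>)"
proof -
  let ?f = "\<lambda>\<iota>. cstar (\<eta> \<iota>) * \<zeta> \<iota>"
  let ?n = "\<lambda>\<iota> t. (norm (apply_bcontfun (\<eta> \<iota>) t))\<^sup>2"
  have \<eta>K: "\<eta> \<in> K" by (rule modH_subset_modK[OF \<eta>])
  obtain C where C: "C \<ge> 0" "\<And>F t. finite F \<Longrightarrow> (\<Sum>\<iota>\<in>F. (norm (apply_bcontfun (\<zeta> \<iota>) t))\<^sup>2) \<le> C\<^sup>2"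
    using \<zeta> unfolding modK_iff by blast
  have "?f summable_on UNIV"
    unfolding summable_on_iff_Cauchy
  proof (intro allI impI)
    fix \<epsilon> :: real assume "\<epsilon> > 0"
    \<comment> \<open>\<open>C + 1\<close> keeps the denominator positive, and the factor 2 leaves
      room for the strict inequality.\<close>
    define \<delta> where "\<delta> = \<epsilon> / (2 * (C + 1))"
    have "\<delta> > 0" using \<open>\<epsilon> > 0\<close> C by (simp add: \<delta>_def)
    then have "\<delta>\<^sup>2 > 0" by simp
    have *: "\<forall>\<epsilon>>0. \<exists>F0. finite F0 \<and> (\<forall>F t. finite F \<and> F \<inter> F0 = {} \<longrightarrow> (\<Sum>\<iota>\<in>F. ?n \<iota> t) \<le> \<epsilon>)"
      using \<eta> unfolding modH_iff by (elim conjE)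
    obtain F0 where F0: "finite F0" "\<forall>F t. finite F \<and> F \<inter> F0 = {} \<longrightarrow> (\<Sum>\<iota>\<in>F. ?n \<iota> t) \<le> \<delta>\<^sup>2"
      using *[rule_format, OF \<open>\<delta>\<^sup>2 > 0\<close>] by auto
    have "norm (sum ?f F) < \<epsilon>" if F: "finite F \<and> F \<inter> F0 = {}" for F
    proof -
      have "norm (sum ?f F) \<le> \<delta> * C"
      proof (rule norm_bound)
        fix t
        let ?a = "\<lambda>\<iota>. norm (apply_bcontfun (\<eta> \<iota>) t)" and ?b = "\<lambda>\<iota>. norm (apply_bcontfun (\<zeta> \<iota>) t)"
        have "norm (apply_bcontfun (sum ?f F) t) \<le> (\<Sum>\<iota>\<in>F. \<bar>?a \<iota>\<bar> * \<bar>?b \<iota>\<bar>)"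
          by (simp add: sum_norm_le norm_mult)
        also have "\<dots> \<le> L2_set ?a F * L2_set ?b F" by (rule L2_set_mult_ineq)
        also have "\<dots> \<le> \<delta> * C"
        proof (rule mult_mono)
          show "L2_set ?a F \<le> \<delta>" unfolding L2_set_def
            using F0(2) F \<open>\<delta> > 0\<close> by (intro real_le_lsqrt) auto
          show "L2_set ?b F \<le> C" unfolding L2_set_def
            using C F by (intro real_le_lsqrt) auto
        qed (use \<open>\<delta> > 0\<close> in auto)
        finally show "norm (apply_bcontfun (sum ?f F) t) \<le> \<delta> * C" .
      qed
      also have "\<dots> < \<epsilon>"
      proof -
        have "\<delta> * C \<le> \<delta> * (C + 1)" using \<open>\<delta> > 0\<close> by simp
        also have "\<dots> = \<epsilon> / 2" using C(1) by (simp add: \<delta>_def field_simps)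
        finally show ?thesis using \<open>\<epsilon> > 0\<close> by simp
      qed
      finally show ?thesis .
    qed
    with F0(1) show "\<exists>F0. finite F0 \<and> (\<forall>F. finite F \<and> F \<inter> F0 = {} \<longrightarrow> norm (sum ?f F) < \<epsilon>)"
      by (intro exI[of _ F0]) simp
  qed
  then obtain x where x: "(?f has_sum x) UNIV" by (auto simp: summable_on_def)
  have "minner \<zeta> \<eta> = x"
    unfolding minner_def
    using has_sum_imp_weak_star_has_sum[OF x] weak_star_sum_unique[OF hyperstonian] by (intro the_equality) auto
  moreover have "((\<lambda>\<iota>. coord (fib t \<zeta>) \<iota> * kconj (coord (fib t \<eta>) \<iota>)) has_sum apply_bcontfun x t) UNIV"
    using has_sum_bounded_linear[OF bounded_linear_apply_bcontfun x, of t]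
    by (simp add: coord_fib \<zeta> \<eta>K mult.commute)
  ultimately show ?thesis using kinner_eqI by metis
qed

lemma P_fib: "\<xi> \<in> K \<Longrightarrow> apply_bcontfun (P \<iota>) t * coord (fib t \<xi>) \<iota> = coord (fib t \<xi>) \<iota>"
  by (simp add: coord_fib P_absorb)

section \<open>Constant sections and continuity of sections\<close>

lemma psi_apply: "apply_bcontfun (psi P \<zeta> \<iota>) t = \<zeta> \<iota> * apply_bcontfun (P \<iota>) t"
  by (simp add: psi_def)

lemma psi_in_modH: "psi P (coord x) \<in> H"
  unfolding modH_iff
proof (intro conjI allI impI)
  show "P \<iota> * psi P (coord x) \<iota> = psi P (coord x) \<iota>" for \<iota>
    by (simp only: psi_def mult.left_commute[of "P \<iota>" "const_bcontfun _"] P_mult)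
  fix \<epsilon> :: real assume "\<epsilon> > 0"
  have "(\<lambda>\<iota>. (norm (coord x \<iota>))\<^sup>2) summable_on UNIV"
    using norm_ell2_has_sum summable_on_def by blast
  then obtain F0 where F0: "finite F0" "\<forall>F. finite F \<and> F \<inter> F0 = {} \<longrightarrow> norm (\<Sum>\<iota>\<in>F. (norm (coord x \<iota>))\<^sup>2) < \<epsilon>"
    using \<open>\<epsilon> > 0\<close> unfolding summable_on_iff_Cauchy by blast
  have "(\<Sum>\<iota>\<in>F. (norm (apply_bcontfun (psi P (coord x) \<iota>) t))\<^sup>2) \<le> \<epsilon>"
    if F: "finite F \<and> F \<inter> F0 = {}" for F t
  proof -
    have "(\<Sum>\<iota>\<in>F. (norm (apply_bcontfun (psi P (coord x) \<iota>) t))\<^sup>2) \<le> (\<Sum>\<iota>\<in>F. (norm (coord x \<iota>))\<^sup>2)"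
      by (intro sum_mono power_mono)
        (use P_norm_le in \<open>auto simp: psi_apply norm_mult mult_left_le\<close>)
    also have "\<dots> \<le> \<epsilon>" using F0(2)[rule_format, OF F] by (simp add: sum_nonneg)
    finally show ?thesis .
  qed
  with F0(1) show "\<exists>F0. finite F0 \<and> (\<forall>F t. finite F \<and> F \<inter> F0 = {} \<longrightarrow>
      (\<Sum>\<iota>\<in>F. (norm (apply_bcontfun (psi P (coord x) \<iota>) t))\<^sup>2) \<le> \<epsilon>)"
    by (intro exI[of _ F0]) simp
qed

lemma psi_in_modK: "psi P (coord x) \<in> K"
  by (rule modH_subset_modK[OF psi_in_modH])

lemma coord_fib_psi: "coord (fib t (psi P (coord x))) \<iota> = coord x \<iota> * apply_bcontfun (P \<iota>) t"
  by (simp add: coord_fib[OF psi_in_modK] psi_apply)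

text \<open>The coordinates suppressed by \<open>psi\<close> are those whose projection vanishes at
  \<open>t\<close>, and there the other factor vanishes as well.\<close>

lemma kinner_fib_psi:
  assumes "\<xi> \<in> K"
  shows "kinner (fib t (psi P (coord x))) (fib t \<xi>) = kinner x (fib t \<xi>)"
proof -
  have "coord x \<iota> * apply_bcontfun (P \<iota>) t * kconj (coord (fib t \<xi>) \<iota>) = coord x \<iota> * kconj (coord (fib t \<xi>) \<iota>)" for \<iota>
    using arg_cong[OF P_fib[OF assms, of \<iota> t], of kconj] by (simp add: kconj_mult P_apply_kconj mult.assoc)
  then show ?thesis by (simp only: kinner_def coord_fib_psi)
qed

lemma kinner_fib_psi': "\<xi> \<in> K \<Longrightarrow> kinner (fib t \<xi>) (fib t (psi P (coord x))) = kinner (fib t \<xi>) x"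
  using kinner_fib_psi[of \<xi> t x] by (metis kinner_commute)

lemma norm_fib_psi_le: "norm (fib t (psi P (coord x))) \<le> norm x"
proof -
  let ?y = "fib t (psi P (coord x))"
  have "(norm ?y)\<^sup>2 = norm (kinner ?y ?y)" by (simp only: kinner_self norm_of_real) simp
  also have "\<dots> = norm (kinner x ?y)" by (simp add: kinner_fib_psi[OF psi_in_modK])
  also have "\<dots> \<le> norm x * norm ?y" by (rule kinner_cauchy_schwarz)
  finally have "norm ?y * norm ?y \<le> norm x * norm ?y" by (simp add: power2_eq_square)
  then show ?thesis using mult_right_le_imp_le[of "norm ?y"] by (cases "norm ?y = 0") auto
qed

lemma mnorm_psi_le: "mnorm (psi P (coord x)) \<le> norm x"
  by (subst mnorm_le_iff[OF psi_in_modK]) (auto simp: norm_fib_psi_le)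

text \<open>Through every value of a member of \<open>K\<close> there passes a section that lies in
  \<open>H\<close>; pointwise claims at \<open>t\<close> are reduced to it.\<close>

lemma fib_psi_self: "\<xi> \<in> K \<Longrightarrow> fib t (psi P (coord (fib t \<xi>))) = fib t \<xi>"
  by (rule ell2_eqI) (simp add: coord_fib_psi mult.commute[of "coord _ _"] P_fib)

text \<open>With the section \<open>?z\<close> through the value at \<open>t\<close>, the squared
  distance of the values at \<open>s\<close> and \<open>t\<close> expands into inner products of
  elements of \<open>H\<close>. As elements of \<open>E\<close> these are continuous in
  \<open>s\<close>.\<close>

lemma fib_continuous:
  assumes "\<xi> \<in> H"
  shows "continuous_on UNIV (\<lambda>t. fib t \<xi>)"
  unfolding continuous_on_def
proof
  fix t
  have \<xi>: "\<xi> \<in> K" by (rule modH_subset_modK[OF assms])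
  let ?z = "psi P (coord (fib t \<xi>))"
  let ?h = "\<lambda>s. kre (apply_bcontfun (minner \<xi> \<xi>) s) + (norm (fib t \<xi>))\<^sup>2 - 2 * kre (apply_bcontfun (minner \<xi> ?z) s)"
  have h: "(norm (fib s \<xi> - fib t \<xi>))\<^sup>2 = ?h s" for s
  proof -
    have "(norm (fib s \<xi> - fib t \<xi>))\<^sup>2 = (norm (fib s \<xi>))\<^sup>2 + (norm (fib t \<xi>))\<^sup>2 - 2 * kre (kinner (fib s \<xi>) (fib t \<xi>))"
      unfolding power2_norm_eq_inner inner_ell2_def[symmetric] by (simp add: inner_diff inner_commute)
    moreover have "apply_bcontfun (minner \<xi> ?z) s = kinner (fib s \<xi>) (fib t \<xi>)"
      by (simp add: minner_apply[OF \<xi> psi_in_modH] kinner_fib_psi'[OF \<xi>])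
    moreover have "kre (apply_bcontfun (minner \<xi> \<xi>) s) = (norm (fib s \<xi>))\<^sup>2"
      unfolding minner_apply[OF \<xi> assms] kinner_self kre_of_real ..
    ultimately show ?thesis by simp
  qed
  have "continuous_on UNIV ?h" by (intro continuous_intros continuous_on_apply_bcontfun)
  then have "(?h \<longlongrightarrow> ?h t) (at t)" unfolding continuous_on_def by blast
  then have "((\<lambda>s. (norm (fib s \<xi> - fib t \<xi>))\<^sup>2) \<longlongrightarrow> 0) (at t)" unfolding h[symmetric] by simp
  then have "((\<lambda>s. sqrt ((norm (fib s \<xi> - fib t \<xi>))\<^sup>2)) \<longlongrightarrow> sqrt 0) (at t)" by (rule tendsto_real_sqrt)
  then have "((\<lambda>s. norm (fib s \<xi> - fib t \<xi>)) \<longlongrightarrow> 0) (at t)"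
    by (simp only: real_sqrt_abs abs_norm_cancel real_sqrt_zero)
  then show "((\<lambda>s. fib s \<xi>) \<longlongrightarrow> fib t \<xi>) (at t within UNIV)"
    by (rule LIM_zero_cancel[OF tendsto_norm_zero_cancel])
qed

text \<open>Dini's theorem: a continuous section has uniformly small tails.\<close>

lemma section_in_modH:
  assumes X: "continuous_on UNIV X" and PX: "\<And>\<iota> t. apply_bcontfun (P \<iota>) t * coord (X t) \<iota> = coord (X t) \<iota>"
  defines "\<xi> \<equiv> \<lambda>\<iota>. Bcontfun (\<lambda>t. coord (X t) \<iota>)"
  shows "\<xi> \<in> H" "fib t \<xi> = X t"
proof -
  have \<xi>: "apply_bcontfun (\<xi> \<iota>) t = coord (X t) \<iota>" for \<iota> t
    unfolding \<xi>_def by (rule apply_Bcontfun_T) (rule bounded_linear.continuous_on[OF bounded_linear_coord X])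
  show "fib t \<xi> = X t" by (rule fib_eqI) (simp add: \<xi>)
  show "\<xi> \<in> H"
    unfolding modH_iff
  proof (intro conjI allI impI)
    show "P \<iota> * \<xi> \<iota> = \<xi> \<iota>" for \<iota> by (rule bcontfun_eqI) (simp add: \<xi> PX)
    fix \<epsilon> :: real assume "\<epsilon> > 0"
    \<comment> \<open>The tail outside \<open>F\<close>, continuous in \<open>t\<close> because
      finitely many coordinates are subtracted from the squared norm; compactness selects finitely
      many \<open>F\<close>.\<close>
    define r where "r = (\<lambda>F t. (norm (X t))\<^sup>2 - (\<Sum>\<iota>\<in>F. (norm (coord (X t) \<iota>))\<^sup>2))"
    have r: "continuous_on UNIV (r F)" for F
      unfolding r_def by (intro continuous_intros X bounded_linear.continuous_on[OF bounded_linear_coord])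
    have "\<exists>F. finite F \<and> t \<in> {t. r F t < \<epsilon>}" for t
    proof -
      have "((\<lambda>F. \<Sum>\<iota>\<in>F. (norm (coord (X t) \<iota>))\<^sup>2) \<longlongrightarrow> (norm (X t))\<^sup>2) (finite_subsets_at_top UNIV)"
        using norm_ell2_has_sum[of "X t"] by (simp add: has_sum_def)
      from tendstoD[OF this \<open>\<epsilon> > 0\<close>]
      obtain F where "finite F" "dist (\<Sum>\<iota>\<in>F. (norm (coord (X t) \<iota>))\<^sup>2) ((norm (X t))\<^sup>2) < \<epsilon>"
        unfolding eventually_finite_subsets_at_top by blast
      then show ?thesis by (intro exI[of _ F]) (auto simp: r_def dist_real_def)
    qed
    then have cover: "UNIV \<subseteq> (\<Union>F\<in>{F. finite F}. {t. r F t < \<epsilon>})" by blast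
    have op: "open {t. r F t < \<epsilon>}" for F by (intro open_Collect_less r continuous_on_const)
    obtain \<F> where \<F>: "\<F> \<subseteq> {F. finite F}" "finite \<F>" "UNIV \<subseteq> (\<Union>F\<in>\<F>. {t. r F t < \<epsilon>})"
      by (rule compactE_image[OF compact_T op cover])
    let ?F0 = "\<Union>\<F>"
    have fin: "finite ?F0" using \<F>(1,2) by auto
    have "(\<Sum>\<iota>\<in>F. (norm (apply_bcontfun (\<xi> \<iota>) t))\<^sup>2) \<le> \<epsilon>" if F: "finite F \<and> F \<inter> ?F0 = {}" for F t
    proof -
      obtain F1 where F1: "F1 \<in> \<F>" "r F1 t < \<epsilon>" using \<F>(3) by blast
      then have fin1: "finite F1" and disj: "F \<inter> F1 = {}" using \<F>(1) F by auto
      have "(\<Sum>\<iota>\<in>F \<union> F1. (norm (coord (X t) \<iota>))\<^sup>2) \<le> (norm (X t))\<^sup>2"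
        by (rule finite_sum_le_has_sum[OF norm_ell2_has_sum]) (use F fin1 in auto)
      then have "(\<Sum>\<iota>\<in>F. (norm (coord (X t) \<iota>))\<^sup>2) \<le> r F1 t"
        using F fin1 disj by (simp add: sum.union_disjoint r_def)
      with F1(2) show ?thesis by (simp add: \<xi>)
    qed
    with fin show "\<exists>F0. finite F0 \<and> (\<forall>F t. finite F \<and> F \<inter> F0 = {} \<longrightarrow>
        (\<Sum>\<iota>\<in>F. (norm (apply_bcontfun (\<xi> \<iota>) t))\<^sup>2) \<le> \<epsilon>)"
      by (intro exI[of _ ?F0]) simp
  qed
qed

text \<open>With \<open>fib_continuous\<close>, \<open>H\<close> consists of exactly the members of
  \<open>K\<close> whose section is norm continuous, which reduces closure properties of
  \<open>H\<close> to continuity.\<close>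

lemma modH_I:
  assumes "\<xi> \<in> K" "continuous_on UNIV (\<lambda>t. fib t \<xi>)"
  shows "\<xi> \<in> H"
proof -
  let ?\<eta> = "\<lambda>\<iota>. Bcontfun (\<lambda>t. coord (fib t \<xi>) \<iota>)"
  have H: "?\<eta> \<in> H" "\<And>t. fib t ?\<eta> = fib t \<xi>"
    using section_in_modH[OF assms(2) P_fib[OF assms(1)]] by auto
  then have "?\<eta> = \<xi>" using modK_family_eqI[OF modH_subset_modK[OF H(1)] assms(1)] by simp
  then show ?thesis using H(1) by simp
qed

lemma modH_add: "\<xi> \<in> H \<Longrightarrow> \<eta> \<in> H \<Longrightarrow> \<xi> + \<eta> \<in> H"
  by (rule modH_I) (auto simp: modK_add modH_subset_modK fib_add intro!: continuous_intros fib_continuous)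

lemma modH_mscale: "\<xi> \<in> H \<Longrightarrow> mscale \<xi> x \<in> H"
  by (rule modH_I)
    (auto simp: modK_mscale modH_subset_modK fib_mscale intro!: continuous_intros fib_continuous continuous_on_apply_bcontfun)

lemma modH_0: "0 \<in> H"
proof -
  have "psi P (coord 0) = (0 :: ('i, 't, 'k) family)" by (rule ext) (simp add: psi_def)
  then show ?thesis using psi_in_modH[of 0] by simp
qed

section \<open>Adjointable operators as fields of operators\<close>

lemma adjointableD:
  assumes "u \<in> adjointable_ops H"
  shows "\<zeta> \<in> H \<Longrightarrow> u \<zeta> \<in> H" "\<zeta> \<notin> H \<Longrightarrow> u \<zeta> = 0" "\<zeta> \<in> H \<Longrightarrow> \<omega> \<in> H \<Longrightarrow> u (\<zeta> + \<omega>) = u \<zeta> + u \<omega>"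
    "\<zeta> \<in> H \<Longrightarrow> u (mscale \<zeta> x) = mscale (u \<zeta>) x" "\<exists>C. \<forall>\<zeta>\<in>H. mnorm (u \<zeta>) \<le> C * mnorm \<zeta>"
    "\<exists>v. (\<forall>\<omega>\<in>H. v \<omega> \<in> H) \<and> (\<forall>\<zeta>\<in>H. \<forall>\<omega>\<in>H. minner (u \<zeta>) \<omega> = minner \<zeta> (v \<omega>))"
  using assms unfolding adjointable_ops_def mem_Collect_eq by blast+

definition Phi :: "('i, 't, 'k) oper \<Rightarrow> 't \<Rightarrow> ('i, 'k) ell2 \<Rightarrow>\<^sub>L ('i, 'k) ell2" where
  "Phi u t = Blinfun (\<lambda>x. fib t (u (psi P (coord x))))"

lemma psi_add: "psi P (coord (x + y)) = psi P (coord x) + psi P (coord y)"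
  by (intro ext bcontfun_eqI) (simp add: psi_apply distrib_right)

lemma psi_ksc: "psi P (coord (ksc c x)) = mscale (psi P (coord x)) (const_bcontfun c)"
  by (intro ext bcontfun_eqI) (simp add: psi_apply mscale_def mult_ac)

lemma Phi_apply:
  assumes u: "u \<in> adjointable_ops H"
  shows "blinfun_apply (Phi u t) x = fib t (u (psi P (coord x)))"
proof -
  obtain C where C: "\<And>\<zeta>. \<zeta> \<in> H \<Longrightarrow> mnorm (u \<zeta>) \<le> C * mnorm \<zeta>" using adjointableD(5)[OF u] by blast
  have "bounded_linear (\<lambda>x. fib t (u (psi P (coord x))))"
  proof (rule bounded_linear_intro)
    show "fib t (u (psi P (coord (x + y)))) = fib t (u (psi P (coord x))) + fib t (u (psi P (coord y)))" for x y
      by (simp only: psi_add adjointableD(3)[OF u psi_in_modH psi_in_modH]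
          fib_add[OF modH_subset_modK modH_subset_modK] adjointableD(1)[OF u psi_in_modH])
    show "fib t (u (psi P (coord (r *\<^sub>R x)))) = r *\<^sub>R fib t (u (psi P (coord x)))" for r x
      unfolding scaleR_ksc psi_ksc adjointableD(4)[OF u psi_in_modH]
      by (simp add: fib_mscale modH_subset_modK adjointableD(1)[OF u psi_in_modH])
    show "norm (fib t (u (psi P (coord x)))) \<le> norm x * \<bar>C\<bar>" for x
    proof -
      have "norm (fib t (u (psi P (coord x)))) \<le> mnorm (u (psi P (coord x)))"
        by (intro norm_fib_le_mnorm modH_subset_modK adjointableD(1)[OF u psi_in_modH])
      also have "\<dots> \<le> C * mnorm (psi P (coord x))" by (rule C[OF psi_in_modH])
      also have "\<dots> \<le> \<bar>C\<bar> * norm x" by (intro mult_mono mnorm_psi_le) auto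
      finally show ?thesis by (simp add: mult.commute)
    qed
  qed
  then show ?thesis by (simp add: Phi_def bounded_linear_Blinfun_apply)
qed

text \<open>\<open>\<xi>\<close> differs from the constant section through its value at
  \<open>t\<close> by some \<open>\<delta>\<close> that vanishes at \<open>t\<close>. Moving
  \<open>u\<close> to the other side of the inner product with its adjoint shows that
  \<open>u \<delta>\<close> vanishes at \<open>t\<close> too, so only the value of
  \<open>\<xi>\<close> at \<open>t\<close> matters.\<close>

lemma fib_op:
  assumes u: "u \<in> adjointable_ops H" and \<xi>: "\<xi> \<in> H"
  shows "fib t (u \<xi>) = blinfun_apply (Phi u t) (fib t \<xi>)"
proof -
  let ?\<zeta> = "psi P (coord (fib t \<xi>))"
  define \<delta> where "\<delta> = \<xi> + mscale ?\<zeta> (const_bcontfun (- 1))"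
  have \<delta>H: "\<delta> \<in> H" unfolding \<delta>_def by (intro modH_add modH_mscale \<xi> psi_in_modH)
  have \<xi>eq: "\<xi> = \<delta> + ?\<zeta>" by (intro ext bcontfun_eqI) (simp add: \<delta>_def mscale_def)
  have "fib t \<delta> = 0"
    unfolding \<delta>_def
    by (simp add: fib_add fib_mscale modK_mscale psi_in_modK modH_subset_modK[OF \<xi>] fib_psi_self)
      (rule ell2_eqI, simp)
  moreover obtain v where v: "\<And>\<omega>. \<omega> \<in> H \<Longrightarrow> v \<omega> \<in> H" "\<And>\<zeta> \<omega>. \<zeta> \<in> H \<Longrightarrow> \<omega> \<in> H \<Longrightarrow> minner (u \<zeta>) \<omega> = minner \<zeta> (v \<omega>)"
    using adjointableD(6)[OF u] by blast
  have u\<delta>: "u \<delta> \<in> H" by (rule adjointableD(1)[OF u \<delta>H])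
  have "kinner (fib t (u \<delta>)) (fib t (u \<delta>)) = kinner (fib t \<delta>) (fib t (v (u \<delta>)))"
    using arg_cong[OF v(2)[OF \<delta>H u\<delta>], of "\<lambda>f. apply_bcontfun f t"]
    by (simp add: minner_apply modH_subset_modK u\<delta> \<delta>H v(1))
  ultimately have "fib t (u \<delta>) = 0" by (simp add: kinner_self)
  moreover have "u \<xi> = u \<delta> + u ?\<zeta>" by (subst \<xi>eq) (rule adjointableD(3)[OF u \<delta>H psi_in_modH])
  ultimately show ?thesis
    by (simp add: Phi_apply[OF u] fib_add modH_subset_modK u\<delta> adjointableD(1)[OF u psi_in_modH])
qed

lemma phi_eq_raw_op:
  assumes u: "u \<in> adjointable_ops H"
  shows "phi P t u = raw_op (Phi u t)"
proof (rule ext)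
  fix \<zeta>
  show "phi P t u \<zeta> = raw_op (Phi u t) \<zeta>"
  proof (cases "\<zeta> \<in> l2")
    case True
    then have "coord (of_coord \<zeta>) = \<zeta>" by (rule of_coord_inverse)
    then show ?thesis
      using coord_fib_fun[OF modH_subset_modK[OF adjointableD(1)[OF u psi_in_modH[of "of_coord \<zeta>"]]]] True
      by (simp add: phi_def raw_op_def Phi_apply[OF u])
  qed (simp add: phi_def raw_op_def)
qed

lemma klin_Phi: "u \<in> adjointable_ops H \<Longrightarrow> klin (Phi u t)"
  unfolding klin_def
  by (simp add: Phi_apply psi_ksc adjointableD(1,4) psi_in_modH fib_mscale modH_subset_modK)

lemma has_adjoint_Phi:
  assumes u: "u \<in> adjointable_ops H"
  shows "has_adjoint (Phi u t)"
proof -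
  obtain v where v: "\<And>\<omega>. \<omega> \<in> H \<Longrightarrow> v \<omega> \<in> H" "\<And>\<zeta> \<omega>. \<zeta> \<in> H \<Longrightarrow> \<omega> \<in> H \<Longrightarrow> minner (u \<zeta>) \<omega> = minner \<zeta> (v \<omega>)"
    using adjointableD(6)[OF u] by blast
  have "kinner (blinfun_apply (Phi u t) x) y = kinner x (fib t (v (psi P (coord y))))" for x y
  proof -
    let ?x = "psi P (coord x)" and ?y = "psi P (coord y)"
    have H: "u ?x \<in> H" "v ?y \<in> H" using adjointableD(1)[OF u] v(1) psi_in_modH by auto
    have "kinner (fib t (u ?x)) (fib t ?y) = kinner (fib t ?x) (fib t (v ?y))"
      using arg_cong[OF v(2)[of ?x ?y], of "\<lambda>f. apply_bcontfun f t"] psi_in_modH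
      by (simp add: minner_apply modH_subset_modK H)
    then show ?thesis
      by (simp add: Phi_apply[OF u] kinner_fib_psi' kinner_fib_psi modH_subset_modK H)
  qed
  then show ?thesis
    unfolding has_adjoint_def by (intro exI[of _ "\<lambda>y. fib t (v (psi P (coord y)))"]) simp
qed

lemma adjointable_eqI:
  assumes "u \<in> adjointable_ops H" "v \<in> adjointable_ops H" "\<And>t. Phi u t = Phi v t"
  shows "u = v"
proof (rule ext)
  fix \<zeta>
  show "u \<zeta> = v \<zeta>"
  proof (cases "\<zeta> \<in> H")
    case True
    show ?thesis
      by (rule modK_family_eqI)
        (auto simp: modH_subset_modK adjointableD(1)[OF assms(1) True] adjointableD(1)[OF assms(2) True]
          fib_op[OF assms(1) True] fib_op[OF assms(2) True] assms(3))
  qed (simp add: adjointableD(2)[OF assms(1)] adjointableD(2)[OF assms(2)])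
qed

text \<open>A fibrewise adjoint relation already forces additivity and \<open>E\<close>-linearity: a
  vector in the fibre at \<open>t\<close> is determined by its inner products with the values of
  \<open>H\<close>, because \<open>psi\<close> produces a member of \<open>H\<close> through the
  difference \<open>d\<close>.\<close>

lemma adjointableI:
  assumes uH: "\<And>\<zeta>. \<zeta> \<in> H \<Longrightarrow> u \<zeta> \<in> H" and u0: "\<And>\<zeta>. \<zeta> \<notin> H \<Longrightarrow> u \<zeta> = 0" and vH: "\<And>\<zeta>. \<zeta> \<in> H \<Longrightarrow> v \<zeta> \<in> H"
    and uv: "\<And>\<zeta> \<omega> t. \<zeta> \<in> H \<Longrightarrow> \<omega> \<in> H \<Longrightarrow> kinner (fib t (u \<zeta>)) (fib t \<omega>) = kinner (fib t \<zeta>) (fib t (v \<omega>))"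
    and C: "0 \<le> C" "\<And>\<zeta> t. \<zeta> \<in> H \<Longrightarrow> norm (fib t (u \<zeta>)) \<le> C * norm (fib t \<zeta>)"
  shows "u \<in> adjointable_ops H"
proof -
  have fib_eq: "x = fib t (u \<zeta>)" if "\<zeta> \<in> H" and x: "\<And>\<iota>. apply_bcontfun (P \<iota>) t * coord x \<iota> = coord x \<iota>"
      "\<And>\<omega>. \<omega> \<in> H \<Longrightarrow> kinner x (fib t \<omega>) = kinner (fib t \<zeta>) (fib t (v \<omega>))" for x \<zeta> t
  proof -
    define d where "d = x - fib t (u \<zeta>)"
    have "kinner d (fib t \<omega>) = 0" if "\<omega> \<in> H" for \<omega>
      using x(2)[OF that] uv[OF \<open>\<zeta> \<in> H\<close> that, of t] by (simp add: d_def kinner_diff_left)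
    from this[OF psi_in_modH[of d]] have "kinner d (fib t (psi P (coord d))) = 0" .
    moreover have "fib t (psi P (coord d)) = d"
      by (rule ell2_eqI)
        (simp add: coord_fib_psi d_def left_diff_distrib mult.commute[of _ "apply_bcontfun _ _"] x(1)
          P_fib modH_subset_modK uH[OF \<open>\<zeta> \<in> H\<close>] right_diff_distrib)
    ultimately show ?thesis by (simp add: kinner_self d_def)
  qed
  have K: "\<zeta> \<in> H \<Longrightarrow> \<zeta> \<in> K" for \<zeta> by (rule modH_subset_modK)
  show ?thesis
    unfolding adjointable_ops_def mem_Collect_eq
  proof (intro conjI ballI allI impI)
    show "u \<zeta> \<in> H" if "\<zeta> \<in> H" for \<zeta> by (rule uH[OF that])
    show "u \<zeta> = 0" if "\<zeta> \<notin> H" for \<zeta> by (rule u0[OF that])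
    show "u (\<zeta> + \<omega>) = u \<zeta> + u \<omega>" if H: "\<zeta> \<in> H" "\<omega> \<in> H" for \<zeta> \<omega>
    proof (rule modK_family_eqI)
      fix t
      show "fib t (u (\<zeta> + \<omega>)) = fib t (u \<zeta> + u \<omega>)"
      proof (rule fib_eq[symmetric, OF modH_add[OF H]])
        show "apply_bcontfun (P \<iota>) t * coord (fib t (u \<zeta> + u \<omega>)) \<iota> = coord (fib t (u \<zeta> + u \<omega>)) \<iota>" for \<iota>
          by (intro P_fib modK_add K uH H)
        show "kinner (fib t (u \<zeta> + u \<omega>)) (fib t \<omega>') = kinner (fib t (\<zeta> + \<omega>)) (fib t (v \<omega>'))" if "\<omega>' \<in> H" for \<omega>'
          using H that by (simp add: fib_add K uH kinner_add_left uv)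
      qed
    qed (use H in \<open>auto intro!: K uH modK_add modH_add\<close>)
    show "u (mscale \<zeta> x) = mscale (u \<zeta>) x" if H: "\<zeta> \<in> H" for \<zeta> x
    proof (rule modK_family_eqI)
      fix t
      show "fib t (u (mscale \<zeta> x)) = fib t (mscale (u \<zeta>) x)"
      proof (rule fib_eq[symmetric, OF modH_mscale[OF H]])
        show "apply_bcontfun (P \<iota>) t * coord (fib t (mscale (u \<zeta>) x)) \<iota> = coord (fib t (mscale (u \<zeta>) x)) \<iota>" for \<iota>
          by (intro P_fib modK_mscale K uH H)
        show "kinner (fib t (mscale (u \<zeta>) x)) (fib t \<omega>') = kinner (fib t (mscale \<zeta> x)) (fib t (v \<omega>'))" if "\<omega>' \<in> H" for \<omega>'
          using H that by (simp add: fib_mscale K uH uv)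
      qed
    qed (use H in \<open>auto intro!: K uH modK_mscale modH_mscale\<close>)
    have "mnorm (u \<zeta>) \<le> C * mnorm \<zeta>" if "\<zeta> \<in> H" for \<zeta>
    proof (subst mnorm_le_iff)
      show "\<forall>t. norm (fib t (u \<zeta>)) \<le> C * mnorm \<zeta>"
        using C norm_fib_le_mnorm[OF K[OF that]] that by (meson mult_left_mono order_trans)
    qed (use C that in \<open>auto intro!: K uH\<close>)
    then show "\<exists>C. \<forall>\<zeta>\<in>H. mnorm (u \<zeta>) \<le> C * mnorm \<zeta>" by blast
    show "\<exists>v. (\<forall>\<omega>\<in>H. v \<omega> \<in> H) \<and> (\<forall>\<zeta>\<in>H. \<forall>\<omega>\<in>H. minner (u \<zeta>) \<omega> = minner \<zeta> (v \<omega>))"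
    proof (intro exI[of _ v] conjI ballI)
      fix \<zeta> \<omega> assume "\<zeta> \<in> H" "\<omega> \<in> H"
      then show "minner (u \<zeta>) \<omega> = minner \<zeta> (v \<omega>)"
        by (intro bcontfun_eqI) (simp add: minner_apply K uH vH uv)
    qed (rule vH)
  qed
qed

lemma adjointable_norm_bound:
  assumes u: "u \<in> adjointable_ops H"
  shows "\<exists>C\<ge>0. \<forall>t. norm (Phi u t) \<le> C"
proof -
  obtain C where C: "\<And>\<zeta>. \<zeta> \<in> H \<Longrightarrow> mnorm (u \<zeta>) \<le> C * mnorm \<zeta>" using adjointableD(5)[OF u] by blast
  have "norm (Phi u t) \<le> \<bar>C\<bar>" for t
  proof (rule norm_blinfun_bound)
    fix x
    have "norm (fib t (u (psi P (coord x)))) \<le> mnorm (u (psi P (coord x)))"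
      by (intro norm_fib_le_mnorm modH_subset_modK adjointableD(1)[OF u psi_in_modH])
    also have "\<dots> \<le> C * mnorm (psi P (coord x))" by (rule C[OF psi_in_modH])
    also have "\<dots> \<le> \<bar>C\<bar> * norm x" by (intro mult_mono mnorm_psi_le) auto
    finally show "norm (blinfun_apply (Phi u t) x) \<le> \<bar>C\<bar> * norm x" by (simp add: Phi_apply[OF u])
  qed simp
  then show ?thesis by (intro exI[of _ "\<bar>C\<bar>"]) auto
qed

text \<open>\<open>fib_op\<close> bounds \<open>u\<close> by its fibres; conversely
  \<open>psi\<close> does not increase norms, so each fibre is tested by elements of the unit ball
  of \<open>H\<close>. The uniform bound on the fibres makes the supremum in \<open>opnorm\<close>
  meaningful.\<close>

lemma opnorm_le_iff:
  assumes u: "u \<in> adjointable_ops H" and C: "0 \<le> C"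
  shows "opnorm H u \<le> C \<longleftrightarrow> (\<forall>t. norm (Phi u t) \<le> C)"
proof -
  have le: "mnorm (u \<zeta>) \<le> D" if "\<forall>t. norm (Phi u t) \<le> D" "0 \<le> D" "\<zeta> \<in> H" "mnorm \<zeta> \<le> 1" for \<zeta> D
  proof (subst mnorm_le_iff)
    show "\<forall>t. norm (fib t (u \<zeta>)) \<le> D"
    proof
      fix t
      have "norm (fib t (u \<zeta>)) \<le> norm (Phi u t) * norm (fib t \<zeta>)"
        unfolding fib_op[OF u that(3)] by (rule norm_blinfun)
      also have "\<dots> \<le> D * 1"
        using that norm_fib_le_mnorm[OF modH_subset_modK[OF that(3)], of t] by (intro mult_mono) auto
      finally show "norm (fib t (u \<zeta>)) \<le> D" by simp
    qed
  qed (use that in \<open>auto intro!: modH_subset_modK adjointableD(1)[OF u]\<close>)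
  obtain D where D: "D \<ge> 0" "\<forall>t. norm (Phi u t) \<le> D" using adjointable_norm_bound[OF u] by blast
  have bdd: "bdd_above ((\<lambda>\<zeta>. mnorm (u \<zeta>)) ` {\<zeta>\<in>H. mnorm \<zeta> \<le> 1})"
    by (rule bdd_aboveI2[where M=D]) (use le[OF D(2,1)] in auto)
  show ?thesis
  proof
    assume op: "opnorm H u \<le> C"
    show "\<forall>t. norm (Phi u t) \<le> C"
    proof (intro allI norm_blinfun_bound C)
      fix t x
      show "norm (blinfun_apply (Phi u t) x) \<le> C * norm x"
      proof (cases "x = 0")
        case False
        let ?y = "inverse (norm x) *\<^sub>R x"
        let ?\<zeta> = "psi P (coord ?y)"
        have "norm ?y = 1" using False by simp
        then have m: "mnorm ?\<zeta> \<le> 1" using mnorm_psi_le[of ?y] by simp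
        have "norm (blinfun_apply (Phi u t) ?y) \<le> mnorm (u ?\<zeta>)"
          unfolding Phi_apply[OF u] by (intro norm_fib_le_mnorm modH_subset_modK adjointableD(1)[OF u psi_in_modH])
        also have "\<dots> \<le> opnorm H u"
          unfolding opnorm_def by (rule cSUP_upper[OF _ bdd]) (use m psi_in_modH in auto)
        finally have "norm (blinfun_apply (Phi u t) ?y) \<le> C" using op by simp
        then show ?thesis using False by (simp add: blinfun.scaleR_right divide_simps)
      qed (simp add: blinfun.zero_right)
    qed
  next
    assume *: "\<forall>t. norm (Phi u t) \<le> C"
    have "mnorm (0 :: ('i, 't, 'k) family) \<le> 1"
      using mnorm_le_iff[OF modH_subset_modK[OF modH_0], of 1] by simp
    then have "{\<zeta>\<in>H. mnorm \<zeta> \<le> 1} \<noteq> {}" using modH_0 by blast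
    then show "opnorm H u \<le> C"
      unfolding opnorm_def by (rule cSUP_least) (use le[OF * C] in auto)
  qed
qed

section \<open>Algebra of adjointable operators and rank one operators\<close>

lemma adjointable_add:
  assumes u: "u \<in> adjointable_ops H" and w: "w \<in> adjointable_ops H"
  shows "u + w \<in> adjointable_ops H" "Phi (u + w) t = Phi u t + Phi w t"
proof -
  obtain v where v: "\<And>\<omega>. \<omega> \<in> H \<Longrightarrow> v \<omega> \<in> H" "\<And>\<zeta> \<omega>. \<zeta> \<in> H \<Longrightarrow> \<omega> \<in> H \<Longrightarrow> minner (u \<zeta>) \<omega> = minner \<zeta> (v \<omega>)"
    using adjointableD(6)[OF u] by blast
  obtain v' where v': "\<And>\<omega>. \<omega> \<in> H \<Longrightarrow> v' \<omega> \<in> H" "\<And>\<zeta> \<omega>. \<zeta> \<in> H \<Longrightarrow> \<omega> \<in> H \<Longrightarrow> minner (w \<zeta>) \<omega> = minner \<zeta> (v' \<omega>)"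
    using adjointableD(6)[OF w] by blast
  obtain C where C: "C \<ge> 0" "\<And>t. norm (Phi u t) \<le> C" using adjointable_norm_bound[OF u] by blast
  obtain D where D: "D \<ge> 0" "\<And>t. norm (Phi w t) \<le> D" using adjointable_norm_bound[OF w] by blast
  note uH = adjointableD(1)[OF u] and wH = adjointableD(1)[OF w] and K = modH_subset_modK
  show uw: "u + w \<in> adjointable_ops H"
  proof (rule adjointableI)
    show "(u + w) \<zeta> \<in> H" "v \<zeta> + v' \<zeta> \<in> H" if "\<zeta> \<in> H" for \<zeta>
      using that by (auto intro!: modH_add uH wH v v')
    show "(u + w) \<zeta> = 0" if "\<zeta> \<notin> H" for \<zeta> using that by (simp add: adjointableD(2)[OF u] adjointableD(2)[OF w])
    show "kinner (fib t ((u + w) \<zeta>)) (fib t \<omega>) = kinner (fib t \<zeta>) (fib t (v \<omega> + v' \<omega>))"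
      if H: "\<zeta> \<in> H" "\<omega> \<in> H" for \<zeta> \<omega> t
      using arg_cong[OF v(2)[OF H], of "\<lambda>f. apply_bcontfun f t"] arg_cong[OF v'(2)[OF H], of "\<lambda>f. apply_bcontfun f t"] H
      by (simp add: minner_apply K uH wH v(1) v'(1) fib_add kinner_add_left kinner_add_right)
    show "0 \<le> C + D" using C D by simp
    show "norm (fib t ((u + w) \<zeta>)) \<le> (C + D) * norm (fib t \<zeta>)" if "\<zeta> \<in> H" for \<zeta> t
    proof -
      have "norm (fib t (u \<zeta>)) \<le> C * norm (fib t \<zeta>)" "norm (fib t (w \<zeta>)) \<le> D * norm (fib t \<zeta>)"
        unfolding fib_op[OF u that] fib_op[OF w that]
        using C D by (auto intro!: order_trans[OF norm_blinfun] mult_right_mono)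
      then show ?thesis using that by (simp add: fib_add K uH wH distrib_right norm_triangle_le)
    qed
  qed
  show "Phi (u + w) t = Phi u t + Phi w t"
    by (rule blinfun_eqI) (simp add: Phi_apply u w uw plus_blinfun.rep_eq fib_add K uH wH psi_in_modH)
qed

lemma adjointable_scale:
  assumes u: "u \<in> adjointable_ops H"
  shows "op_scale c u \<in> adjointable_ops H" "blinfun_apply (Phi (op_scale c u) t) x = ksc c (blinfun_apply (Phi u t) x)"
proof -
  obtain v where v: "\<And>\<omega>. \<omega> \<in> H \<Longrightarrow> v \<omega> \<in> H" "\<And>\<zeta> \<omega>. \<zeta> \<in> H \<Longrightarrow> \<omega> \<in> H \<Longrightarrow> minner (u \<zeta>) \<omega> = minner \<zeta> (v \<omega>)"
    using adjointableD(6)[OF u] by blast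
  obtain C where C: "C \<ge> 0" "\<And>t. norm (Phi u t) \<le> C" using adjointable_norm_bound[OF u] by blast
  note uH = adjointableD(1)[OF u] and K = modH_subset_modK
  have sc: "op_scale c u \<zeta> = mscale (u \<zeta>) (const_bcontfun c)" for \<zeta>
    by (simp add: op_scale_def mscale_def mult.commute)
  show cu: "op_scale c u \<in> adjointable_ops H"
  proof (rule adjointableI)
    show "op_scale c u \<zeta> \<in> H" "mscale (v \<zeta>) (const_bcontfun (kconj c)) \<in> H" if "\<zeta> \<in> H" for \<zeta>
      using that by (auto simp: sc intro!: modH_mscale uH v)
    show "op_scale c u \<zeta> = 0" if "\<zeta> \<notin> H" for \<zeta> using that by (simp add: sc adjointableD(2)[OF u] mscale_def zero_fun_def)
    show "kinner (fib t (op_scale c u \<zeta>)) (fib t \<omega>) = kinner (fib t \<zeta>) (fib t (mscale (v \<omega>) (const_bcontfun (kconj c))))"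
      if H: "\<zeta> \<in> H" "\<omega> \<in> H" for \<zeta> \<omega> t
      using arg_cong[OF v(2)[OF H], of "\<lambda>f. apply_bcontfun f t"] H
      by (simp add: sc minner_apply K uH v(1) fib_mscale kconj_kconj)
    show "0 \<le> norm c * C" using C by simp
    show "norm (fib t (op_scale c u \<zeta>)) \<le> (norm c * C) * norm (fib t \<zeta>)" if "\<zeta> \<in> H" for \<zeta> t
    proof -
      have "norm (fib t (u \<zeta>)) \<le> C * norm (fib t \<zeta>)"
        unfolding fib_op[OF u that]
        using C by (auto intro!: order_trans[OF norm_blinfun] mult_right_mono)
      then show ?thesis using that by (simp add: sc fib_mscale K uH mult.assoc mult_left_mono)
    qed
  qed
  show "blinfun_apply (Phi (op_scale c u) t) x = ksc c (blinfun_apply (Phi u t) x)"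
    by (simp add: Phi_apply u cu sc fib_mscale K uH psi_in_modH)
qed

lemma adjointable_diff:
  assumes u: "u \<in> adjointable_ops H" and w: "w \<in> adjointable_ops H"
  shows "u - w \<in> adjointable_ops H" "Phi (u - w) t = Phi u t - Phi w t"
proof -
  have eq: "u - w = u + op_scale (- 1) w"
    by (intro ext bcontfun_eqI) (simp add: op_scale_def)
  show "u - w \<in> adjointable_ops H" unfolding eq by (intro adjointable_add adjointable_scale u w)
  have "ksc (- 1) x = - x" for x :: "('i, 'k) ell2" by (rule ell2_eqI) simp
  then show "Phi (u - w) t = Phi u t - Phi w t"
    unfolding eq adjointable_add(2)[OF u adjointable_scale(1)[OF w]]
    by (intro blinfun_eqI)
      (simp only: plus_blinfun.rep_eq minus_blinfun.rep_eq adjointable_scale(2)[OF w] add_uminus_conv_diff)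
qed

lemma adjointable_zero: "0 \<in> adjointable_ops H" "Phi 0 t = 0"
proof -
  show 0: "0 \<in> adjointable_ops H"
    by (rule adjointableI[where v="\<lambda>_. 0" and C=0]) (auto simp: modH_0)
  show "Phi 0 t = 0" by (rule blinfun_eqI) (simp add: Phi_apply[OF 0])
qed

lemma rank_one_adjointable:
  assumes \<xi>: "\<xi> \<in> H" and \<eta>: "\<eta> \<in> H"
  shows "rank_one H \<xi> \<eta> \<in> adjointable_ops H"
    "blinfun_apply (Phi (rank_one H \<xi> \<eta>) t) x = ksc (kinner x (fib t \<eta>)) (fib t \<xi>)"
proof -
  note K = modH_subset_modK
  obtain C where C: "C \<ge> 0" "\<And>t. norm (fib t \<xi>) \<le> C" using modK_norm_bounded[OF K[OF \<xi>]] by blast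
  obtain D where D: "D \<ge> 0" "\<And>t. norm (fib t \<eta>) \<le> D" using modK_norm_bounded[OF K[OF \<eta>]] by blast
  have fr: "fib t (rank_one H \<xi> \<eta> \<zeta>) = ksc (kinner (fib t \<zeta>) (fib t \<eta>)) (fib t \<xi>)"
    if "\<zeta> \<in> H" "\<xi> \<in> H" "\<eta> \<in> H" for \<zeta> \<xi> \<eta> t
    using that by (simp add: rank_one_def fib_mscale K minner_apply)
  show adj: "rank_one H \<xi> \<eta> \<in> adjointable_ops H"
  proof (rule adjointableI)
    show "rank_one H \<xi> \<eta> \<zeta> \<in> H" "rank_one H \<eta> \<xi> \<zeta> \<in> H" if "\<zeta> \<in> H" for \<zeta>
      using that by (auto simp: rank_one_def intro!: modH_mscale \<xi> \<eta>)
    show "rank_one H \<xi> \<eta> \<zeta> = 0" if "\<zeta> \<notin> H" for \<zeta> using that by (simp add: rank_one_def)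
    show "kinner (fib t (rank_one H \<xi> \<eta> \<zeta>)) (fib t \<omega>) = kinner (fib t \<zeta>) (fib t (rank_one H \<eta> \<xi> \<omega>))"
      if H: "\<zeta> \<in> H" "\<omega> \<in> H" for \<zeta> \<omega> t
      using kinner_commute[of "fib t \<omega>" "fib t \<xi>"] by (simp add: fr H \<xi> \<eta> kconj_kconj)
    show "0 \<le> C * D" using C D by simp
    show "norm (fib t (rank_one H \<xi> \<eta> \<zeta>)) \<le> C * D * norm (fib t \<zeta>)" if "\<zeta> \<in> H" for \<zeta> t
    proof -
      have "norm (fib t (rank_one H \<xi> \<eta> \<zeta>)) \<le> (norm (fib t \<zeta>) * norm (fib t \<eta>)) * norm (fib t \<xi>)"
        by (simp add: fr that \<xi> \<eta> mult_right_mono kinner_cauchy_schwarz)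
      also have "\<dots> \<le> (norm (fib t \<zeta>) * D) * C"
        using C D by (intro mult_mono) auto
      finally show ?thesis by (simp add: mult_ac)
    qed
  qed
  show "blinfun_apply (Phi (rank_one H \<xi> \<eta>) t) x = ksc (kinner x (fib t \<eta>)) (fib t \<xi>)"
    by (simp add: Phi_apply[OF adj] fr psi_in_modH \<xi> \<eta> kinner_fib_psi K)
qed

section \<open>Compact operators as uniform limits of finite rank fields\<close>

lemma mscale_rank_one: "op_scale c (rank_one H \<xi> \<eta>) = rank_one H (mscale \<xi> (const_bcontfun c)) \<eta>"
  by (intro ext bcontfun_eqI) (simp add: op_scale_def rank_one_def mscale_def mult_ac)

abbreviation finite_rank_ops where
  "finite_rank_ops \<equiv> opv.span {rank_one H \<xi> \<eta> | \<xi> \<eta>. \<xi> \<in> H \<and> \<eta> \<in> H}"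

text \<open>Induction over the span, with scalars absorbed into the first vector. A rank one field
  is norm continuous because both of its vectors are continuous sections.\<close>

lemma finite_rank_ops:
  assumes "v \<in> finite_rank_ops"
  shows "v \<in> adjointable_ops H \<and> (\<forall>t. compact_op (Phi v t)) \<and> continuous_on UNIV (Phi v)"
  using assms
proof (induction rule: opv.span_induct_alt)
  case base
  have "compact_op (0 :: ('i, 'k) ell2 \<Rightarrow>\<^sub>L ('i, 'k) ell2)"
    by (rule compact_op_rank_one[where g=0 and h=0]) simp
  moreover have "Phi 0 = (\<lambda>t. 0)" by (rule ext) (rule adjointable_zero(2))
  ultimately show ?case
    by (intro conjI allI adjointable_zero(1)) (simp_all only: continuous_on_const)
next
  case (step c u v)
  then obtain \<xi> \<eta> where u: "u = rank_one H \<xi> \<eta>" and H: "\<xi> \<in> H" "\<eta> \<in> H" by blast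
  define \<xi>' where "\<xi>' = mscale \<xi> (const_bcontfun c)"
  have \<xi>': "\<xi>' \<in> H" unfolding \<xi>'_def by (rule modH_mscale[OF H(1)])
  have cu: "op_scale c u = rank_one H \<xi>' \<eta>" by (simp add: u mscale_rank_one \<xi>'_def)
  note r = rank_one_adjointable[OF \<xi>' H(2)]
  let ?R = "Phi (rank_one H \<xi>' \<eta>)"
  have comp: "compact_op (?R t)" for t by (rule compact_op_rank_one) (rule r(2))
  have cont: "continuous_on UNIV ?R"
    unfolding continuous_on_def
  proof
    fix t
    have le: "norm (?R s - ?R t) \<le> norm (fib s \<eta> - fib t \<eta>) * norm (fib s \<xi>') + norm (fib t \<eta>) * norm (fib s \<xi>' - fib t \<xi>')" (is "_ \<le> ?b s") for s
    proof (rule norm_blinfun_bound)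
      fix x
      have "blinfun_apply (?R s - ?R t) x =
          ksc (kinner x (fib s \<eta> - fib t \<eta>)) (fib s \<xi>') + ksc (kinner x (fib t \<eta>)) (fib s \<xi>' - fib t \<xi>')"
        by (simp add: minus_blinfun.rep_eq r(2) kinner_diff_right ksc_diff_left ksc_diff_right)
      also have "norm \<dots> \<le> norm (kinner x (fib s \<eta> - fib t \<eta>)) * norm (fib s \<xi>') + norm (kinner x (fib t \<eta>)) * norm (fib s \<xi>' - fib t \<xi>')"
        by (rule norm_triangle_le) simp
      also have "\<dots> \<le> (norm x * norm (fib s \<eta> - fib t \<eta>)) * norm (fib s \<xi>') + (norm x * norm (fib t \<eta>)) * norm (fib s \<xi>' - fib t \<xi>')"
        by (intro add_mono mult_right_mono kinner_cauchy_schwarz) auto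
      finally show "norm (blinfun_apply (?R s - ?R t) x) \<le> ?b s * norm x" by (simp add: algebra_simps)
    qed simp
    have lim: "((\<lambda>s. fib s \<eta>) \<longlongrightarrow> fib t \<eta>) (at t)" "((\<lambda>s. fib s \<xi>') \<longlongrightarrow> fib t \<xi>') (at t)"
      using fib_continuous[OF H(2)] fib_continuous[OF \<xi>'] by (auto simp: continuous_on_def)
    have "((\<lambda>s. ?b s) \<longlongrightarrow> norm (fib t \<eta> - fib t \<eta>) * norm (fib t \<xi>') + norm (fib t \<eta>) * norm (fib t \<xi>' - fib t \<xi>')) (at t)"
      by (intro tendsto_intros lim)
    then have "(?b \<longlongrightarrow> 0) (at t)" by simp
    then have "((\<lambda>s. ?R s - ?R t) \<longlongrightarrow> 0) (at t)"
      by (rule Lim_null_comparison[OF always_eventually[OF allI[OF le]]])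
    then show "(?R \<longlongrightarrow> ?R t) (at t within UNIV)" using LIM_zero_cancel by blast
  qed
  have eq: "Phi (op_scale c u + v) t = ?R t + Phi v t" for t
    unfolding cu by (rule adjointable_add(2)) (use r step in auto)
  have "continuous_on UNIV (\<lambda>t. ?R t + Phi v t)" using step by (intro continuous_intros cont) auto
  then have "continuous_on UNIV (Phi (op_scale c u + v))" by (simp add: eq cong: continuous_on_cong)
  moreover have "op_scale c u + v \<in> adjointable_ops H"
    unfolding cu by (rule adjointable_add(1)) (use r step in auto)
  moreover have "compact_op (Phi (op_scale c u + v) t)" for t
    unfolding eq by (rule compact_op_add[OF comp]) (use step in blast)
  ultimately show ?case by (intro conjI allI)
qed

lemma compact_ops_iff:
  "u \<in> compact_ops H \<longleftrightarrow> u \<in> adjointable_ops H \<and>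
    (\<forall>\<epsilon>>0. \<exists>v\<in>finite_rank_ops. \<forall>t. norm (Phi u t - Phi v t) \<le> \<epsilon>)"
proof -
  have le: "opnorm H (u - v) \<le> \<epsilon> \<longleftrightarrow> (\<forall>t. norm (Phi u t - Phi v t) \<le> \<epsilon>)"
    if "u \<in> adjointable_ops H" "v \<in> finite_rank_ops" "\<epsilon> > 0" for v and \<epsilon> :: real
  proof -
    have "v \<in> adjointable_ops H" using finite_rank_ops[OF that(2)] by simp
    then show ?thesis
      using opnorm_le_iff[OF adjointable_diff(1)[OF that(1)], of v \<epsilon>] that by (simp add: adjointable_diff(2))
  qed
  show ?thesis
    unfolding compact_ops_def mem_Collect_eq
  proof (intro conj_cong refl iffI allI impI)
    fix \<epsilon> :: real
    assume u: "u \<in> adjointable_ops H" and *: "\<forall>\<epsilon>>0. \<exists>v\<in>finite_rank_ops. opnorm H (u - v) < \<epsilon>" and "\<epsilon> > 0"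
    then obtain v where v: "v \<in> finite_rank_ops" "opnorm H (u - v) < \<epsilon>" by blast
    then have "\<forall>t. norm (Phi u t - Phi v t) \<le> \<epsilon>" using le[OF u v(1) \<open>\<epsilon> > 0\<close>] by simp
    then show "\<exists>v\<in>finite_rank_ops. \<forall>t. norm (Phi u t - Phi v t) \<le> \<epsilon>" using v(1) by blast
  next
    fix \<epsilon> :: real
    assume u: "u \<in> adjointable_ops H" and *: "\<forall>\<epsilon>>0. \<exists>v\<in>finite_rank_ops. \<forall>t. norm (Phi u t - Phi v t) \<le> \<epsilon>" and "\<epsilon> > 0"
    then have "\<epsilon> / 2 > 0" by simp
    then obtain v where v: "v \<in> finite_rank_ops" "\<forall>t. norm (Phi u t - Phi v t) \<le> \<epsilon> / 2" using * by blast
    then have "opnorm H (u - v) \<le> \<epsilon> / 2" using le[OF u v(1) \<open>\<epsilon> / 2 > 0\<close>] by blast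
    then have "opnorm H (u - v) < \<epsilon>" using \<open>\<epsilon> > 0\<close> by simp
    then show "\<exists>v\<in>finite_rank_ops. opnorm H (u - v) < \<epsilon>" using v(1) by blast
  qed
qed

lemma compact_ops_adjointable: "u \<in> compact_ops H \<Longrightarrow> u \<in> adjointable_ops H"
  by (simp add: compact_ops_def)

text \<open>The operator norm is uniform in \<open>t\<close>, so compactness of the fibres and norm
  continuity pass from finite rank fields to their limits.\<close>

lemma compact_ops_Phi:
  assumes u: "u \<in> compact_ops H"
  shows "compact_op (Phi u t)" "continuous_on UNIV (Phi u)"
proof -
  have u': "u \<in> adjointable_ops H" and *: "\<forall>\<epsilon>>0. \<exists>v\<in>finite_rank_ops. \<forall>t. norm (Phi u t - Phi v t) \<le> \<epsilon>"
    using u unfolding compact_ops_iff by auto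
  have **: "\<exists>v. (\<forall>t. compact_op (Phi v t)) \<and> continuous_on UNIV (Phi v) \<and> (\<forall>t. norm (Phi u t - Phi v t) < \<epsilon>)" if "\<epsilon> > 0" for \<epsilon>
  proof -
    have "\<epsilon> / 2 > 0" using that by simp
    then obtain v where v: "v \<in> finite_rank_ops" "\<forall>t. norm (Phi u t - Phi v t) \<le> \<epsilon> / 2" using * by blast
    moreover have "\<epsilon> / 2 < \<epsilon>" using that by simp
    ultimately show ?thesis using finite_rank_ops[OF v(1)] by (meson order_le_less_trans)
  qed
  show "compact_op (Phi u t)"
    by (rule compact_op_limit[OF klin_Phi[OF u']]) (use ** in blast)
  have "\<forall>n. \<exists>v. continuous_on UNIV (Phi v) \<and> (\<forall>t. norm (Phi u t - Phi v t) < 1 / real (Suc n))"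
    using ** by (metis of_nat_0_less_iff zero_less_Suc zero_less_divide_1_iff)
  then obtain v where v: "\<And>n. continuous_on UNIV (Phi (v n))" "\<And>n t. norm (Phi u t - Phi (v n) t) < 1 / real (Suc n)"
    by metis
  have "uniform_limit UNIV (\<lambda>n. Phi (v n)) (Phi u) sequentially"
  proof (rule uniform_limitI)
    fix e :: real assume "e > 0"
    have "eventually (\<lambda>n. 1 / real (Suc n) < e) sequentially"
      using LIMSEQ_inverse_real_of_nat[THEN order_tendstoD(2), OF \<open>e > 0\<close>] by (simp add: inverse_eq_divide)
    then show "eventually (\<lambda>n. \<forall>x\<in>UNIV. dist (Phi (v n) x) (Phi u x) < e) sequentially"
    proof eventually_elim
      case (elim n)
      then show ?case using v(2)[of _ n] by (auto simp: dist_norm norm_minus_commute intro: less_trans)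
    qed
  qed
  then show "continuous_on UNIV (Phi u)"
    by (rule uniform_limit_theorem[rotated]) (use v(1) in auto)
qed

lemma compact_ops_subspace: "opv.subspace (compact_ops H)"
proof (rule opv.subspaceI)
  show "0 \<in> compact_ops H"
    unfolding compact_ops_iff using opv.span_zero adjointable_zero
    by (auto intro!: bexI[of _ 0])
next
  fix u w assume u: "u \<in> compact_ops H" and w: "w \<in> compact_ops H"
  then have adj: "u \<in> adjointable_ops H" "w \<in> adjointable_ops H" by (auto simp: compact_ops_adjointable)
  show "u + w \<in> compact_ops H"
    unfolding compact_ops_iff
  proof (intro conjI allI impI adjointable_add adj)
    fix \<epsilon> :: real assume "\<epsilon> > 0"
    then have "\<epsilon> / 2 > 0" by simp
    obtain v where v: "v \<in> finite_rank_ops" "\<forall>t. norm (Phi u t - Phi v t) \<le> \<epsilon> / 2"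
      using u \<open>\<epsilon> / 2 > 0\<close> unfolding compact_ops_iff by blast
    obtain v' where v': "v' \<in> finite_rank_ops" "\<forall>t. norm (Phi w t - Phi v' t) \<le> \<epsilon> / 2"
      using w \<open>\<epsilon> / 2 > 0\<close> unfolding compact_ops_iff by blast
    have "norm (Phi (u + w) t - Phi (v + v') t) \<le> \<epsilon>" for t
    proof -
      have "Phi (u + w) t - Phi (v + v') t = (Phi u t - Phi v t) + (Phi w t - Phi v' t)"
        using finite_rank_ops[OF v(1)] finite_rank_ops[OF v'(1)] by (simp add: adjointable_add(2) adj)
      then show ?thesis
        using norm_triangle_ineq[of "Phi u t - Phi v t" "Phi w t - Phi v' t"] v(2)[rule_format, of t] v'(2)[rule_format, of t] by simp
    qed
    then show "\<exists>v\<in>finite_rank_ops. \<forall>t. norm (Phi (u + w) t - Phi v t) \<le> \<epsilon>"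
      using opv.span_add[OF v(1) v'(1)] by blast
  qed
next
  fix c u assume u: "u \<in> compact_ops H"
  then have adj: "u \<in> adjointable_ops H" by (rule compact_ops_adjointable)
  show "op_scale c u \<in> compact_ops H"
    unfolding compact_ops_iff
  proof (intro conjI allI impI adjointable_scale adj)
    fix \<epsilon> :: real assume "\<epsilon> > 0"
    define \<delta> where "\<delta> = \<epsilon> / (norm c + 1)"
    have c1: "norm c + 1 > 0" by (simp add: add_nonneg_pos)
    then have "\<delta> > 0" using \<open>\<epsilon> > 0\<close> by (simp add: \<delta>_def)
    then obtain v where v: "v \<in> finite_rank_ops" "\<forall>t. norm (Phi u t - Phi v t) \<le> \<delta>"
      using u unfolding compact_ops_iff by blast
    have "norm (Phi (op_scale c u) t - Phi (op_scale c v) t) \<le> \<epsilon>" for t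
    proof (rule norm_blinfun_bound)
      fix x
      have "blinfun_apply (Phi (op_scale c u) t - Phi (op_scale c v) t) x = ksc c (blinfun_apply (Phi u t - Phi v t) x)"
        using finite_rank_ops[OF v(1)] by (simp add: minus_blinfun.rep_eq adjointable_scale(2) adj ksc_diff_right)
      then have "norm (blinfun_apply (Phi (op_scale c u) t - Phi (op_scale c v) t) x) = norm c * norm (blinfun_apply (Phi u t - Phi v t) x)"
        by simp
      also have "\<dots> \<le> (norm c + 1) * (\<delta> * norm x)"
        using v(2) \<open>\<delta> > 0\<close> by (intro mult_mono order_trans[OF norm_blinfun] mult_right_mono) auto
      also have "\<dots> = \<epsilon> * norm x" using c1 by (simp add: \<delta>_def)
      finally show "norm (blinfun_apply (Phi (op_scale c u) t - Phi (op_scale c v) t) x) \<le> \<epsilon> * norm x" .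
    qed (use \<open>\<epsilon> > 0\<close> in simp)
    then show "\<exists>v\<in>finite_rank_ops. \<forall>t. norm (Phi (op_scale c u) t - Phi v t) \<le> \<epsilon>"
      using opv.span_scale[OF v(1)] by blast
  qed
qed

section \<open>Singular value functions\<close>

abbreviation sv :: "('i, 't, 'k) oper \<Rightarrow> 't \<Rightarrow> nat \<Rightarrow> real" where
  "sv u t \<equiv> singular_values (phi P t u)"

lemma sv_eqI: "u \<in> adjointable_ops H \<Longrightarrow> schmidt (Phi u t) s e f \<Longrightarrow> sv u t = s"
  using schmidt_singular_values has_adjoint_Phi phi_eq_raw_op by metis

text \<open>Every property of the singular values of a fibre is read off from such a
  decomposition.\<close>

lemma sv_schmidt:
  assumes "u \<in> compact_ops H"
  shows "\<exists>e f. schmidt (Phi u t) (sv u t) e f"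
proof -
  obtain s e f where "schmidt (Phi u t) s e f"
    using schmidt_exists[OF compact_ops_Phi(1)[OF assms]] by blast
  moreover from this have "sv u t = s" by (rule sv_eqI[OF compact_ops_adjointable[OF assms]])
  ultimately show ?thesis by blast
qed

lemma sv_nonneg: "u \<in> compact_ops H \<Longrightarrow> 0 \<le> sv u t n"
  using sv_schmidt schmidtD(8) by blast

lemma sv_antimono: "u \<in> compact_ops H \<Longrightarrow> m \<le> n \<Longrightarrow> sv u t n \<le> sv u t m"
  using sv_schmidt schmidtD(1) by (metis decseq_def)

lemma norm_Phi_eq_sv: "u \<in> compact_ops H \<Longrightarrow> norm (Phi u t) = sv u t 0"
  using sv_schmidt schmidt_norm by blast

lemma sv_add:
  assumes "u \<in> compact_ops H" "w \<in> compact_ops H"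
  shows "sv (u + w) t (m + n) \<le> sv u t m + sv w t n"
proof -
  obtain e f where 1: "schmidt (Phi u t) (sv u t) e f" using sv_schmidt[OF assms(1)] by blast
  obtain e' f' where 2: "schmidt (Phi w t) (sv w t) e' f'" using sv_schmidt[OF assms(2)] by blast
  obtain e'' f'' where "schmidt (Phi (u + w) t) (sv (u + w) t) e'' f''"
    using sv_schmidt[OF opv.subspace_add[OF compact_ops_subspace assms]] by blast
  then have 3: "schmidt (Phi u t + Phi w t) (sv (u + w) t) e'' f''"
    using assms by (simp only: adjointable_add(2) compact_ops_adjointable)
  show ?thesis by (rule schmidt_weyl[OF 1 2 3])
qed

text \<open>Two operators and two points at once: \<open>w = u\<close> yields continuity in
  \<open>t\<close>, and \<open>s = t\<close> yields convergence of singular values along a norm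
  convergent sequence of operators.\<close>

lemma sv_lipschitz:
  assumes u: "u \<in> compact_ops H" and w: "w \<in> compact_ops H"
  shows "\<bar>sv u t n - sv w s n\<bar> \<le> norm (Phi u t - Phi w s)"
proof -
  obtain e f where 1: "schmidt (Phi u t) (sv u t) e f" using sv_schmidt[OF u] by blast
  obtain e' f' where 2: "schmidt (Phi w s) (sv w s) e' f'" using sv_schmidt[OF w] by blast
  show ?thesis
    using schmidt_lipschitz[OF 1 2, of n] schmidt_lipschitz[OF 2 1, of n]
      compact_op_diff[OF compact_ops_Phi(1)[OF u, of t] compact_ops_Phi(1)[OF w, of s]]
      compact_op_diff[OF compact_ops_Phi(1)[OF w, of s] compact_ops_Phi(1)[OF u, of t]]
    by (simp add: norm_minus_commute abs_le_iff)
qed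

lemma sv_continuous:
  assumes "u \<in> compact_ops H"
  shows "continuous_on UNIV (\<lambda>t. sv u t n)"
  unfolding continuous_on_def
proof
  fix t
  have "((\<lambda>s. Phi u s) \<longlongrightarrow> Phi u t) (at t)"
    using compact_ops_Phi(2)[OF assms] unfolding continuous_on_def by blast
  then have "((\<lambda>s. norm (Phi u s - Phi u t)) \<longlongrightarrow> 0) (at t)" by (rule tendsto_norm_zero[OF LIM_zero])
  moreover have "eventually (\<lambda>s. norm (sv u s n - sv u t n) \<le> norm (Phi u s - Phi u t)) (at t)"
    by (intro always_eventually allI) (simp add: sv_lipschitz[OF assms assms])
  ultimately have "((\<lambda>s. sv u s n - sv u t n) \<longlongrightarrow> 0) (at t)" by (rule Lim_null_comparison[rotated])
  then show "((\<lambda>s. sv u s n) \<longlongrightarrow> sv u t n) (at t within UNIV)" by (rule LIM_zero_cancel)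
qed

lemma sv_scale:
  assumes "u \<in> compact_ops H"
  shows "sv (op_scale c u) t n = norm c * sv u t n"
proof (cases "c = 0")
  case True
  have z: "schmidt (Phi 0 t) (\<lambda>_. 0) (\<lambda>_. 0) (\<lambda>_. 0)" unfolding adjointable_zero(2) by (rule schmidt_zero)
  have "sv 0 t = (\<lambda>_. 0)" by (rule sv_eqI[OF adjointable_zero(1) z])
  moreover have "op_scale c u = 0" using True by (simp only: opv.scale_zero_left)
  ultimately show ?thesis using True by (simp only: norm_zero mult_zero_left)
next
  case False
  note u = compact_ops_adjointable[OF assms]
  obtain e f where "schmidt (Phi u t) (sv u t) e f" using sv_schmidt[OF assms] by blast
  from schmidt_scale[OF this False, of "Phi (op_scale c u) t"]
  show ?thesis using sv_eqI[OF adjointable_scale(1)[OF u]] adjointable_scale(2)[OF u] by simp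
qed

lemma op_uminus: "op_scale (- 1) u = - (u :: ('i, 't, 'k) oper)"
  by (intro ext bcontfun_eqI) (simp add: op_scale_def)

lemma sv_minus:
  assumes "u \<in> compact_ops H"
  shows "sv (- u) t n = sv u t n"
  using sv_scale[OF assms, where c="- 1"] by (simp only: op_uminus) simp

text \<open>\<open>Bcontfun\<close> can be evaluated only on bounded continuous functions, so
  continuity of the singular values has to be known before \<open>theta\<close> has values.\<close>

lemma apply_theta: "u \<in> compact_ops H \<Longrightarrow> apply_bcontfun (theta P u n) t = of_real (sv u t n)"
  unfolding theta_def by (intro apply_Bcontfun_T continuous_intros sv_continuous)

lemma apply_cpowr_theta:
  assumes "u \<in> compact_ops H" "0 < p"
  shows "apply_bcontfun (cpowr (theta P u n) p) t = of_real (sv u t n powr p)"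
proof -
  have "continuous_on UNIV (\<lambda>t. sv u t n powr p)"
    by (intro continuous_on_powr' sv_continuous assms continuous_on_const)
      (use assms sv_nonneg in auto)
  then have "continuous_on UNIV (\<lambda>t. of_real (sv u t n powr p) :: 'k)" by (rule continuous_on_of_real)
  then show ?thesis
    unfolding cpowr_def apply_theta[OF assms(1)] norm_of_real abs_of_nonneg[OF sv_nonneg[OF assms(1)]]
    by (rule apply_Bcontfun_T)
qed

end

section \<open>Schatten classes\<close>

lemma powr_add_le:
  assumes "0 \<le> a" "0 \<le> b" "0 \<le> (p::real)"
  shows "(a + b) powr p \<le> 2 powr p * (a powr p + b powr p)"
proof -
  have "(a + b) powr p \<le> (2 * max a b) powr p" using assms by (intro powr_mono2) auto
  also have "\<dots> = 2 powr p * max a b powr p" using assms by (simp add: powr_mult)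
  also have "\<dots> \<le> 2 powr p * (a powr p + b powr p)"
    by (intro mult_left_mono) (auto simp: max_def)
  finally show ?thesis .
qed

lemma sum_double_interval: "(\<Sum>k\<in>{2 * N..<2 * M}. f k) = (\<Sum>n\<in>{N..<M}. f (2 * n) + f (Suc (2 * n)) :: real)"
proof (induction M)
  case (Suc M)
  show ?case
  proof (cases "N \<le> M")
    case True
    then have "{2 * N..<2 * Suc M} = insert (Suc (2 * M)) (insert (2 * M) {2 * N..<2 * M})"
      "{N..<Suc M} = insert M {N..<M}" by auto
    then show ?thesis using Suc by simp
  next
    case False
    then show ?thesis by simp
  qed
qed simp

locale schatten_family = hilbert_family P
  for P :: "'i \<Rightarrow> ('t::t2_space \<Rightarrow>\<^sub>C 'k::rc_scalar)" +
  fixes p :: real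
  assumes p: "1 \<le> p"
begin

lemma p_pos: "0 < p"
  using p by simp

abbreviation L where "L \<equiv> Lp P p"
abbreviation Lnorm where "Lnorm \<equiv> Lp_norm P p"

lemma Lp_compact: "u \<in> L \<Longrightarrow> u \<in> compact_ops H"
  by (simp add: Lp_def)

text \<open>For non-negative terms the finite sets off a finite set may be replaced by intervals of
  indices. The tails must be small uniformly in \<open>t\<close>, which bounded sums do not
  provide.\<close>

lemma Lp_iff: "u \<in> L \<longleftrightarrow> u \<in> compact_ops H \<and>
    (\<forall>\<epsilon>>0. \<exists>N. \<forall>M t. (\<Sum>n\<in>{N..<M}. sv u t n powr p) \<le> \<epsilon>)"
proof (cases "u \<in> compact_ops H")
  case True
  have "(\<lambda>n. cpowr (theta P u n) p) summable_on UNIV \<longleftrightarrow>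
     (\<forall>\<epsilon>>0. \<exists>F0. finite F0 \<and> (\<forall>F t. finite F \<and> F \<inter> F0 = {} \<longrightarrow> (\<Sum>n\<in>F. sv u t n powr p) \<le> \<epsilon>))"
    by (rule nonneg_bcontfun_summable_iff) (auto simp: apply_cpowr_theta[OF True p_pos])
  also have "\<dots> \<longleftrightarrow> (\<forall>\<epsilon>>0. \<exists>N. \<forall>M t. (\<Sum>n\<in>{N..<M}. sv u t n powr p) \<le> \<epsilon>)"
  proof (intro all_cong1 imp_cong refl iffI)
    fix \<epsilon> :: real
    assume "\<exists>F0. finite F0 \<and> (\<forall>F t. finite F \<and> F \<inter> F0 = {} \<longrightarrow> (\<Sum>n\<in>F. sv u t n powr p) \<le> \<epsilon>)"
    then obtain F0 where F0: "finite F0" "\<And>F t. finite F \<and> F \<inter> F0 = {} \<Longrightarrow> (\<Sum>n\<in>F. sv u t n powr p) \<le> \<epsilon>" by blast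
    obtain N where N: "\<forall>n\<in>F0. n < N" using F0(1) by (metis finite_nat_set_iff_bounded)
    have "(\<Sum>n\<in>{N..<M}. sv u t n powr p) \<le> \<epsilon>" for M t by (rule F0(2)) (use N in force)
    then show "\<exists>N. \<forall>M t. (\<Sum>n\<in>{N..<M}. sv u t n powr p) \<le> \<epsilon>" by blast
  next
    fix \<epsilon> :: real
    assume "\<exists>N. \<forall>M t. (\<Sum>n\<in>{N..<M}. sv u t n powr p) \<le> \<epsilon>"
    then obtain N where N: "\<And>M t. (\<Sum>n\<in>{N..<M}. sv u t n powr p) \<le> \<epsilon>" by blast
    have "(\<Sum>n\<in>F. sv u t n powr p) \<le> \<epsilon>" if F: "finite F \<and> F \<inter> {..<N} = {}" for F t
    proof -
      obtain M where "\<forall>n\<in>F. n < M" using F by (metis finite_nat_set_iff_bounded)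
      then have "F \<subseteq> {N..<M}" using F by (auto simp: not_less[symmetric])
      then have "(\<Sum>n\<in>F. sv u t n powr p) \<le> (\<Sum>n\<in>{N..<M}. sv u t n powr p)" by (intro sum_mono2) auto
      also have "\<dots> \<le> \<epsilon>" by (rule N)
      finally show ?thesis .
    qed
    then show "\<exists>F0. finite F0 \<and> (\<forall>F t. finite F \<and> F \<inter> F0 = {} \<longrightarrow> (\<Sum>n\<in>F. sv u t n powr p) \<le> \<epsilon>)"
      by (intro exI[of _ "{..<N}"]) simp
  qed
  finally show ?thesis using True by (simp add: Lp_def)
qed (simp add: Lp_def)

text \<open>The norm is the supremum over \<open>t\<close> of pointwise \<open>p\<close>-norms. An
  infinite sum that does not converge is 0 by default, so membership in \<open>L\<close> must be
  secured before the norm says anything.\<close>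

lemma Lp_norm_le_iff:
  assumes u: "u \<in> L" and c: "0 \<le> c"
  shows "Lnorm u \<le> c \<longleftrightarrow> (\<forall>t N. (\<Sum>n<N. sv u t n powr p) \<le> c powr p)"
proof -
  let ?f = "\<lambda>n. cpowr (theta P u n) p"
  define x where "x = (\<Sum>\<^sub>\<infinity>n. ?f n)"
  have x: "(?f has_sum x) UNIV" using u by (simp add: Lp_def x_def)
  note f = apply_cpowr_theta[OF Lp_compact[OF u] p_pos]
  have ft: "((\<lambda>n. of_real (sv u t n powr p)) has_sum apply_bcontfun x t) UNIV" for t
    using has_sum_bounded_linear[OF bounded_linear_apply_bcontfun x, of t] by (simp only: f)
  have rt: "((\<lambda>n. sv u t n powr p) has_sum kre (apply_bcontfun x t)) UNIV" for t
    using has_sum_bounded_linear[OF bounded_linear_kre ft[of t]] by (simp only: kre_of_real)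
  have xt: "apply_bcontfun x t = of_real (kre (apply_bcontfun x t))" for t
    by (rule has_sum_unique[OF ft has_sum_bounded_linear[OF bounded_linear_of_real rt]])
  have nx: "norm (apply_bcontfun x t) = kre (apply_bcontfun x t)" for t
  proof -
    have "0 \<le> kre (apply_bcontfun x t)" by (rule has_sum_nonneg[OF rt]) simp
    then show ?thesis using arg_cong[OF xt[of t], of norm] by (simp only: norm_of_real abs_of_nonneg)
  qed
  have "Lnorm u \<le> c \<longleftrightarrow> norm x \<le> c powr p"
  proof
    assume "Lnorm u \<le> c"
    then have "(norm x powr (1 / p)) powr p \<le> c powr p"
      using p_pos by (intro powr_mono2) (auto simp: Lp_norm_def x_def)
    then show "norm x \<le> c powr p" using p_pos by (simp add: powr_powr)
  next
    assume "norm x \<le> c powr p"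
    then have "norm x powr (1 / p) \<le> (c powr p) powr (1 / p)" using p_pos by (intro powr_mono2) auto
    then show "Lnorm u \<le> c" using p_pos c by (simp add: Lp_norm_def x_def powr_powr)
  qed
  also have "\<dots> \<longleftrightarrow> (\<forall>t. kre (apply_bcontfun x t) \<le> c powr p)"
    using norm_bounded[of x] norm_bound[of x "c powr p"] unfolding nx by (meson order_trans)
  also have "\<dots> \<longleftrightarrow> (\<forall>t N. (\<Sum>n<N. sv u t n powr p) \<le> c powr p)"
  proof (intro iffI allI)
    fix t N assume "\<forall>t. kre (apply_bcontfun x t) \<le> c powr p"
    moreover have "(\<Sum>n<N. sv u t n powr p) \<le> kre (apply_bcontfun x t)"
      by (rule finite_sum_le_has_sum[OF rt]) auto
    ultimately show "(\<Sum>n<N. sv u t n powr p) \<le> c powr p" by (meson order_trans)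
  next
    fix t assume *: "\<forall>t N. (\<Sum>n<N. sv u t n powr p) \<le> c powr p"
    show "kre (apply_bcontfun x t) \<le> c powr p"
    proof (rule has_sum_le_finite_sums[OF rt])
      fix F :: "nat set" assume "finite F"
      then obtain N where "F \<subseteq> {..<N}" by (metis finite_nat_set_iff_bounded lessThan_iff subsetI)
      then have "(\<Sum>n\<in>F. sv u t n powr p) \<le> (\<Sum>n<N. sv u t n powr p)" by (intro sum_mono2) auto
      then show "(\<Sum>n\<in>F. sv u t n powr p) \<le> c powr p" using * by (meson order_trans)
    qed
  qed
  finally show ?thesis .
qed

lemma Lp_norm_nonneg: "0 \<le> Lnorm u"
  by (simp add: Lp_norm_def)

lemma Lp_norm_bound: "u \<in> L \<Longrightarrow> (\<Sum>n<N. sv u t n powr p) \<le> Lnorm u powr p"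
  using Lp_norm_le_iff[of u "Lnorm u"] Lp_norm_nonneg[of u] by blast

text \<open>The operator norm of a fibre is its largest singular value, a single term of the sum.
  This gives definiteness and turns Cauchy sequences for \<open>Lnorm\<close> into Cauchy sequences
  of fields.\<close>

lemma norm_Phi_le_Lp_norm:
  assumes "u \<in> L"
  shows "norm (Phi u t) \<le> Lnorm u"
proof -
  have "norm (Phi u t) powr p \<le> Lnorm u powr p"
    using Lp_norm_bound[OF assms, of t 1] by (simp add: norm_Phi_eq_sv[OF Lp_compact[OF assms]])
  then show ?thesis
    using powr_less_mono2[OF p_pos Lp_norm_nonneg[of u], of "norm (Phi u t)"] by (meson not_le)
qed

text \<open>\<open>\<theta>\<^sub>2\<^sub>n\<^sub>+\<^sub>1(u + w) \<le> \<theta>\<^sub>2\<^sub>n(u + w) \<le> \<theta>\<^sub>n(u) + \<theta>\<^sub>n(w)\<close> controls the tails of a sum uniformly.\<close>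

lemma tail_add:
  assumes u: "u \<in> compact_ops H" and w: "w \<in> compact_ops H"
  shows "(\<Sum>k\<in>{2 * N..<M}. sv (u + w) t k powr p)
    \<le> 2 * 2 powr p * ((\<Sum>n\<in>{N..<M}. sv u t n powr p) + (\<Sum>n\<in>{N..<M}. sv w t n powr p))"
proof -
  let ?s = "sv (u + w) t"
  have uw: "u + w \<in> compact_ops H" by (rule opv.subspace_add[OF compact_ops_subspace u w])
  have b: "?s k powr p \<le> 2 powr p * (sv u t n powr p + sv w t n powr p)" if "2 * n \<le> k" for n k
  proof -
    have "?s k \<le> ?s (n + n)" using sv_antimono[OF uw, of "n + n" k t] that by simp
    also have "\<dots> \<le> sv u t n + sv w t n" by (rule sv_add[OF u w])
    finally have "?s k powr p \<le> (sv u t n + sv w t n) powr p"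
      using p_pos sv_nonneg[OF uw] by (intro powr_mono2) auto
    also have "\<dots> \<le> 2 powr p * (sv u t n powr p + sv w t n powr p)"
      using p_pos sv_nonneg[OF u] sv_nonneg[OF w] by (intro powr_add_le) auto
    finally show ?thesis .
  qed
  have "(\<Sum>k\<in>{2 * N..<M}. ?s k powr p) \<le> (\<Sum>k\<in>{2 * N..<2 * M}. ?s k powr p)"
    by (rule sum_mono2) auto
  \<comment> \<open>Pairing \<open>2 * n\<close> with \<open>2 * n + 1\<close> produces the outer
    factor 2 of the bound; \<open>2 powr p\<close> comes from \<open>powr_add_le\<close>.\<close>
  also have "\<dots> = (\<Sum>n\<in>{N..<M}. ?s (2 * n) powr p + ?s (Suc (2 * n)) powr p)"
    by (rule sum_double_interval)
  also have "\<dots> \<le> (\<Sum>n\<in>{N..<M}. 2 powr p * (sv u t n powr p + sv w t n powr p) + 2 powr p * (sv u t n powr p + sv w t n powr p))"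
    by (intro sum_mono add_mono b) auto
  also have "\<dots> = 2 * 2 powr p * ((\<Sum>n\<in>{N..<M}. sv u t n powr p) + (\<Sum>n\<in>{N..<M}. sv w t n powr p))"
    by (simp add: sum.distrib sum_distrib_left algebra_simps)
  finally show ?thesis .
qed

text \<open>In \<open>u = w + (u - w)\<close> the tail of \<open>w\<close> is uniformly small by
  membership, and all sums for \<open>u - w\<close> are small by assumption. It serves for a limit
  whose membership is still open.\<close>

lemma Lp_approx:
  assumes u: "u \<in> compact_ops H"
    and approx: "\<And>\<epsilon>. \<epsilon> > 0 \<Longrightarrow> \<exists>w\<in>L. \<forall>t N. (\<Sum>n<N. sv (u - w) t n powr p) \<le> \<epsilon>"
  shows "u \<in> L"
  unfolding Lp_iff
proof (intro conjI u allI impI)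
  fix \<epsilon> :: real assume "\<epsilon> > 0"
  \<comment> \<open>The constant \<open>2 * 2 powr p\<close> of \<open>tail_add\<close> times the
    two contributions \<open>\<delta> + \<delta>\<close> is exactly
    \<open>\<epsilon>\<close>.\<close>
  define \<delta> where "\<delta> = \<epsilon> / (4 * 2 powr p)"
  have "\<delta> > 0" using \<open>\<epsilon> > 0\<close> by (simp add: \<delta>_def)
  obtain w where w: "w \<in> L" "\<forall>t N. (\<Sum>n<N. sv (u - w) t n powr p) \<le> \<delta>" using approx[OF \<open>\<delta> > 0\<close>] by blast
  have wc: "w \<in> compact_ops H" by (rule Lp_compact[OF w(1)])
  have uwc: "u - w \<in> compact_ops H" by (rule opv.subspace_diff[OF compact_ops_subspace u wc])
  obtain N where N: "\<forall>M t. (\<Sum>n\<in>{N..<M}. sv w t n powr p) \<le> \<delta>"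
    using w(1) \<open>\<delta> > 0\<close> unfolding Lp_iff by blast
  have "(\<Sum>n\<in>{2 * N..<M}. sv u t n powr p) \<le> \<epsilon>" for M t
  proof -
    have "w + (u - w) = u" by (rule add_diff_cancel_left'[THEN trans[OF add_diff_eq]])
    then have "(\<Sum>n\<in>{2 * N..<M}. sv u t n powr p)
        \<le> 2 * 2 powr p * ((\<Sum>n\<in>{N..<M}. sv w t n powr p) + (\<Sum>n\<in>{N..<M}. sv (u - w) t n powr p))"
      using tail_add[OF wc uwc, where t=t and N=N and M=M] by (simp only:)
    also have "\<dots> \<le> 2 * 2 powr p * (\<delta> + \<delta>)"
    proof (intro mult_left_mono add_mono)
      have "(\<Sum>n\<in>{N..<M}. sv (u - w) t n powr p) \<le> (\<Sum>n<M. sv (u - w) t n powr p)" by (rule sum_mono2) auto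
      also have "\<dots> \<le> \<delta>" using w(2) by blast
      finally show "(\<Sum>n\<in>{N..<M}. sv (u - w) t n powr p) \<le> \<delta>" .
    qed (use N in auto)
    also have "\<dots> = \<epsilon>" by (simp add: \<delta>_def)
    finally show ?thesis .
  qed
  then show "\<exists>N. \<forall>M t. (\<Sum>n\<in>{N..<M}. sv u t n powr p) \<le> \<epsilon>" by blast
qed

section \<open>Vector space structure and norm axioms\<close>

lemma sv_zero: "sv 0 t n = 0"
proof -
  have "schmidt (Phi 0 t) (\<lambda>_. 0) (\<lambda>_. 0) (\<lambda>_. 0)" unfolding adjointable_zero(2) by (rule schmidt_zero)
  from sv_eqI[OF adjointable_zero(1) this] show ?thesis by (simp only:)
qed

lemma Lp_subspace: "opv.subspace L"
proof (rule opv.subspaceI)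
  show "0 \<in> L"
    unfolding Lp_iff by (intro conjI opv.subspace_0 compact_ops_subspace) (auto simp only: sv_zero, simp)
next
  fix u w assume u: "u \<in> L" and w: "w \<in> L"
  show "u + w \<in> L"
    unfolding Lp_iff
  proof (intro conjI allI impI opv.subspace_add[OF compact_ops_subspace] Lp_compact u w)
    fix \<epsilon> :: real assume "\<epsilon> > 0"
    define \<delta> where "\<delta> = \<epsilon> / (4 * 2 powr p)"
    have "\<delta> > 0" using \<open>\<epsilon> > 0\<close> by (simp add: \<delta>_def)
    obtain N1 where N1: "\<forall>M t. (\<Sum>n\<in>{N1..<M}. sv u t n powr p) \<le> \<delta>"
      using u \<open>\<delta> > 0\<close> unfolding Lp_iff by blast
    obtain N2 where N2: "\<forall>M t. (\<Sum>n\<in>{N2..<M}. sv w t n powr p) \<le> \<delta>"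
      using w \<open>\<delta> > 0\<close> unfolding Lp_iff by blast
    define N where "N = max N1 N2"
    have "(\<Sum>n\<in>{2 * N..<M}. sv (u + w) t n powr p) \<le> \<epsilon>" for M t
    proof -
      have "(\<Sum>n\<in>{N..<M}. sv u t n powr p) \<le> (\<Sum>n\<in>{N1..<M}. sv u t n powr p)"
        by (rule sum_mono2) (auto simp: N_def)
      moreover have "(\<Sum>n\<in>{N..<M}. sv w t n powr p) \<le> (\<Sum>n\<in>{N2..<M}. sv w t n powr p)"
        by (rule sum_mono2) (auto simp: N_def)
      ultimately have "(\<Sum>n\<in>{N..<M}. sv u t n powr p) + (\<Sum>n\<in>{N..<M}. sv w t n powr p) \<le> \<delta> + \<delta>"
        using N1[rule_format, where M=M and t=t] N2[rule_format, where M=M and t=t] by linarith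
      then have "2 * 2 powr p * ((\<Sum>n\<in>{N..<M}. sv u t n powr p) + (\<Sum>n\<in>{N..<M}. sv w t n powr p)) \<le> 2 * 2 powr p * (\<delta> + \<delta>)"
        by (intro mult_left_mono) auto
      also have "\<dots> = \<epsilon>" by (simp add: \<delta>_def)
      finally show ?thesis using tail_add[OF Lp_compact[OF u] Lp_compact[OF w], where t=t and N=N and M=M] by linarith
    qed
    then show "\<exists>N. \<forall>M t. (\<Sum>n\<in>{N..<M}. sv (u + w) t n powr p) \<le> \<epsilon>" by blast
  qed
next
  fix c u assume u: "u \<in> L"
  show "op_scale c u \<in> L"
    unfolding Lp_iff
  proof (intro conjI allI impI opv.subspace_scale[OF compact_ops_subspace] Lp_compact u)
    fix \<epsilon> :: real assume "\<epsilon> > 0"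
    define \<delta> where "\<delta> = \<epsilon> / (norm c powr p + 1)"
    have c1: "norm c powr p + 1 > 0" by (simp add: add_nonneg_pos)
    then have "\<delta> > 0" using \<open>\<epsilon> > 0\<close> by (simp add: \<delta>_def)
    then obtain N where N: "\<forall>M t. (\<Sum>n\<in>{N..<M}. sv u t n powr p) \<le> \<delta>" using u unfolding Lp_iff by blast
    have "(\<Sum>n\<in>{N..<M}. sv (op_scale c u) t n powr p) \<le> \<epsilon>" for M t
    proof -
      have "(\<Sum>n\<in>{N..<M}. sv (op_scale c u) t n powr p) = norm c powr p * (\<Sum>n\<in>{N..<M}. sv u t n powr p)"
        by (simp add: sv_scale Lp_compact[OF u] powr_mult sv_nonneg sum_distrib_left)
      also have "\<dots> \<le> (norm c powr p + 1) * \<delta>"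
        using N \<open>\<delta> > 0\<close> by (intro mult_mono) (auto intro: sum_nonneg)
      also have "\<dots> = \<epsilon>" using c1 by (simp add: \<delta>_def)
      finally show ?thesis .
    qed
    then show "\<exists>N. \<forall>M t. (\<Sum>n\<in>{N..<M}. sv (op_scale c u) t n powr p) \<le> \<epsilon>" by blast
  qed
qed

lemma Lp_norm_scale_le:
  assumes u: "u \<in> L"
  shows "Lnorm (op_scale c u) \<le> norm c * Lnorm u"
proof (subst Lp_norm_le_iff)
  show "op_scale c u \<in> L" by (rule opv.subspace_scale[OF Lp_subspace u])
  show "\<forall>t N. (\<Sum>n<N. sv (op_scale c u) t n powr p) \<le> (norm c * Lnorm u) powr p"
  proof (intro allI)
    fix t N
    have "(\<Sum>n<N. sv (op_scale c u) t n powr p) = norm c powr p * (\<Sum>n<N. sv u t n powr p)"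
      by (simp add: sv_scale Lp_compact[OF u] powr_mult sv_nonneg sum_distrib_left)
    also have "\<dots> \<le> norm c powr p * Lnorm u powr p" by (intro mult_left_mono Lp_norm_bound u) auto
    finally show "(\<Sum>n<N. sv (op_scale c u) t n powr p) \<le> (norm c * Lnorm u) powr p"
      by (simp add: powr_mult Lp_norm_nonneg)
  qed
qed (simp add: Lp_norm_nonneg)

text \<open>The inequality for \<open>c\<close> together with the one for
  \<open>inverse c\<close>.\<close>

lemma Lp_norm_scale:
  assumes u: "u \<in> L"
  shows "Lnorm (op_scale c u) = norm c * Lnorm u"
proof (cases "c = 0")
  case True
  then show ?thesis using Lp_norm_scale_le[OF u, of c] Lp_norm_nonneg[of "op_scale c u"] by simp
next
  case False
  have "u = op_scale (inverse c) (op_scale c u)"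
    by (simp only: opv.scale_scale left_inverse[OF False] opv.scale_one)
  then have "Lnorm u \<le> norm (inverse c) * Lnorm (op_scale c u)"
    using Lp_norm_scale_le[OF opv.subspace_scale[OF Lp_subspace u], of "inverse c" c] by metis
  then have "norm c * Lnorm u \<le> norm c * (norm (inverse c) * Lnorm (op_scale c u))"
    by (intro mult_left_mono) auto
  also have "\<dots> = Lnorm (op_scale c u)" using False by (simp add: norm_inverse del: inverse_eq_divide)
  finally have "norm c * Lnorm u \<le> Lnorm (op_scale c u)" .
  then show ?thesis using Lp_norm_scale_le[OF u, of c] by simp
qed

lemma Lp_norm_triangle:
  assumes u: "u \<in> L" and w: "w \<in> L"
  shows "Lnorm (u + w) \<le> Lnorm u + Lnorm w"
proof (subst Lp_norm_le_iff)
  have uw: "u + w \<in> L" by (rule opv.subspace_add[OF Lp_subspace u w])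
  then show "u + w \<in> L" .
  show "\<forall>t N. (\<Sum>n<N. sv (u + w) t n powr p) \<le> (Lnorm u + Lnorm w) powr p"
  proof (intro allI)
    fix t N
    obtain e f where 1: "schmidt (Phi u t) (sv u t) e f" using sv_schmidt[OF Lp_compact[OF u]] by blast
    obtain e' f' where 2: "schmidt (Phi w t) (sv w t) e' f'" using sv_schmidt[OF Lp_compact[OF w]] by blast
    obtain e'' f'' where "schmidt (Phi (u + w) t) (sv (u + w) t) e'' f''"
      using sv_schmidt[OF Lp_compact[OF uw]] by blast
    then have 3: "schmidt (Phi u t + Phi w t) (sv (u + w) t) e'' f''"
      using u w by (simp only: adjointable_add(2) compact_ops_adjointable Lp_compact)
    show "(\<Sum>n<N. sv (u + w) t n powr p) \<le> (Lnorm u + Lnorm w) powr p"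
      by (rule schmidt_powr_sum_triangle[OF 1 2 3 p Lp_norm_nonneg Lp_norm_bound[OF u] Lp_norm_nonneg Lp_norm_bound[OF w]])
  qed
qed (simp add: Lp_norm_nonneg)

lemma Lp_norm_eq_0_iff:
  assumes u: "u \<in> L"
  shows "Lnorm u = 0 \<longleftrightarrow> u = 0"
proof
  assume 0: "Lnorm u = 0"
  have "Phi u t = Phi 0 t" for t
    using norm_Phi_le_Lp_norm[OF u, of t] 0 unfolding adjointable_zero(2) by simp
  then show "u = 0"
    by (rule adjointable_eqI[OF compact_ops_adjointable[OF Lp_compact[OF u]] adjointable_zero(1)])
next
  assume "u = 0"
  then have "u = op_scale 0 u" by (simp only: opv.scale_zero_left)
  then have "Lnorm u = norm (0::'k) * Lnorm u" using Lp_norm_scale[OF u, of 0] by metis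
  then show "Lnorm u = 0" by simp
qed

theorem norm_on_Lp: "norm_on L Lnorm"
  unfolding norm_on_def
  using Lp_norm_nonneg Lp_norm_eq_0_iff Lp_norm_scale Lp_norm_triangle by blast

lemma Lp_norm_minus_commute:
  assumes "u - w \<in> L"
  shows "w - u \<in> L" "Lnorm (w - u) = Lnorm (u - w)"
proof -
  have eq: "w - u = op_scale (- 1) (u - w)" unfolding op_uminus by (rule minus_diff_eq[symmetric])
  show "w - u \<in> L" unfolding eq by (rule opv.subspace_scale[OF Lp_subspace assms])
  show "Lnorm (w - u) = Lnorm (u - w)" unfolding eq Lp_norm_scale[OF assms] by simp
qed

section \<open>Completeness\<close>

lemma modH_diff: "\<xi> \<in> H \<Longrightarrow> \<eta> \<in> H \<Longrightarrow> \<xi> - \<eta> \<in> H"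
proof -
  assume "\<xi> \<in> H" "\<eta> \<in> H"
  moreover have "\<xi> - \<eta> = \<xi> + mscale \<eta> (const_bcontfun (- 1))"
    by (intro ext bcontfun_eqI) (simp add: mscale_def)
  ultimately show ?thesis by (simp only: modH_add modH_mscale)
qed

text \<open>Uniform limits of continuous sections are continuous and inherit the relation with
  \<open>P\<close>, so \<open>section_in_modH\<close> turns the limit into an element of
  \<open>H\<close>.\<close>

lemma modH_complete:
  assumes H: "\<And>n. \<xi> n \<in> H"
    and Cauchy: "\<And>\<epsilon>. \<epsilon> > 0 \<Longrightarrow> \<exists>n0. \<forall>m\<ge>n0. \<forall>n\<ge>n0. \<forall>t. dist (fib t (\<xi> m)) (fib t (\<xi> n)) < \<epsilon>"
  shows "\<exists>\<eta>\<in>H. \<forall>t. (\<lambda>n. fib t (\<xi> n)) \<longlonglongrightarrow> fib t \<eta>"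
proof -
  have "\<forall>\<epsilon>>0. \<exists>N. \<forall>m n t. N \<le> m \<and> N \<le> n \<and> True \<longrightarrow> dist (fib t (\<xi> m)) (fib t (\<xi> n)) < \<epsilon>"
    using Cauchy by meson
  then obtain X where X: "\<forall>\<epsilon>>0. \<exists>N. \<forall>n t. N \<le> n \<and> True \<longrightarrow> dist (fib t (\<xi> n)) (X t) < \<epsilon>"
    unfolding uniformly_convergent_eq_cauchy[symmetric] by blast
  then have lim: "uniform_limit UNIV (\<lambda>n t. fib t (\<xi> n)) X sequentially"
    unfolding uniform_limit_sequentially_iff by auto
  then have cont: "continuous_on UNIV X"
    by (rule uniform_limit_theorem[rotated]) (auto intro!: always_eventually fib_continuous H)
  have pt: "(\<lambda>n. fib t (\<xi> n)) \<longlonglongrightarrow> X t" for t by (rule tendsto_uniform_limitI[OF lim]) simp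
  have PX: "apply_bcontfun (P \<iota>) t * coord (X t) \<iota> = coord (X t) \<iota>" for \<iota> t
  proof (rule LIMSEQ_unique)
    have c: "(\<lambda>n. coord (fib t (\<xi> n)) \<iota>) \<longlonglongrightarrow> coord (X t) \<iota>"
      by (rule bounded_linear.tendsto[OF bounded_linear_coord pt])
    then show "(\<lambda>n. coord (fib t (\<xi> n)) \<iota>) \<longlonglongrightarrow> coord (X t) \<iota>" .
    have "(\<lambda>n. apply_bcontfun (P \<iota>) t * coord (fib t (\<xi> n)) \<iota>) \<longlonglongrightarrow> apply_bcontfun (P \<iota>) t * coord (X t) \<iota>"
      by (rule tendsto_mult_left[OF c])
    then show "(\<lambda>n. coord (fib t (\<xi> n)) \<iota>) \<longlonglongrightarrow> apply_bcontfun (P \<iota>) t * coord (X t) \<iota>"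
      by (simp only: P_fib[OF modH_subset_modK[OF H]])
  qed
  show ?thesis
    using section_in_modH[OF cont PX] pt by (intro bexI[of _ "\<lambda>\<iota>. Bcontfun (\<lambda>t. coord (X t) \<iota>)"]) auto
qed

text \<open>The limit needs an adjoint as well, so the adjoints \<open>v n\<close> are carried
  along; their differences obey the same fibrewise estimate as those of the \<open>w n\<close>, and
  one convergence argument treats both.\<close>

lemma compact_ops_complete:
  fixes w :: "nat \<Rightarrow> ('i, 't, 'k) oper"
  assumes w: "\<And>n. w n \<in> compact_ops H"
    and Cauchy: "\<And>\<epsilon>. \<epsilon> > 0 \<Longrightarrow> \<exists>n0. \<forall>m\<ge>n0. \<forall>n\<ge>n0. \<forall>t. norm (Phi (w m) t - Phi (w n) t) \<le> \<epsilon>"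
  shows "\<exists>u\<in>compact_ops H. \<forall>\<epsilon>>0. \<exists>n0. \<forall>n\<ge>n0. \<forall>t. norm (Phi (w n) t - Phi u t) \<le> \<epsilon>"
proof -
  note adj = compact_ops_adjointable[OF w]
  have "\<forall>n. \<exists>v. (\<forall>\<omega>\<in>H. v \<omega> \<in> H) \<and> (\<forall>\<zeta>\<in>H. \<forall>\<omega>\<in>H. minner (w n \<zeta>) \<omega> = minner \<zeta> (v \<omega>))"
    using adjointableD(6)[OF adj] by blast
  then obtain v where vH: "\<And>n \<omega>. \<omega> \<in> H \<Longrightarrow> v n \<omega> \<in> H"
    and v: "\<And>n \<zeta> \<omega>. \<zeta> \<in> H \<Longrightarrow> \<omega> \<in> H \<Longrightarrow> minner (w n \<zeta>) \<omega> = minner \<zeta> (v n \<omega>)" by metis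
  note wH = adjointableD(1)[OF adj] and K = modH_subset_modK
  have wv: "kinner (fib t (w n \<zeta>)) (fib t \<omega>) = kinner (fib t \<zeta>) (fib t (v n \<omega>))" if "\<zeta> \<in> H" "\<omega> \<in> H" for n \<zeta> \<omega> t
    using arg_cong[OF v[OF that, of n], of "\<lambda>f. apply_bcontfun f t"] that by (simp add: minner_apply K wH vH)
  have wdiff: "norm (fib t (w m \<zeta>) - fib t (w n \<zeta>)) \<le> norm (Phi (w m) t - Phi (w n) t) * norm (fib t \<zeta>)"
    if "\<zeta> \<in> H" for m n \<zeta> t
    using norm_blinfun[of "Phi (w m) t - Phi (w n) t" "fib t \<zeta>"] that
    by (simp add: fib_op[OF adj that] minus_blinfun.rep_eq)
  \<comment> \<open>Pairing the difference \<open>d\<close> of the adjoint values with itself and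
    moving the operators back bounds \<open>(norm d)\<^sup>2\<close> by a multiple of
    \<open>norm d\<close>.\<close>
  have vdiff: "norm (fib t (v m \<omega>) - fib t (v n \<omega>)) \<le> norm (Phi (w m) t - Phi (w n) t) * norm (fib t \<omega>)"
    if "\<omega> \<in> H" for m n \<omega> t
  proof -
    let ?\<zeta> = "v m \<omega> - v n \<omega>"
    have \<zeta>: "?\<zeta> \<in> H" by (intro modH_diff vH that)
    define d where "d = fib t ?\<zeta>"
    have d: "d = fib t (v m \<omega>) - fib t (v n \<omega>)" unfolding d_def by (intro fib_diff K vH that)
    have "norm d * norm d = norm (kinner d d)"
      by (simp only: kinner_self norm_of_real) (simp add: power2_eq_square)
    also have "kinner d d = kinner (fib t (w m ?\<zeta>) - fib t (w n ?\<zeta>)) (fib t \<omega>)"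
      unfolding kinner_diff_left wv[OF \<zeta> that] d_def[symmetric] kinner_diff_right[symmetric] d[symmetric] ..
    also have "norm \<dots> \<le> (norm (Phi (w m) t - Phi (w n) t) * norm d) * norm (fib t \<omega>)"
      unfolding d_def by (intro order_trans[OF kinner_cauchy_schwarz] mult_right_mono wdiff \<zeta>) simp
    finally have "norm d * norm d \<le> (norm (Phi (w m) t - Phi (w n) t) * norm (fib t \<omega>)) * norm d"
      by (simp add: mult_ac)
    then have "norm d \<le> norm (Phi (w m) t - Phi (w n) t) * norm (fib t \<omega>)"
      using mult_right_le_imp_le[of "norm d" "norm d"] by (cases "norm d = 0") auto
    then show ?thesis by (simp only: d)
  qed
  have conv: "\<exists>\<eta>\<in>H. \<forall>t. (\<lambda>n. fib t (x n \<zeta>)) \<longlonglongrightarrow> fib t \<eta>"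
    if \<zeta>: "\<zeta> \<in> H" and xH: "\<And>n. x n \<zeta> \<in> H"
      and xd: "\<And>m n t. norm (fib t (x m \<zeta>) - fib t (x n \<zeta>)) \<le> norm (Phi (w m) t - Phi (w n) t) * norm (fib t \<zeta>)"
    for x :: "nat \<Rightarrow> ('i, 't, 'k) oper" and \<zeta>
  proof (rule modH_complete[OF xH])
    fix \<epsilon> :: real assume "\<epsilon> > 0"
    obtain C where C: "C \<ge> 0" "\<forall>t. norm (fib t \<zeta>) \<le> C" using modK_norm_bounded[OF K[OF \<zeta>]] by blast
    define \<delta> where "\<delta> = \<epsilon> / (2 * (C + 1))"
    have "\<delta> > 0" using \<open>\<epsilon> > 0\<close> C by (simp add: \<delta>_def)
    then obtain n0 where n0: "\<forall>m\<ge>n0. \<forall>n\<ge>n0. \<forall>t. norm (Phi (w m) t - Phi (w n) t) \<le> \<delta>" using Cauchy by blast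
    have "dist (fib t (x m \<zeta>)) (fib t (x n \<zeta>)) < \<epsilon>" if "m \<ge> n0" "n \<ge> n0" for m n t
    proof -
      have "dist (fib t (x m \<zeta>)) (fib t (x n \<zeta>)) \<le> norm (Phi (w m) t - Phi (w n) t) * norm (fib t \<zeta>)"
        unfolding dist_norm by (rule xd)
      also have "\<dots> \<le> \<delta> * (C + 1)"
        using n0 that C \<open>\<delta> > 0\<close> by (intro mult_mono) (auto intro: order_trans[of _ C])
      also have "\<dots> = \<epsilon> / 2" using C(1) by (simp add: \<delta>_def field_simps)
      also have "\<dots> < \<epsilon>" using \<open>\<epsilon> > 0\<close> by simp
      finally show ?thesis .
    qed
    then show "\<exists>n0. \<forall>m\<ge>n0. \<forall>n\<ge>n0. \<forall>t. dist (fib t (x m \<zeta>)) (fib t (x n \<zeta>)) < \<epsilon>" by blast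
  qed
  have "\<exists>\<eta>. \<eta> \<in> H \<and> (\<forall>t. (\<lambda>n. fib t (w n \<zeta>)) \<longlonglongrightarrow> fib t \<eta>)" if "\<zeta> \<in> H" for \<zeta>
    using conv[where x=w and \<zeta>=\<zeta>, OF that wH[OF that] wdiff[OF that]] by blast
  then have "\<forall>\<zeta>\<in>H. \<exists>\<eta>. \<eta> \<in> H \<and> (\<forall>t. (\<lambda>n. fib t (w n \<zeta>)) \<longlonglongrightarrow> fib t \<eta>)" by blast
  from bchoice[OF this] obtain u0 where "\<forall>\<zeta>\<in>H. u0 \<zeta> \<in> H \<and> (\<forall>t. (\<lambda>n. fib t (w n \<zeta>)) \<longlonglongrightarrow> fib t (u0 \<zeta>))" ..
  then have u0: "\<And>\<zeta>. \<zeta> \<in> H \<Longrightarrow> u0 \<zeta> \<in> H" "\<And>\<zeta> t. \<zeta> \<in> H \<Longrightarrow> (\<lambda>n. fib t (w n \<zeta>)) \<longlonglongrightarrow> fib t (u0 \<zeta>)"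
    by simp_all
  have "\<exists>\<eta>. \<eta> \<in> H \<and> (\<forall>t. (\<lambda>n. fib t (v n \<zeta>)) \<longlonglongrightarrow> fib t \<eta>)" if "\<zeta> \<in> H" for \<zeta>
    using conv[where x=v and \<zeta>=\<zeta>, OF that vH[OF that] vdiff[OF that]] by blast
  then have "\<forall>\<zeta>\<in>H. \<exists>\<eta>. \<eta> \<in> H \<and> (\<forall>t. (\<lambda>n. fib t (v n \<zeta>)) \<longlonglongrightarrow> fib t \<eta>)" by blast
  from bchoice[OF this] obtain v0 where "\<forall>\<zeta>\<in>H. v0 \<zeta> \<in> H \<and> (\<forall>t. (\<lambda>n. fib t (v n \<zeta>)) \<longlonglongrightarrow> fib t (v0 \<zeta>))" ..
  then have v0: "\<And>\<zeta>. \<zeta> \<in> H \<Longrightarrow> v0 \<zeta> \<in> H" "\<And>\<zeta> t. \<zeta> \<in> H \<Longrightarrow> (\<lambda>n. fib t (v n \<zeta>)) \<longlonglongrightarrow> fib t (v0 \<zeta>)"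
    by simp_all
  define u where "u = (\<lambda>\<zeta>. if \<zeta> \<in> H then u0 \<zeta> else 0)"
  have uH: "u \<zeta> \<in> H" and ulim: "(\<lambda>n. fib t (w n \<zeta>)) \<longlonglongrightarrow> fib t (u \<zeta>)" if "\<zeta> \<in> H" for \<zeta> t
    using u0[OF that] that by (simp_all add: u_def)
  \<comment> \<open>The Cauchy condition at 1 bounds all later fibres by \<open>D + 1\<close>, and
    the limit inherits this bound.\<close>
  obtain n1 where n1: "\<forall>m\<ge>n1. \<forall>n\<ge>n1. \<forall>t. norm (Phi (w m) t - Phi (w n) t) \<le> 1" using Cauchy[of 1] by auto
  obtain D where D: "D \<ge> 0" "\<forall>t. norm (Phi (w n1) t) \<le> D" using adjointable_norm_bound[OF adj] by blast
  have uadj: "u \<in> adjointable_ops H"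
  proof (rule adjointableI[where v=v0 and C="D + 1"])
    show "u \<zeta> \<in> H" "v0 \<zeta> \<in> H" if "\<zeta> \<in> H" for \<zeta> using uH v0(1) that by auto
    show "u \<zeta> = 0" if "\<zeta> \<notin> H" for \<zeta> using that by (simp add: u_def)
    show "kinner (fib t (u \<zeta>)) (fib t \<omega>) = kinner (fib t \<zeta>) (fib t (v0 \<omega>))" if "\<zeta> \<in> H" "\<omega> \<in> H" for \<zeta> \<omega> t
    proof (rule LIMSEQ_unique)
      show "(\<lambda>n. kinner (fib t (w n \<zeta>)) (fib t \<omega>)) \<longlonglongrightarrow> kinner (fib t (u \<zeta>)) (fib t \<omega>)"
        by (intro tendsto_kinner tendsto_const ulim that)
      show "(\<lambda>n. kinner (fib t (w n \<zeta>)) (fib t \<omega>)) \<longlonglongrightarrow> kinner (fib t \<zeta>) (fib t (v0 \<omega>))"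
        unfolding wv[OF that] by (intro tendsto_kinner tendsto_const v0 that)
    qed
    show "0 \<le> D + 1" using D by simp
    show "norm (fib t (u \<zeta>)) \<le> (D + 1) * norm (fib t \<zeta>)" if "\<zeta> \<in> H" for \<zeta> t
    proof (rule LIMSEQ_le_const2[OF tendsto_norm[OF ulim[OF that]]])
      have "norm (fib t (w n \<zeta>)) \<le> (D + 1) * norm (fib t \<zeta>)" if "n \<ge> n1" for n
      proof -
        have "norm (Phi (w n) t) \<le> norm (Phi (w n1) t) + norm (Phi (w n) t - Phi (w n1) t)"
          by (metis add_diff_cancel_left' add_diff_eq norm_triangle_ineq)
        also have "\<dots> \<le> D + 1" using D(2) n1 that by (intro add_mono) auto
        finally show ?thesis
          unfolding fib_op[OF adj \<open>\<zeta> \<in> H\<close>] by (intro order_trans[OF norm_blinfun] mult_right_mono) auto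
      qed
      then show "\<exists>N. \<forall>n\<ge>N. norm (fib t (w n \<zeta>)) \<le> (D + 1) * norm (fib t \<zeta>)" by blast
    qed
  qed
  have lim: "\<exists>n0. \<forall>n\<ge>n0. \<forall>t. norm (Phi (w n) t - Phi u t) \<le> \<epsilon>" if pos: "\<epsilon> > 0" for \<epsilon>
  proof -
    obtain n0 where n0: "\<forall>m\<ge>n0. \<forall>n\<ge>n0. \<forall>t. norm (Phi (w m) t - Phi (w n) t) \<le> \<epsilon>"
      using Cauchy[OF pos] by blast
    have "norm (Phi (w n) t - Phi u t) \<le> \<epsilon>" if n: "n \<ge> n0" for n t
    proof (rule norm_blinfun_bound)
      fix x
      let ?x = "psi P (coord x)"
      have *: "blinfun_apply (Phi (w n) t - Phi u t) x = fib t (w n ?x) - fib t (u ?x)"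
        by (simp add: minus_blinfun.rep_eq Phi_apply uadj adj)
      have "(\<lambda>m. norm (fib t (w n ?x) - fib t (w m ?x))) \<longlonglongrightarrow> norm (fib t (w n ?x) - fib t (u ?x))"
        by (intro tendsto_intros ulim psi_in_modH)
      then show "norm (blinfun_apply (Phi (w n) t - Phi u t) x) \<le> \<epsilon> * norm x"
        unfolding *
      proof (rule LIMSEQ_le_const2)
        have "norm (fib t (w n ?x) - fib t (w m ?x)) \<le> \<epsilon> * norm x" if "m \<ge> n0" for m
        proof -
          have "norm (fib t (w n ?x) - fib t (w m ?x)) \<le> norm (Phi (w n) t - Phi (w m) t) * norm (fib t ?x)"
            by (rule wdiff[OF psi_in_modH])
          also have "\<dots> \<le> \<epsilon> * norm x"
            using n0 n that \<open>\<epsilon> > 0\<close> by (intro mult_mono norm_fib_psi_le) auto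
          finally show ?thesis .
        qed
        then show "\<exists>N. \<forall>m\<ge>N. norm (fib t (w n ?x) - fib t (w m ?x)) \<le> \<epsilon> * norm x" by blast
      qed
    qed (use \<open>\<epsilon> > 0\<close> in simp)
    then show ?thesis by blast
  qed
  have "u \<in> compact_ops H"
    unfolding compact_ops_iff
  proof (intro conjI uadj allI impI)
    fix \<epsilon> :: real assume "\<epsilon> > 0"
    then have "\<epsilon> / 2 > 0" by simp
    obtain n where n: "\<forall>t. norm (Phi (w n) t - Phi u t) \<le> \<epsilon> / 2" using lim[OF \<open>\<epsilon> / 2 > 0\<close>] by blast
    obtain z where z: "z \<in> finite_rank_ops" "\<forall>t. norm (Phi (w n) t - Phi z t) \<le> \<epsilon> / 2"
      using w[of n] \<open>\<epsilon> / 2 > 0\<close> unfolding compact_ops_iff by blast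
    have "norm (Phi u t - Phi z t) \<le> \<epsilon>" for t
      using norm_triangle_ineq4[of "Phi (w n) t - Phi z t" "Phi (w n) t - Phi u t"] n[rule_format, of t] z(2)[rule_format, of t]
      by simp
    then show "\<exists>v\<in>finite_rank_ops. \<forall>t. norm (Phi u t - Phi v t) \<le> \<epsilon>" using z(1) by blast
  qed
  then show ?thesis using lim by blast
qed

end

context schatten_family
begin

text \<open>Convergence of the fields in operator norm supplies a compact limit. That it lies in
  \<open>L\<close> and is the limit for \<open>Lnorm\<close> follows from a Fatou type argument on
  finite sums of singular values.\<close>

theorem complete_on_Lp: "complete_on L Lnorm"
  unfolding complete_on_def
proof (intro allI impI, elim conjE)
  fix w :: "nat \<Rightarrow> ('i, 't, 'k) oper"
  assume wL: "\<forall>n. w n \<in> L" and Cauchy: "\<forall>\<epsilon>>0. \<exists>n0. \<forall>m\<ge>n0. \<forall>n\<ge>n0. Lnorm (w m - w n) < \<epsilon>"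
  have wc: "w n \<in> compact_ops H" for n using wL Lp_compact by blast
  have diffL: "w m - w n \<in> L" for m n using wL opv.subspace_diff[OF Lp_subspace] by blast
  have Phi_diff: "Phi (a - b) t = Phi a t - Phi b t" if "a \<in> compact_ops H" "b \<in> compact_ops H" for a b t
    by (intro adjointable_diff(2) compact_ops_adjointable that)
  have "\<exists>n0. \<forall>m\<ge>n0. \<forall>n\<ge>n0. \<forall>t. norm (Phi (w m) t - Phi (w n) t) \<le> \<epsilon>" if pos: "\<epsilon> > 0" for \<epsilon>
  proof -
    obtain n0 where n0: "\<forall>m\<ge>n0. \<forall>n\<ge>n0. Lnorm (w m - w n) < \<epsilon>" using Cauchy pos by blast
    have "norm (Phi (w m) t - Phi (w n) t) \<le> \<epsilon>" if "m \<ge> n0" "n \<ge> n0" for m n t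
    proof -
      have "Lnorm (w m - w n) < \<epsilon>" using n0 that by blast
      then show ?thesis using norm_Phi_le_Lp_norm[OF diffL[of m n], of t] by (simp add: Phi_diff wc)
    qed
    then show ?thesis by blast
  qed
  from compact_ops_complete[OF wc this]
  obtain u where u: "u \<in> compact_ops H"
    and lim: "\<forall>\<epsilon>>0. \<exists>n0. \<forall>n\<ge>n0. \<forall>t. norm (Phi (w n) t - Phi u t) \<le> \<epsilon>" by blast
  have limt: "(\<lambda>m. Phi (w m) t) \<longlonglongrightarrow> Phi u t" for t
  proof (rule LIMSEQ_I)
    fix r :: real assume "r > 0"
    then have "r / 2 > 0" by simp
    then obtain n0 where "\<forall>n\<ge>n0. \<forall>t. norm (Phi (w n) t - Phi u t) \<le> r / 2" using lim by blast
    moreover have "r / 2 < r" using \<open>r > 0\<close> by simp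
    ultimately show "\<exists>no. \<forall>n\<ge>no. norm (Phi (w n) t - Phi u t) < r" by (meson order_le_less_trans)
  qed
  have uwc: "w n - u \<in> compact_ops H" for n by (rule opv.subspace_diff[OF compact_ops_subspace wc u])
  \<comment> \<open>For fixed \<open>n\<close> let \<open>m\<close> tend to infinity in each finite
    sum: the singular values converge by \<open>sv_lipschitz\<close>, and the bound does not depend
    on \<open>t\<close> or \<open>N\<close>.\<close>
  have bound: "\<exists>n0. \<forall>n\<ge>n0. \<forall>t N. (\<Sum>k<N. sv (w n - u) t k powr p) \<le> \<epsilon> powr p" if pos: "\<epsilon> > 0" for \<epsilon>
  proof -
    obtain n0 where n0: "\<forall>m\<ge>n0. \<forall>n\<ge>n0. Lnorm (w m - w n) < \<epsilon>" using Cauchy pos by blast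
    have "(\<Sum>k<N. sv (w n - u) t k powr p) \<le> \<epsilon> powr p" if n: "n \<ge> n0" for n t N
    proof (rule LIMSEQ_le_const2)
      have "(\<lambda>m. sv (w n - w m) t k) \<longlonglongrightarrow> sv (w n - u) t k" for k
      proof -
        have "norm (sv (w n - w m) t k - sv (w n - u) t k) \<le> norm (Phi (w m) t - Phi u t)" for m
        proof -
          have "w n - w m \<in> compact_ops H" by (rule Lp_compact[OF diffL])
          from sv_lipschitz[OF this uwc[of n], of t k t] show ?thesis
            by (simp add: Phi_diff wc u norm_minus_commute)
        qed
        moreover have "(\<lambda>m. norm (Phi (w m) t - Phi u t)) \<longlonglongrightarrow> 0" by (rule tendsto_norm_zero[OF LIM_zero[OF limt]])
        ultimately have "(\<lambda>m. sv (w n - w m) t k - sv (w n - u) t k) \<longlonglongrightarrow> 0"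
          by (rule Lim_null_comparison[OF always_eventually[OF allI]])
        then show ?thesis by (rule LIM_zero_cancel)
      qed
      then show "(\<lambda>m. \<Sum>k<N. sv (w n - w m) t k powr p) \<longlonglongrightarrow> (\<Sum>k<N. sv (w n - u) t k powr p)"
        using p_pos sv_nonneg[OF Lp_compact[OF diffL]]
        by (intro tendsto_sum tendsto_powr' tendsto_const) auto
      have "(\<Sum>k<N. sv (w n - w m) t k powr p) \<le> \<epsilon> powr p" if "m \<ge> n0" for m
      proof -
        have "Lnorm (w n - w m) \<le> \<epsilon>" using n0 n that by (simp add: less_imp_le)
        then show ?thesis using Lp_norm_le_iff[OF diffL less_imp_le[OF \<open>\<epsilon> > 0\<close>]] by blast
      qed
      then show "\<exists>M. \<forall>m\<ge>M. (\<Sum>k<N. sv (w n - w m) t k powr p) \<le> \<epsilon> powr p" by blast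
    qed
    then show ?thesis by blast
  qed
  have "u \<in> L"
  proof (rule Lp_approx[OF u])
    fix \<epsilon> :: real assume "\<epsilon> > 0"
    \<comment> \<open>\<open>Lp_approx\<close> bounds the sum of \<open>p\<close>-th powers,
      \<open>bound\<close> its \<open>p\<close>-th root.\<close>
    then have "\<epsilon> powr (1 / p) > 0" by simp
    from bound[OF this] obtain n where n: "\<forall>t N. (\<Sum>k<N. sv (w n - u) t k powr p) \<le> (\<epsilon> powr (1 / p)) powr p" by blast
    have e1: "(\<epsilon> powr (1 / p)) powr p = \<epsilon>" using p_pos \<open>\<epsilon> > 0\<close> by (simp add: powr_powr)
    have e2: "sv (u - w n) t k = sv (w n - u) t k" for t k
      using sv_minus[OF uwc[of n], of t k] by (simp only: minus_diff_eq)
    have "\<forall>t N. (\<Sum>k<N. sv (u - w n) t k powr p) \<le> \<epsilon>" using n unfolding e1 e2 .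
    then show "\<exists>w\<in>L. \<forall>t N. (\<Sum>k<N. sv (u - w) t k powr p) \<le> \<epsilon>" using wL by blast
  qed
  have uL: "w n - u \<in> L" for n by (rule opv.subspace_diff[OF Lp_subspace]) (use wL \<open>u \<in> L\<close> in auto)
  have "(\<lambda>n. Lnorm (w n - u)) \<longlonglongrightarrow> 0"
  proof (rule LIMSEQ_I)
    fix r :: real assume "r > 0"
    then have "r / 2 > 0" by simp
    from bound[OF this] obtain n0 where n0: "\<forall>n\<ge>n0. \<forall>t N. (\<Sum>k<N. sv (w n - u) t k powr p) \<le> (r / 2) powr p" by blast
    have "norm (Lnorm (w n - u) - 0) < r" if "n \<ge> n0" for n
    proof -
      have "Lnorm (w n - u) \<le> r / 2"
        using Lp_norm_le_iff[OF uL less_imp_le[OF \<open>r / 2 > 0\<close>]] n0 that by blast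
      then show ?thesis using Lp_norm_nonneg[of "w n - u"] \<open>r > 0\<close> by simp
    qed
    then show "\<exists>no. \<forall>n\<ge>no. norm (Lnorm (w n - u) - 0) < r" by blast
  qed
  with \<open>u \<in> L\<close> show "\<exists>u\<in>L. (\<lambda>n. Lnorm (w n - u)) \<longlonglongrightarrow> 0" by blast
qed

section \<open>Schatten decompositions\<close>

text \<open>Decompositions converge in the norm of operators on \<open>K\<close>; only its values on \<open>H\<close> are needed, but
  the supremum defining it is meaningful only after checking boundedness on the unit ball of \<open>K\<close>.\<close>

lemma schatten_partial_sums_bounded:
  assumes \<xi>: "\<And>n. \<xi> n \<in> H" and \<eta>: "\<And>n. \<eta> n \<in> H"
  shows "\<exists>D\<ge>0. \<forall>\<zeta>\<in>K. mnorm \<zeta> \<le> 1 \<longrightarrow>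
    (\<Sum>n<N. schatten_term P K u \<xi> \<eta> n) \<zeta> \<in> K \<and> (\<forall>t. norm (fib t ((\<Sum>n<N. schatten_term P K u \<xi> \<eta> n) \<zeta>)) \<le> D)"
proof (induction N)
  case 0
  have "0 \<in> K" by (rule modH_subset_modK[OF modH_0])
  moreover have "(\<Sum>n<0. schatten_term P K u \<xi> \<eta> n) \<zeta> = 0" for \<zeta> by simp
  ultimately show ?case by (intro exI[of _ 0] conjI ballI impI allI) (simp_all only: fib_0 norm_zero order_refl)
next
  case (Suc N)
  note HK = modH_subset_modK
  let ?S = "\<lambda>N. \<Sum>n<N. schatten_term P K u \<xi> \<eta> n"
  obtain D where D: "D \<ge> 0" "\<And>\<zeta>. \<zeta> \<in> K \<Longrightarrow> mnorm \<zeta> \<le> 1 \<Longrightarrow> ?S N \<zeta> \<in> K"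
    "\<And>\<zeta> t. \<zeta> \<in> K \<Longrightarrow> mnorm \<zeta> \<le> 1 \<Longrightarrow> norm (fib t (?S N \<zeta>)) \<le> D" using Suc.IH by blast
  define \<xi>' where "\<xi>' = mscale (\<xi> N) (theta P u N)"
  have \<xi>': "\<xi>' \<in> K" unfolding \<xi>'_def by (intro modK_mscale HK \<xi>)
  obtain A where A: "A \<ge> 0" "\<And>t. norm (fib t \<xi>') \<le> A" using modK_norm_bounded[OF \<xi>'] by blast
  obtain B where B: "B \<ge> 0" "\<And>t. norm (fib t (\<eta> N)) \<le> B" using modK_norm_bounded[OF HK[OF \<eta>]] by blast
  have S: "?S (Suc N) \<zeta> = ?S N \<zeta> + mscale \<xi>' (minner \<zeta> (\<eta> N))" if "\<zeta> \<in> K" for \<zeta>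
    using that by (simp add: schatten_term_def rank_one_def \<xi>'_def)
  have tK: "mscale \<xi>' (minner \<zeta> (\<eta> N)) \<in> K" for \<zeta> by (rule modK_mscale[OF \<xi>'])
  have t: "norm (fib t (mscale \<xi>' (minner \<zeta> (\<eta> N)))) \<le> B * A" if "\<zeta> \<in> K" "mnorm \<zeta> \<le> 1" for \<zeta> t
  proof -
    have "norm (kinner (fib t \<zeta>) (fib t (\<eta> N))) \<le> norm (fib t \<zeta>) * norm (fib t (\<eta> N))" by (rule kinner_cauchy_schwarz)
    also have "\<dots> \<le> 1 * B"
      using norm_fib_le_mnorm[OF that(1), of t] that(2) B by (intro mult_mono) auto
    finally show ?thesis
      using A B by (simp add: fib_mscale[OF \<xi>'] minner_apply[OF that(1) \<eta>] mult_mono)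
  qed
  have "?S (Suc N) \<zeta> \<in> K \<and> (\<forall>t. norm (fib t (?S (Suc N) \<zeta>)) \<le> D + B * A)" if "\<zeta> \<in> K" "mnorm \<zeta> \<le> 1" for \<zeta>
    unfolding S[OF that(1)]
    by (intro conjI allI modK_add D(2) that tK)
      (simp only: fib_add[OF D(2)[OF that] tK], intro norm_triangle_le add_mono D(3) t that)
  moreover have "0 \<le> D + B * A" using D(1) A(1) B(1) by simp
  ultimately show ?case by blast
qed

text \<open>On \<open>H\<close> both operators agree with those on \<open>K\<close>, and the unit
  ball of \<open>H\<close> lies in that of \<open>K\<close>; this transfers convergence from
  \<open>K\<close> to the fibres.\<close>

lemma opnorm_restrict_le:
  assumes \<xi>: "\<And>n. \<xi> n \<in> H" and \<eta>: "\<And>n. \<eta> n \<in> H" and v: "v \<in> compact_ops K" and vu: "\<And>\<zeta>. \<zeta> \<in> H \<Longrightarrow> v \<zeta> = u \<zeta>"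
    and w: "(\<Sum>n<N. schatten_term P H u \<xi> \<eta> n) - u \<in> adjointable_ops H"
  shows "norm (Phi ((\<Sum>n<N. schatten_term P H u \<xi> \<eta> n) - u) t)
    \<le> opnorm K ((\<Sum>n<N. schatten_term P K u \<xi> \<eta> n) - v)"
proof -
  let ?S = "\<Sum>n<N. schatten_term P K u \<xi> \<eta> n" and ?A = "\<Sum>n<N. schatten_term P H u \<xi> \<eta> n"
  note HK = modH_subset_modK
  obtain D where D: "D \<ge> 0" "\<And>\<zeta>. \<zeta> \<in> K \<Longrightarrow> mnorm \<zeta> \<le> 1 \<Longrightarrow> ?S \<zeta> \<in> K"
    "\<And>\<zeta> t. \<zeta> \<in> K \<Longrightarrow> mnorm \<zeta> \<le> 1 \<Longrightarrow> norm (fib t (?S \<zeta>)) \<le> D"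
    using schatten_partial_sums_bounded[where \<xi>=\<xi> and \<eta>=\<eta> and N=N and u=u, OF \<xi> \<eta>] by blast
  have va: "v \<in> adjointable_ops K" using v by (simp add: compact_ops_def)
  then have vK: "\<And>\<zeta>. \<zeta> \<in> K \<Longrightarrow> v \<zeta> \<in> K" unfolding adjointable_ops_def by blast
  obtain C where C: "\<And>\<zeta>. \<zeta> \<in> K \<Longrightarrow> mnorm (v \<zeta>) \<le> C * mnorm \<zeta>" using va unfolding adjointable_ops_def by blast
  have bdd: "bdd_above ((\<lambda>\<zeta>. mnorm ((?S - v) \<zeta>)) ` {\<zeta>\<in>K. mnorm \<zeta> \<le> 1})"
  proof (rule bdd_aboveI2[where M="D + \<bar>C\<bar>"])
    fix \<zeta> assume "\<zeta> \<in> {\<zeta>\<in>K. mnorm \<zeta> \<le> 1}"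
    then have \<zeta>: "\<zeta> \<in> K" "mnorm \<zeta> \<le> 1" by auto
    have eq: "(?S - v) \<zeta> = ?S \<zeta> - v \<zeta>" by (rule fun_diff_def[THEN fun_cong])
    have "norm (fib t (?S \<zeta> - v \<zeta>)) \<le> D + \<bar>C\<bar>" for t
    proof -
      have "norm (fib t (v \<zeta>)) \<le> mnorm (v \<zeta>)" by (rule norm_fib_le_mnorm[OF vK[OF \<zeta>(1)]])
      also have "\<dots> \<le> C * mnorm \<zeta>" by (rule C[OF \<zeta>(1)])
      also have "\<dots> \<le> \<bar>C\<bar> * 1" using \<zeta>(2) by (intro mult_mono) auto
      finally have "norm (fib t (v \<zeta>)) \<le> \<bar>C\<bar>" by simp
      then show ?thesis
        unfolding fib_diff[OF D(2)[OF \<zeta>] vK[OF \<zeta>(1)]] using norm_triangle_ineq4 D(3)[OF \<zeta>, of t]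
        by (meson add_mono order_trans)
    qed
    moreover have "?S \<zeta> - v \<zeta> \<in> K"
    proof -
      have "?S \<zeta> - v \<zeta> = ?S \<zeta> + mscale (v \<zeta>) (const_bcontfun (- 1))"
        by (intro ext bcontfun_eqI) (simp add: mscale_def)
      then show ?thesis using modK_add[OF D(2)[OF \<zeta>] modK_mscale[OF vK[OF \<zeta>(1)]]] by metis
    qed
    ultimately show "mnorm ((?S - v) \<zeta>) \<le> D + \<bar>C\<bar>"
      unfolding eq using D(1) by (subst mnorm_le_iff) auto
  qed
  have AS: "?A \<zeta> = ?S \<zeta>" if "\<zeta> \<in> H" for \<zeta>
    using that by (induction N) (simp_all add: schatten_term_def rank_one_def HK)
  have le: "mnorm ((?A - u) \<zeta>) \<le> opnorm K (?S - v)" if "\<zeta> \<in> H" "mnorm \<zeta> \<le> 1" for \<zeta>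
  proof -
    have "(?A - u) \<zeta> = (?S - v) \<zeta>" using AS[OF that(1)] vu[OF that(1)] by (simp only: fun_diff_def)
    moreover have "mnorm ((?S - v) \<zeta>) \<le> opnorm K (?S - v)"
      unfolding opnorm_def by (rule cSUP_upper[OF _ bdd]) (use that HK in auto)
    ultimately show ?thesis by (simp only:)
  qed
  have m0: "mnorm (0 :: ('i, 't, 'k) family) \<le> 1"
    using mnorm_le_iff[OF modH_subset_modK[OF modH_0], of 1] by (simp only: fib_0 norm_zero) simp
  have "0 \<le> opnorm K (?S - v)" using le[OF modH_0 m0] mnorm_nonneg order_trans by blast
  moreover have "opnorm H (?A - u) \<le> opnorm K (?S - v)"
    unfolding opnorm_def[of H] using modH_0 m0 le by (intro cSUP_least) auto
  ultimately show ?thesis using opnorm_le_iff[OF w] by blast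
qed

text \<open>At each point the two \<open>u\<close>-orthonormal sequences form, after removing the
  indices with vanishing singular value, a Schmidt decomposition of the fibre of \<open>u\<close>.
  Dropping its first \<open>N\<close> terms leaves one of the remainder, and uniqueness of singular
  values identifies the remainder's sequence.\<close>

theorem schatten_series:
  assumes u: "u \<in> L" and dec: "schatten_decomposition P u \<xi> \<eta>" and H: "\<And>n. \<xi> n \<in> H" "\<And>n. \<eta> n \<in> H"
  shows "schatten_term P H u \<xi> \<eta> n \<in> L"
    "(\<lambda>N. Lnorm ((\<Sum>n<N. schatten_term P H u \<xi> \<eta> n) - u)) \<longlonglongrightarrow> 0"
proof -
  note HK = modH_subset_modK
  define A where "A = (\<lambda>N. \<Sum>n<N. schatten_term P H u \<xi> \<eta> n)"
  have uc: "u \<in> compact_ops H" by (rule Lp_compact[OF u])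
  have ua: "u \<in> adjointable_ops H" by (rule compact_ops_adjointable[OF uc])
  have trm: "schatten_term P H u \<xi> \<eta> n \<in> finite_rank_ops" for n
    unfolding schatten_term_def by (rule opv.span_base) (use modH_mscale H in blast)
  have fr: "A N \<in> finite_rank_ops" for N unfolding A_def by (intro opv.span_sum trm)
  have Aa: "A N \<in> adjointable_ops H" for N using finite_rank_ops[OF fr] by blast
  have Ac: "A N \<in> compact_ops H" for N
    unfolding compact_ops_iff using fr[of N] Aa[of N] by (auto intro!: bexI[of _ "A N"])
  have PhiA: "blinfun_apply (Phi (A N) t) x =
      (\<Sum>n<N. ksc (of_real (sv u t n) * kinner x (fib t (\<eta> n))) (fib t (\<xi> n)))" for N t x
  proof (induction N)
    case 0
    have "A 0 = 0" by (simp only: A_def lessThan_0 sum.empty)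
    then show ?case by (simp only: adjointable_zero(2)) simp
  next
    case (Suc N)
    note r = rank_one_adjointable[OF modH_mscale[OF H(1)] H(2)]
    have "A (Suc N) = A N + schatten_term P H u \<xi> \<eta> N" by (simp only: A_def sum.lessThan_Suc)
    then have "Phi (A (Suc N)) t = Phi (A N) t + Phi (schatten_term P H u \<xi> \<eta> N) t"
      using adjointable_add(2)[OF Aa r(1)] by (simp only: schatten_term_def)
    then show ?case
      using Suc by (simp add: plus_blinfun.rep_eq schatten_term_def r(2) fib_mscale HK[OF H(1)] apply_theta[OF uc] mult.commute)
  qed
  obtain v where v: "v \<in> compact_ops K" "\<And>\<zeta>. \<zeta> \<in> H \<Longrightarrow> v \<zeta> = u \<zeta>"
    and lim: "(\<lambda>N. opnorm K ((\<Sum>n<N. schatten_term P K u \<xi> \<eta> n) - v)) \<longlonglongrightarrow> 0"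
    using dec unfolding schatten_decomposition_def by blast
  have PhiAu: "(\<lambda>N. Phi (A N) t) \<longlonglongrightarrow> Phi u t" for t
  proof -
    have "norm (Phi (A N) t - Phi u t) \<le> opnorm K ((\<Sum>n<N. schatten_term P K u \<xi> \<eta> n) - v)" for N
      using opnorm_restrict_le[where \<xi>=\<xi> and \<eta>=\<eta> and v=v and u=u and N=N and t=t, OF H v]
        adjointable_diff[OF Aa ua, of N] by (simp only: A_def)
    then have "(\<lambda>N. Phi (A N) t - Phi u t) \<longlonglongrightarrow> 0"
      by (rule Lim_null_comparison[OF always_eventually[OF allI] lim])
    then show ?thesis by (rule LIM_zero_cancel)
  qed
  \<comment> \<open>A point with non-zero singular value lies in the clopen closure of
    \<open>U_set\<close>, where the indicator is 1; hence the vectors there are unit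
    vectors.\<close>
  have e_proj: "apply_bcontfun (e_proj P u n) t = 1" if "sv u t n \<noteq> 0" for n t
  proof -
    have "open (U_set P u n)"
      unfolding U_set_def by (intro open_Collect_neq sv_continuous[OF uc] continuous_on_const)
    then have "open (closure (U_set P u n))" by (rule hyperstonian_open_closure[OF hyperstonian])
    then have "continuous_on UNIV (indicator (closure (U_set P u n)) :: 't \<Rightarrow> 'k)"
      by (intro continuous_on_indicator_clopen closed_closure)
    then have "apply_bcontfun (e_proj P u n) t = indicator (closure (U_set P u n)) t"
      unfolding e_proj_def by (rule apply_Bcontfun_T)
    moreover have "t \<in> closure (U_set P u n)"
      by (rule closure_subset[THEN subsetD]) (use that in \<open>simp add: U_set_def\<close>)
    ultimately show ?thesis by simp
  qed
  \<comment> \<open>On the boundary of \<open>U_set\<close> the singular value is 0 while the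
    vectors still have norm 1. A Schmidt decomposition demands zero vectors there, and resetting
    them leaves the terms unchanged because of the factor \<open>sv u t n\<close>.\<close>
  define sys where "sys = (\<lambda>(\<alpha> :: nat \<Rightarrow> ('i, 't, 'k) family) t n. if sv u t n = 0 then 0 else fib t (\<alpha> n))"
  have onz: "onz (sys \<alpha> t)" and sys0: "sys \<alpha> t n = 0 \<longleftrightarrow> sv u t n = 0"
    if \<alpha>: "u_orthonormal P u \<alpha>" "\<And>n. \<alpha> n \<in> H" for \<alpha> t n
  proof -
    have ip: "kinner (fib t (\<alpha> m)) (fib t (\<alpha> n)) = (if m = n then apply_bcontfun (e_proj P u n) t else 0)" if "m \<le> n" for m n
    proof -
      have "minner (\<alpha> m) (\<alpha> n) = (if m = n then e_proj P u n else 0)"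
        using \<alpha>(1) that unfolding u_orthonormal_def by blast
      then show ?thesis
        using minner_apply[OF HK[OF \<alpha>(2)] \<alpha>(2), of m n t] by auto
    qed
    have ne: "fib t (\<alpha> n) \<noteq> 0" if "sv u t n \<noteq> 0" for n
      using ip[of n n] e_proj[OF that] by auto
    then show "sys \<alpha> t n = 0 \<longleftrightarrow> sv u t n = 0" by (simp add: sys_def)
    show "onz (sys \<alpha> t)"
      unfolding onz_def
    proof (intro allI)
      fix m n
      show "kinner (sys \<alpha> t m) (sys \<alpha> t n) = (if m = n \<and> sys \<alpha> t n \<noteq> 0 then 1 else 0)"
      proof (cases m n rule: linorder_cases)
        case less
        then show ?thesis using ip[of m n] by (simp add: sys_def)
      next
        case equal
        then show ?thesis using ip[of n n] e_proj[of t n] ne[of n] by (simp add: sys_def)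
      next
        case greater
        then have "kinner (fib t (\<alpha> m)) (fib t (\<alpha> n)) = 0"
          using ip[of n m] kinner_commute[of "fib t (\<alpha> m)" "fib t (\<alpha> n)"] by simp
        then show ?thesis using greater by (simp add: sys_def)
      qed
    qed
  qed
  have orth: "u_orthonormal P u \<xi>" "u_orthonormal P u \<eta>"
    using dec unfolding schatten_decomposition_def by blast+
  have sv_tail: "sv (u - A N) t k = sv u t (k + N)" for N t k
  proof -
    let ?s = "sv u t"
    obtain e0 f0 where S0: "schmidt (Phi u t) ?s e0 f0" using sv_schmidt[OF uc] by blast
    let ?term = "\<lambda>x n. ksc (of_real (?s n) * kinner x (sys \<eta> t n)) (sys \<xi> t n)"
    have pA: "blinfun_apply (Phi (A M) t) x = (\<Sum>n<M. ?term x n)" for M x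
      unfolding PhiA by (rule sum.cong) (auto simp: sys_def)
    have "schmidt (Phi (u - A N) t) (\<lambda>k. ?s (k + N)) (\<lambda>k. sys \<eta> t (k + N)) (\<lambda>k. sys \<xi> t (k + N))"
      unfolding schmidt_def
    proof (intro conjI allI)
      show "decseq (\<lambda>k. ?s (k + N))" using schmidtD(1)[OF S0] by (simp add: decseq_def)
      show "(\<lambda>k. ?s (k + N)) \<longlonglongrightarrow> 0" by (rule LIMSEQ_ignore_initial_segment[OF schmidtD(2)[OF S0]])
      show "onz (\<lambda>k. sys \<eta> t (k + N))" using onz[OF orth(2) H(2), of t] by (simp add: onz_def)
      show "onz (\<lambda>k. sys \<xi> t (k + N))" using onz[OF orth(1) H(1), of t] by (simp add: onz_def)
      show "sys \<eta> t (k + N) = 0 \<longleftrightarrow> ?s (k + N) = 0" "sys \<xi> t (k + N) = 0 \<longleftrightarrow> ?s (k + N) = 0" for k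
        using sys0 orth H by auto
      fix x
      have "(\<lambda>M. blinfun_apply (Phi (A (M + N)) t) x - blinfun_apply (Phi (A N) t) x)
          \<longlonglongrightarrow> blinfun_apply (Phi u t) x - blinfun_apply (Phi (A N) t) x"
        by (intro tendsto_diff tendsto_const blinfun.tendsto LIMSEQ_ignore_initial_segment[OF PhiAu])
      moreover have "blinfun_apply (Phi (A (M + N)) t) x - blinfun_apply (Phi (A N) t) x = (\<Sum>k<M. ?term x (k + N))" for M
      proof -
        have "(\<Sum>n<M + N. ?term x n) = (\<Sum>n<N. ?term x n) + (\<Sum>k<M. ?term x (k + N))"
          by (induction M) (simp_all add: add.assoc)
        then show ?thesis by (simp add: pA)
      qed
      ultimately show "(\<lambda>M. \<Sum>k<M. ?term x (k + N)) \<longlonglongrightarrow> blinfun_apply (Phi (u - A N) t) x"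
        by (simp only: adjointable_diff(2)[OF ua Aa] minus_blinfun.rep_eq)
    qed
    from sv_eqI[OF adjointable_diff(1)[OF ua Aa] this] show ?thesis by (simp only:)
  qed
  have shift: "(\<Sum>k\<in>{M..<M'}. sv u t (k + N) powr p) = (\<Sum>k\<in>{M + N..<M' + N}. sv u t k powr p)" for M M' N t
    by (rule sum.shift_bounds_nat_ivl[symmetric])
  have uA: "u - A N \<in> L" for N
    unfolding Lp_iff
  proof (intro conjI allI impI opv.subspace_diff[OF compact_ops_subspace] uc Ac)
    fix \<epsilon> :: real assume "\<epsilon> > 0"
    then obtain M where M: "\<forall>M' t. (\<Sum>n\<in>{M..<M'}. sv u t n powr p) \<le> \<epsilon>" using u unfolding Lp_iff by blast
    have "(\<Sum>n\<in>{M..<M'}. sv (u - A N) t n powr p) \<le> \<epsilon>" for M' t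
    proof -
      have "(\<Sum>n\<in>{M..<M'}. sv (u - A N) t n powr p) \<le> (\<Sum>n\<in>{M..<M' + N}. sv u t n powr p)"
        unfolding sv_tail shift by (rule sum_mono2) auto
      also have "\<dots> \<le> \<epsilon>" using M by blast
      finally show ?thesis .
    qed
    then show "\<exists>M. \<forall>M' t. (\<Sum>n\<in>{M..<M'}. sv (u - A N) t n powr p) \<le> \<epsilon>" by blast
  qed
  \<comment> \<open>A single term is a difference of two successive remainders, which are already
    known to lie in \<open>L\<close>.\<close>
  have "schatten_term P H u \<xi> \<eta> n = (u - A n) - (u - A (Suc n))"
    unfolding A_def sum.lessThan_Suc by (intro ext) simp
  then show "schatten_term P H u \<xi> \<eta> n \<in> L"
    using opv.subspace_diff[OF Lp_subspace uA uA] by metis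
  have "(\<lambda>N. Lnorm (A N - u)) \<longlonglongrightarrow> 0"
  proof (rule LIMSEQ_I)
    fix r :: real assume "r > 0"
    then have r2: "r / 2 > 0" by simp
    then have "(r / 2) powr p > 0" by simp
    then obtain M where M: "\<forall>M' t. (\<Sum>n\<in>{M..<M'}. sv u t n powr p) \<le> (r / 2) powr p" using u unfolding Lp_iff by blast
    have "norm (Lnorm (A N - u) - 0) < r" if "N \<ge> M" for N
    proof -
      have "(\<Sum>n<M'. sv (u - A N) t n powr p) \<le> (r / 2) powr p" for t M'
      proof -
        have "(\<Sum>n<M'. sv (u - A N) t n powr p) = (\<Sum>k\<in>{0 + N..<M' + N}. sv u t k powr p)"
          unfolding sv_tail lessThan_atLeast0 by (rule shift)
        also have "\<dots> \<le> (\<Sum>k\<in>{M..<M' + N}. sv u t k powr p)" by (rule sum_mono2) (use that in auto)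
        also have "\<dots> \<le> (r / 2) powr p" using M by blast
        finally show ?thesis .
      qed
      then have "Lnorm (u - A N) \<le> r / 2" using Lp_norm_le_iff[OF uA less_imp_le[OF r2]] by blast
      then show ?thesis
        using Lp_norm_minus_commute(2)[OF uA] Lp_norm_nonneg[of "u - A N"] \<open>r > 0\<close> by simp
    qed
    then show "\<exists>no. \<forall>N\<ge>no. norm (Lnorm (A N - u) - 0) < r" by blast
  qed
  then show "(\<lambda>N. Lnorm ((\<Sum>n<N. schatten_term P H u \<xi> \<eta> n) - u)) \<longlonglongrightarrow> 0" by (simp only: A_def)
qed

end

theorem theorem3p6:
  fixes P :: "'i \<Rightarrow> ('t::t2_space \<Rightarrow>\<^sub>C 'k::rc_scalar)"
    and p :: real
  assumes "hyperstonian TYPE('t)"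
    and "\<And>\<iota>. cprojection (P \<iota>)"
    and "1 \<le> p"
  shows "(Lp P p \<subseteq> compact_ops (modH P) \<and> opv.subspace (Lp P p) \<and> norm_on (Lp P p) (Lp_norm P p))
    \<and> complete_on (Lp P p) (Lp_norm P p)
    \<and> (\<forall>u \<in> Lp P p. \<forall>\<xi> \<eta>.
          schatten_decomposition P u \<xi> \<eta> \<and> (\<forall>n. \<xi> n \<in> modH P \<and> \<eta> n \<in> modH P) \<longrightarrow>
          (\<forall>n. schatten_term P (modH P) u \<xi> \<eta> n \<in> Lp P p) \<and>
          (\<lambda>N. Lp_norm P p ((\<Sum>n<N. schatten_term P (modH P) u \<xi> \<eta> n) - u)) \<longlonglongrightarrow> 0)"
proof -
  interpret schatten_family P p
    by unfold_locales (use assms in auto)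
  show ?thesis
  proof (intro conjI ballI allI impI)
    show "Lp P p \<subseteq> compact_ops (modH P)" using Lp_compact by blast
    fix u \<xi> \<eta>
    assume u: "u \<in> Lp P p"
      and dec: "schatten_decomposition P u \<xi> \<eta> \<and> (\<forall>n. \<xi> n \<in> modH P \<and> \<eta> n \<in> modH P)"
    then have d: "schatten_decomposition P u \<xi> \<eta>" and H: "\<And>n. \<xi> n \<in> modH P" "\<And>n. \<eta> n \<in> modH P" by auto
    show "schatten_term P (modH P) u \<xi> \<eta> n \<in> Lp P p" for n by (rule schatten_series(1)[OF u d H])
    show "(\<lambda>N. Lp_norm P p ((\<Sum>n<N. schatten_term P (modH P) u \<xi> \<eta> n) - u)) \<longlonglongrightarrow> 0"
      by (rule schatten_series(2)[OF u d H])
  qed (rule Lp_subspace norm_on_Lp complete_on_Lp)+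
qed

end
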